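(* Let $R$ be a standard graded $K$-algebra over a field $K$ with maximal homogeneous ideal $\mathfrak m$, let $M$ be a finitely generated graded $R$-module, let $c\ge1$ be an integer, and set $Z_i=Z_i(\mathfrak m^c,M)$. (a) Assume $c\geq \operatorname{slope}_R(M)$. Then for all $a,i\in\mathbb N$ we have $$t^R_a(Z_i)\leq t^R_0(M)+ic+\max\{a\operatorname{slope}_R(M),\ (a+i)\operatorname{Rate}(R)\}.$$ In particular, $\operatorname{slope}_R(Z_i)\leq\max\{\operatorname{slope}_R(M),\ (1+i)\operatorname{Rate}(R)\}$. (b) Assume $R$ is Koszul, i.e. $\operatorname{Rate}(R)=1$. Then for all $a,i\in\mathbb N$ we have $$t^R_a(Z_i)\leq a+i(c+1)+\operatorname{reg}_R(M).$$ In particular, $\operatorname{reg}_R(Z_i)\leq i(c+1)+\operatorname{reg}_R(M)$.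
   Context: A standard graded $K$-algebra is an $\mathbb N$-graded algebra $R$ with $R_0=K$, finitely generated over $K$ by elements of degree $1$. For a finitely generated graded $R$-module $M$, $t_i^R(M)=\max\{j:\operatorname{Tor}_i^R(M,K)_j\neq0\}$ (and $-\infty$ if $\operatorname{Tor}_i^R(M,K)=0$); $\operatorname{reg}_R(M)=\sup\{t_i^R(M)-i:i\in\mathbb N\}$; $\operatorname{slope}_R(M)=\sup\{(t_i^R(M)-t_0^R(M))/i : i\in\mathbb N,\ i>0\}$. The Backelin rate is $\operatorname{Rate}(R)=\operatorname{slope}_R(\mathfrak m)=\sup\{(t_i^R(K)-1)/(i-1): i\in\mathbb N,\ i>1\}$; one has $\operatorname{Rate}(R)\ge1$, with equality if and only if $R$ is Koszul (in the degenerate case where $t_i^R(K)=-\infty$ for all $i>1$, $R$ is Koszul and $\operatorname{Rate}(R)$ is read as $1$). For $a=0$ the term $a\operatorname{slope}_R(M)$ is $0$. $K(\mathfrak m^c,M)$ is the graded Koszul complex on $M$ associated to a $K$-basis of $R_c$ (the minimal generators of $\mathfrak m^c$), with $K_t(\mathfrak m^c,M)=M\otimes_K\bigwedge^tR_c$ and elements of $\bigwedge^t R_c$ in degree $tc$ (so the differential has degree $0$); $Z_i(\mathfrak m^c,M)$ is its module of $i$-th cycles.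
   Formalization: With B = max{slope(M),(1+i)Rate(R)}, the bound slope(Z_i) ≤ B in (a) is false for some M when i = D = dim R_c; for i = D it is proved only if Z_D = 0, or t_0(Z_D) ≥ t_0(M)+Dc, or c ≤ B. *)

theory Defs
  imports Complex_Main "HOL-Library.Extended_Real" "HOL-Library.Function_Algebras"
begin

section \<open>Graded algebras and graded modules\<close>

definition internal_grading :: "('i \<Rightarrow> 'a::ab_group_add set) \<Rightarrow> 'a set \<Rightarrow> bool" where
  "internal_grading G A \<longleftrightarrow>
     (\<forall>i. 0 \<in> G i \<and> (\<forall>x\<in>G i. \<forall>y\<in>G i. x - y \<in> G i) \<and> G i \<subseteq> A) \<and>
     (\<forall>x\<in>A. \<exists>!f. finite {i. f i \<noteq> 0} \<and> (\<forall>i. f i \<in> G i) \<and> x = (\<Sum>i | f i \<noteq> 0. f i))"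

inductive_set subalgebra_gen :: "('k \<Rightarrow> 'r::comm_ring_1) \<Rightarrow> 'r set \<Rightarrow> 'r set"
  for h :: "'k \<Rightarrow> 'r" and X :: "'r set" where
  scalar: "h a \<in> subalgebra_gen h X"
| gen: "x \<in> X \<Longrightarrow> x \<in> subalgebra_gen h X"
| add: "x \<in> subalgebra_gen h X \<Longrightarrow> y \<in> subalgebra_gen h X \<Longrightarrow> x + y \<in> subalgebra_gen h X"
| mult: "x \<in> subalgebra_gen h X \<Longrightarrow> y \<in> subalgebra_gen h X \<Longrightarrow> x * y \<in> subalgebra_gen h X"

text \<open>
  The ring \<open>R\<close> is the whole type \<open>'r\<close>; the record carries the structure map \<open>K \<rightarrow> R\<close> and the
  homogeneous components \<open>R\<^sub>n\<close>.
\<close>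
record ('k, 'r) grad_alg =
  str :: "'k \<Rightarrow> 'r"
  gr :: "nat \<Rightarrow> 'r set"

definition standard_graded :: "('k::field, 'r::comm_ring_1) grad_alg \<Rightarrow> bool" where
  "standard_graded R \<longleftrightarrow>
     str R 1 = 1 \<and> (\<forall>a b. str R (a + b) = str R a + str R b) \<and>
     (\<forall>a b. str R (a * b) = str R a * str R b) \<and>
     range (str R) = gr R 0 \<and>
     internal_grading (gr R) UNIV \<and>
     (\<forall>i j. \<forall>x\<in>gr R i. \<forall>y\<in>gr R j. x * y \<in> gr R (i + j)) \<and>
     (\<exists>X. finite X \<and> X \<subseteq> gr R 1 \<and> subalgebra_gen (str R) X = UNIV)"

text \<open>
  Modules are \<open>\<int>\<close>-graded and live inside an ambient module of type \<open>'m\<close>; the module itself is the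
  submodule generated by its homogeneous components, so that a graded submodule is given by
  shrinking the components.
\<close>
record ('r, 'm) grad_mod =
  smult :: "'r \<Rightarrow> 'm \<Rightarrow> 'm"
  piece :: "int \<Rightarrow> 'm set"

definition mod_carrier :: "('r::comm_ring_1, 'm::ab_group_add) grad_mod \<Rightarrow> 'm set" where
  "mod_carrier M = module.span (smult M) (\<Union>j. piece M j)"

definition graded_module ::
    "('k, 'r::comm_ring_1) grad_alg \<Rightarrow> ('r, 'm::ab_group_add) grad_mod \<Rightarrow> bool" where
  "graded_module R M \<longleftrightarrow>
     module (smult M) \<and> internal_grading (piece M) (mod_carrier M) \<and>
     (\<forall>i j. \<forall>r\<in>gr R i. \<forall>x\<in>piece M j. smult M r x \<in> piece M (int i + j))"

definition fin_gen :: "('r::comm_ring_1, 'm::ab_group_add) grad_mod \<Rightarrow> bool" where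
  "fin_gen M \<longleftrightarrow> (\<exists>X. finite X \<and> module.span (smult M) X = mod_carrier M)"

definition regular_mod :: "('k, 'r::comm_ring_1) grad_alg \<Rightarrow> ('r, 'r) grad_mod" where
  "regular_mod R = \<lparr>smult = (*), piece = (\<lambda>j. if j < 0 then {0} else gr R (nat j))\<rparr>"

definition max_homog_ideal :: "('k, 'r::comm_ring_1) grad_alg \<Rightarrow> 'r set" where
  "max_homog_ideal R = module.span (*) (\<Union>n\<in>{0<..}. gr R n)"

text \<open>
  The residue class map \<open>R \<rightarrow> R/\<mm> = K\<close>, where \<open>\<mm>\<close> is the maximal homogeneous ideal, and \<open>K\<close> as a
  graded \<open>R\<close>-module concentrated in degree \<open>0\<close>.
\<close>
definition residue_map :: "('k, 'r::comm_ring_1) grad_alg \<Rightarrow> 'r \<Rightarrow> 'k" where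
  "residue_map R r = (THE a. r - str R a \<in> max_homog_ideal R)"

definition residue_mod :: "('k::field, 'r::comm_ring_1) grad_alg \<Rightarrow> ('r, 'k) grad_mod" where
  "residue_mod R = \<lparr>smult = (\<lambda>r a. residue_map R r * a),
                    piece = (\<lambda>j. if j = 0 then UNIV else {0})\<rparr>"

section \<open>Graded free resolutions and Tor\<close>

text \<open>
  A complex of graded free modules \<open>F\<^sub>i = \<Oplus>b\<in>basis i. R(-deg i b)\<close> with an augmentation to a module.
  The \<open>basis\<close> sets may be infinite. The differential \<open>F\<^bsub>i+1\<^esub> \<rightarrow> F\<^sub>i\<close> sends the basis element \<open>e\<^sub>b\<close> to
  the (finite) sum of \<open>coef i b b' * e\<^sub>b'\<close> over \<open>b'\<close> in \<open>basis i\<close>, and \<open>F\<^sub>0 \<rightarrow> M\<close> sends \<open>e\<^sub>b\<close> to \<open>augm b\<close>.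
\<close>
record ('r, 'm) free_cx =
  basis :: "nat \<Rightarrow> nat set"
  deg :: "nat \<Rightarrow> nat \<Rightarrow> int"
  coef :: "nat \<Rightarrow> nat \<Rightarrow> nat \<Rightarrow> 'r"
  augm :: "nat \<Rightarrow> 'm"

text \<open>
  The degree \<open>j\<close> component of \<open>F\<^sub>i \<otimes>\<^sub>R N = \<Oplus>b\<in>basis i. N(-deg i b)\<close>, as finitely supported families,
  and the differential \<open>F\<^bsub>i+1\<^esub> \<otimes>\<^sub>R N \<rightarrow> F\<^sub>i \<otimes>\<^sub>R N\<close>. For \<open>N = R\<close> this is the complex \<open>F\<close> itself.
\<close>
definition tensor_piece ::
    "('r, 'm) free_cx \<Rightarrow> ('r, 'n::ab_group_add) grad_mod \<Rightarrow> nat \<Rightarrow> int \<Rightarrow> (nat \<Rightarrow> 'n) set" where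
  "tensor_piece F N i j = {v. finite {b. v b \<noteq> 0} \<and> {b. v b \<noteq> 0} \<subseteq> basis F i \<and>
                              (\<forall>b\<in>basis F i. v b \<in> piece N (j - deg F i b))}"

definition tensor_diff ::
    "('r, 'm) free_cx \<Rightarrow> ('r, 'n::ab_group_add) grad_mod \<Rightarrow> nat \<Rightarrow> (nat \<Rightarrow> 'n) \<Rightarrow> nat \<Rightarrow> 'n" where
  "tensor_diff F N i v = (\<lambda>b'. \<Sum>b | v b \<noteq> 0. smult N (coef F i b b') (v b))"

definition augmentation ::
    "('r, 'm) free_cx \<Rightarrow> ('r::zero, 'm::ab_group_add) grad_mod \<Rightarrow> (nat \<Rightarrow> 'r) \<Rightarrow> 'm" where
  "augmentation F M v = (\<Sum>b | v b \<noteq> 0. smult M (v b) (augm F b))"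

definition graded_free_resolution ::
    "('k, 'r::comm_ring_1) grad_alg \<Rightarrow> ('r, 'm::ab_group_add) grad_mod \<Rightarrow> ('r, 'm) free_cx \<Rightarrow> bool"
  where
  "graded_free_resolution R M F \<longleftrightarrow>
     (\<forall>i. \<forall>b\<in>basis F (Suc i).
        finite {b'. coef F i b b' \<noteq> 0} \<and> {b'. coef F i b b' \<noteq> 0} \<subseteq> basis F i \<and>
        (\<forall>b'\<in>basis F i. coef F i b b' \<in> piece (regular_mod R) (deg F (Suc i) b - deg F i b'))) \<and>
     (\<forall>b\<in>basis F 0. augm F b \<in> piece M (deg F 0 b)) \<and>
     (\<forall>j. augmentation F M ` tensor_piece F (regular_mod R) 0 j = piece M j) \<and>
     (\<forall>j. {v \<in> tensor_piece F (regular_mod R) 0 j. augmentation F M v = 0} =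
          tensor_diff F (regular_mod R) 0 ` tensor_piece F (regular_mod R) 1 j) \<and>
     (\<forall>i j. {v \<in> tensor_piece F (regular_mod R) (Suc i) j. tensor_diff F (regular_mod R) i v = 0} =
          tensor_diff F (regular_mod R) (Suc i) ` tensor_piece F (regular_mod R) (Suc (Suc i)) j)"

definition tensor_cycles ::
    "('r, 'm) free_cx \<Rightarrow> ('r, 'n::ab_group_add) grad_mod \<Rightarrow> nat \<Rightarrow> int \<Rightarrow> (nat \<Rightarrow> 'n) set" where
  "tensor_cycles F N i j = (case i of
       0 \<Rightarrow> tensor_piece F N 0 j
     | Suc i' \<Rightarrow> {v \<in> tensor_piece F N (Suc i') j. tensor_diff F N i' v = 0})"

definition tensor_boundaries ::
    "('r, 'm) free_cx \<Rightarrow> ('r, 'n::ab_group_add) grad_mod \<Rightarrow> nat \<Rightarrow> int \<Rightarrow> (nat \<Rightarrow> 'n) set" where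
  "tensor_boundaries F N i j = tensor_diff F N i ` tensor_piece F N (Suc i) j"

text \<open>
  \<open>Tor\<^sub>i(M,N)\<^sub>j = H\<^sub>i(F \<otimes>\<^sub>R N)\<^sub>j \<noteq> 0\<close> for a graded free resolution \<open>F\<close> of \<open>M\<close>; the homology does not
  depend on \<open>F\<close>. A resolution with countable bases exists whenever the components of \<open>M\<close> are
  finite-dimensional and vanish in sufficiently negative degrees, in particular for every graded
  submodule of a finitely generated graded module over a standard graded algebra.
\<close>
definition Tor_nonzero ::
    "('k, 'r::comm_ring_1) grad_alg \<Rightarrow> ('r, 'm::ab_group_add) grad_mod \<Rightarrow>
     ('r, 'n::ab_group_add) grad_mod \<Rightarrow> nat \<Rightarrow> int \<Rightarrow> bool" where
  "Tor_nonzero R M N i j \<longleftrightarrow>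
     (\<exists>F. graded_free_resolution R M F \<and> \<not> tensor_cycles F N i j \<subseteq> tensor_boundaries F N i j)"

section \<open>Regularity, slope and rate\<close>

text \<open>
  The supremum is a maximum for finitely generated modules; it is \<open>-\<infinity>\<close> if Tor vanishes.
\<close>
definition t_inv :: "('k::field, 'r::comm_ring_1) grad_alg \<Rightarrow> ('r, 'm::ab_group_add) grad_mod \<Rightarrow>
    nat \<Rightarrow> ereal" where
  "t_inv R M i = Sup {ereal (real_of_int j) | j. Tor_nonzero R M (residue_mod R) i j}"

definition regularity ::
    "('k::field, 'r::comm_ring_1) grad_alg \<Rightarrow> ('r, 'm::ab_group_add) grad_mod \<Rightarrow> ereal" where
  "regularity R M = (SUP i. t_inv R M i - ereal (real i))"

text \<open>
  Indices \<open>i\<close> with \<open>t\<^sub>i = -\<infinity>\<close> contribute \<open>-\<infinity>\<close> to the supremum and are left out: for \<open>M = 0\<close> also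
  \<open>t\<^sub>0 = -\<infinity>\<close>, and the difference of the two would be \<open>\<infinity>\<close> in \<^typ>\<open>ereal\<close>. So the slope of the zero
  module is \<open>-\<infinity>\<close>.
\<close>
definition slope ::
    "('k::field, 'r::comm_ring_1) grad_alg \<Rightarrow> ('r, 'm::ab_group_add) grad_mod \<Rightarrow> ereal" where
  "slope R M = Sup {(t_inv R M i - t_inv R M 0) / ereal (real i) | i. 0 < i \<and> t_inv R M i \<noteq> -\<infinity>}"

definition Rate :: "('k::field, 'r::comm_ring_1) grad_alg \<Rightarrow> ereal" where
  "Rate R = (if \<forall>i>1. t_inv R (residue_mod R) i = -\<infinity> then 1
     else Sup {(t_inv R (residue_mod R) i - 1) / ereal (real i - 1) | i.
               1 < i \<and> t_inv R (residue_mod R) i \<noteq> -\<infinity>})"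

section \<open>Koszul cycles\<close>

definition K_basis ::
    "('k::field, 'r::comm_ring_1) grad_alg \<Rightarrow> nat \<Rightarrow> nat \<Rightarrow> (nat \<Rightarrow> 'r) \<Rightarrow> bool" where
  "K_basis R c D u \<longleftrightarrow>
     inj_on u {..<D} \<and>
     \<not> module.dependent (\<lambda>a x. str R a * x) (u ` {..<D}) \<and>
     module.span (\<lambda>a x. str R a * x) (u ` {..<D}) = gr R c"

text \<open>
  With \<open>e\<^sub>S = e\<^bsub>s\<^sub>1\<^esub> \<and> \<dots> \<and> e\<^bsub>s\<^sub>t\<^esub>\<close> for \<open>S = {s\<^sub>1 < \<dots> < s\<^sub>t}\<close>, an element of \<open>M \<otimes> \<And>\<^sup>t R\<^sub>c\<close> is written as
  the family of its coefficients at the \<open>e\<^sub>S\<close>, \<open>S\<close> a \<open>t\<close>-subset of \<open>{..<D}\<close>. The differential is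
  \<open>m \<otimes> e\<^sub>S \<mapsto> (\<Sum>k. (-1)\<^bsup>k-1\<^esup> u\<^bsub>s\<^sub>k\<^esub> m \<otimes> e\<^bsub>S - {s\<^sub>k}\<^esub>)\<close>; below it is given by its coefficient at \<open>e\<^sub>T\<close>.
\<close>
definition koszul_piece ::
    "('r, 'm::ab_group_add) grad_mod \<Rightarrow> nat \<Rightarrow> nat \<Rightarrow> nat \<Rightarrow> int \<Rightarrow> (nat set \<Rightarrow> 'm) set" where
  "koszul_piece M c D t j =
     {x. (\<forall>S. (S \<subseteq> {..<D} \<and> card S = t \<longrightarrow> x S \<in> piece M (j - int (t * c))) \<and>
              (\<not> (S \<subseteq> {..<D} \<and> card S = t) \<longrightarrow> x S = 0))}"

definition koszul_diff :: "('r::comm_ring_1, 'm::ab_group_add) grad_mod \<Rightarrow> nat \<Rightarrow> (nat \<Rightarrow> 'r) \<Rightarrow>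
    (nat set \<Rightarrow> 'm) \<Rightarrow> nat set \<Rightarrow> 'm" where
  "koszul_diff M D u x =
     (\<lambda>T. \<Sum>s\<in>{..<D} - T. smult M ((-1) ^ card {r\<in>T. r < s} * u s) (x (insert s T)))"

text \<open>
  The graded module \<open>Z\<^sub>i(\<mm>\<^sup>c, M)\<close>. For \<open>i = 0\<close> the differential vanishes, since
  \<^term>\<open>insert s T\<close> is never empty, and the module is \<open>M\<close>.
\<close>
definition koszul_cycles :: "('r::comm_ring_1, 'm::ab_group_add) grad_mod \<Rightarrow> nat \<Rightarrow> nat \<Rightarrow>
    (nat \<Rightarrow> 'r) \<Rightarrow> nat \<Rightarrow> ('r, nat set \<Rightarrow> 'm) grad_mod" where
  "koszul_cycles M c D u i =
     \<lparr>smult = (\<lambda>r x S. smult M r (x S)),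
      piece = (\<lambda>j. {x \<in> koszul_piece M c D i j. koszul_diff M D u x = 0})\<rparr>"

text \<open>
  A bound \<open>slope(Z\<^sub>i) \<le> B\<close> with \<open>B = max {slope(M), (1+i) Rate(R)}\<close> needs care in the top exterior
  degree \<open>i = D\<close>, where \<open>D\<close> is the dimension of \<open>R\<^sub>c\<close>: there \<open>Z\<^sub>D = (0 :\<^sub>M \<mm>\<^sup>c)(-Dc)\<close> may be nonzero
  and generated in degrees below \<open>t\<^sub>0(M) + Dc\<close>. Example: \<open>R = K[x]\<close>, \<open>c = 3\<close>,
  \<open>M = K[x]/(x\<^sup>3) \<oplus> K[x](-10)\<close>. Then \<open>D = 1\<close>, \<open>Rate(R) = 1\<close>, \<open>t\<^sub>0(M) = 10\<close>, \<open>t\<^sub>1(M) = 3\<close> and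
  \<open>slope(M) = -7\<close>, so \<open>B = 2\<close>, but \<open>Z\<^sub>1 = K[x]/(x\<^sup>3)(-3)\<close> has slope \<open>3\<close>.
\<close>

end

theory Submission
  imports Defs
begin

text \<open>
  Let \<open>G\<close> be the minimal graded free resolution of the residue field \<open>K\<close>. For every graded module
  \<open>N\<close> one has \<open>Tor\<^sub>a(N,K)\<^sub>j = H\<^sub>a(G \<otimes> N)\<^sub>j\<close>, and this description has two useful features: it turns short
  exact sequences in \<open>N\<close> into long ones, and the component of \<open>G\<^sub>a \<otimes> N\<close> in degree \<open>j\<close> is zero unless
  \<open>N\<close> lives in a degree \<open>j - d\<close>, where \<open>d\<close> is the degree of a basis element of \<open>G\<^sub>a\<close>. Such a degree
  satisfies \<open>d \<le> t\<^sub>a(K)\<close>, and \<open>t\<^sub>a(K) \<le> 1 + (a - 1) Rate(R)\<close> for \<open>a \<ge> 1\<close>.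

  Write \<open>K\<^sub>i\<close>, \<open>Z\<^sub>i\<close>, \<open>B\<^sub>i\<close> for the terms, cycles and boundaries of the Koszul complex. The sequences
  \<open>0 \<rightarrow> Z\<^bsub>i+1\<^esub> \<rightarrow> K\<^bsub>i+1\<^esub> \<rightarrow> B\<^sub>i \<rightarrow> 0\<close> and \<open>0 \<rightarrow> B\<^sub>i \<rightarrow> Z\<^sub>i \<rightarrow> H\<^sub>i \<rightarrow> 0\<close> show that
  \<open>Tor\<^sub>a(Z\<^bsub>i+1\<^esub>,K)\<^sub>j \<noteq> 0\<close> only if one of \<open>Tor\<^sub>a(K\<^bsub>i+1\<^esub>,K)\<^sub>j\<close>, \<open>Tor\<^bsub>a+1\<^esub>(Z\<^sub>i,K)\<^sub>j\<close> and
  \<open>Tor\<^bsub>a+2\<^esub>(H\<^sub>i,K)\<^sub>j\<close> is nonzero. The first is a sum of copies of \<open>Tor\<^sub>a(M,K)\<close> shifted by \<open>(i+1)c\<close>.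
  For the last, \<open>\<mm>\<^sup>c\<close> annihilates \<open>H\<^sub>i\<close>, which therefore vanishes in degrees \<open>\<ge> t\<^sub>0(Z\<^sub>i) + c\<close>, so that
  \<open>j \<le> t\<^sub>0(Z\<^sub>i) + c - 1 + t\<^bsub>a+2\<^esub>(K)\<close>. Any function of \<open>a\<close> and \<open>i\<close> that is compatible with these three
  alternatives bounds \<open>t\<^sub>a(Z\<^sub>i)\<close> by induction on \<open>i\<close> (\<open>cycles_bound\<close>); the right-hand sides of (a) and (b)
  are such functions.

  The bound for \<open>slope(Z\<^sub>i)\<close> follows from that for \<open>t\<^sub>a(Z\<^sub>i)\<close> once \<open>t\<^sub>0(Z\<^sub>i) \<ge> t\<^sub>0(M) + ic\<close>. For \<open>i < D\<close> this
  always holds (\<open>cycles_generator_above\<close>): otherwise the boundary of \<open>m \<otimes> e\<^sub>T\<close>, with \<open>m\<close> a minimal generator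
  of top degree and \<open>card T = i + 1\<close>, would be a combination of elements \<open>u\<^sub>s z\<^sub>s\<close> with \<open>z\<^sub>s \<in> Z\<^sub>i\<close> having
  coefficients in \<open>\<mm>M\<close>. Then \<open>m \<otimes> e\<^sub>T - (\<Sum>s. e\<^sub>s \<and> z\<^sub>s)\<close> is a cycle, and contracting it with a dual basis
  vector gives a cycle in \<open>Z\<^sub>i\<close> with coefficient \<open>m\<close> modulo \<open>\<mm>M\<close>, a contradiction. For \<open>i = D\<close> there are
  no boundaries, so \<open>\<mm>\<^sup>c Z\<^sub>D = 0\<close>, and \<open>t\<^sub>a(Z\<^sub>D) \<le> t\<^sub>0(Z\<^sub>D) + c - 1 + t\<^sub>a(K)\<close> suffices when \<open>c\<close> is at most
  the claimed slope.

  Since \<open>t\<^sub>a\<close> is defined by resolutions of the first argument of Tor, one also needs the balance of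
  Tor (\<open>Tor_balanced\<close>), proved by shifting dimensions along syzygies, and the existence of resolutions
  (\<open>ex_minimal_resolution\<close>).
\<close>

section \<open>Gradings and the structure of the algebra\<close>

text \<open>
  Finite sums of elements of the sets \<open>Q i\<close>. Graded submodules and products such as \<open>R\<^sub>1 R\<^sub>n\<close> are
  written in this form.
\<close>
inductive_set fsums :: "('i \<Rightarrow> 'a::ab_group_add set) \<Rightarrow> 'a set" for Q :: "'i \<Rightarrow> 'a set" where
  zero: "0 \<in> fsums Q"
| step: "q \<in> Q i \<Longrightarrow> y \<in> fsums Q \<Longrightarrow> q + y \<in> fsums Q"

lemma fsums_add: "x \<in> fsums Q \<Longrightarrow> y \<in> fsums Q \<Longrightarrow> x + y \<in> fsums Q"
  by (induction rule: fsums.induct) (auto simp: add.assoc intro: fsums.step)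

lemma fsums_in: "q \<in> Q i \<Longrightarrow> q \<in> fsums Q"
  using fsums.step[OF _ fsums.zero, of q Q i] by simp

lemma fsums_sum: "(\<And>i. i \<in> S \<Longrightarrow> f i \<in> fsums Q) \<Longrightarrow> (\<Sum>i\<in>S. f i) \<in> fsums Q"
  by (induction S rule: infinite_finite_induct) (auto intro: fsums_add fsums.zero)

lemma fsums_image:
  assumes "x \<in> fsums Q" "g 0 = 0"
    and "\<And>i q y. q \<in> Q i \<Longrightarrow> y \<in> fsums Q \<Longrightarrow> g (q + y) = g q + g y"
    and "\<And>i q. q \<in> Q i \<Longrightarrow> g q \<in> fsums P"
  shows "g x \<in> fsums P"
  using assms(1) by induction (auto simp: assms intro: fsums_add fsums.zero)

lemma fsums_subset:
  assumes "x \<in> fsums Q" "0 \<in> S" "\<And>x y. x \<in> S \<Longrightarrow> y \<in> S \<Longrightarrow> x + y \<in> S"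
    and "\<And>i q. q \<in> Q i \<Longrightarrow> q \<in> S"
  shows "x \<in> S"
  using assms(1) by induction (auto simp: assms)

lemma fsums_decomposition:
  assumes "x \<in> fsums Q" and 0: "\<And>i. 0 \<in> Q i"
    and add: "\<And>i x y. x \<in> Q i \<Longrightarrow> y \<in> Q i \<Longrightarrow> x + y \<in> Q i"
  shows "\<exists>f. finite {i. f i \<noteq> 0} \<and> (\<forall>i. f i \<in> Q i) \<and> x = (\<Sum>i | f i \<noteq> 0. f i)"
  using assms(1)
proof induction
  case zero
  show ?case by (rule exI[of _ "\<lambda>_. 0"]) (simp add: 0)
next
  case (step q i y)
  then obtain f where f: "finite {i. f i \<noteq> 0}" "\<forall>i. f i \<in> Q i" "y = (\<Sum>i | f i \<noteq> 0. f i)"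
    by blast
  define g where "g = f(i := q + f i)"
  let ?S = "insert i {i. f i \<noteq> 0}"
  have sub: "{i. g i \<noteq> 0} \<subseteq> ?S" by (auto simp: g_def)
  have "(\<Sum>j | g j \<noteq> 0. g j) = (\<Sum>j\<in>?S. g j)"
    by (rule sum.mono_neutral_left) (use f sub in auto)
  also have "\<dots> = (\<Sum>j\<in>?S. (if j = i then q else 0) + f j)"
    by (rule sum.cong) (auto simp: g_def)
  also have "\<dots> = q + (\<Sum>j\<in>?S. f j)"
    using f(1) by (subst sum.distrib) simp
  also have "(\<Sum>j\<in>?S. f j) = y"
    unfolding f(3) by (rule sum.mono_neutral_right) (use f in auto)
  finally have "q + y = (\<Sum>j | g j \<noteq> 0. g j)" by simp
  moreover have "finite {i. g i \<noteq> 0}" using sub f(1) finite_subset by blast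
  moreover have "\<forall>i. g i \<in> Q i" using f(2) step(1) add by (auto simp: g_def)
  ultimately show ?case by blast
qed

lemma internal_grading_fsums:
  assumes "internal_grading G A" "x \<in> A"
  shows "x \<in> fsums G"
proof -
  obtain f where "finite {i. f i \<noteq> 0}" "\<forall>i. f i \<in> G i" "x = (\<Sum>i | f i \<noteq> 0. f i)"
    using assms unfolding internal_grading_def by blast
  then show ?thesis by (metis fsums_sum fsums_in)
qed

text \<open>
  By uniqueness of homogeneous components, a graded subgroup is determined in degree \<open>j\<close> by its own
  component of degree \<open>j\<close>.
\<close>
lemma homogeneous_fsums:
  assumes gr: "internal_grading G A" and "x \<in> fsums Q" "x \<in> G j"
    and 0: "\<And>i. 0 \<in> Q i" and add: "\<And>i x y. x \<in> Q i \<Longrightarrow> y \<in> Q i \<Longrightarrow> x + y \<in> Q i"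
    and sub: "\<And>i. Q i \<subseteq> G i"
  shows "x \<in> Q j"
proof -
  obtain f where f: "finite {i. f i \<noteq> 0}" "\<forall>i. f i \<in> Q i" "x = (\<Sum>i | f i \<noteq> 0. f i)"
    using fsums_decomposition[OF assms(2) 0 add] by blast
  define g where "g i = (if i = j then x else 0)" for i
  have xA: "x \<in> A" and 0: "\<And>i. 0 \<in> G i"
    using gr assms(3) unfolding internal_grading_def by blast+
  have supp: "{i. g i \<noteq> 0} \<subseteq> {j}" by (auto simp: g_def)
  have fg: "finite {i. g i \<noteq> 0}" using supp finite_subset by blast
  have "(\<Sum>i | g i \<noteq> 0. g i) = (\<Sum>i\<in>{j}. g i)"
    by (rule sum.mono_neutral_left) (use supp in auto)
  then have "x = (\<Sum>i | g i \<noteq> 0. g i)" by (simp add: g_def)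
  moreover have "\<forall>i. g i \<in> G i" using assms(3) 0 by (simp add: g_def)
  ultimately have g: "finite {i. g i \<noteq> 0} \<and> (\<forall>i. g i \<in> G i) \<and> x = (\<Sum>i | g i \<noteq> 0. g i)"
    using fg by blast
  define P where "P f \<longleftrightarrow> finite {i. f i \<noteq> 0} \<and> (\<forall>i. f i \<in> G i) \<and> x = (\<Sum>i | f i \<noteq> 0. f i)" for f
  have "P f" unfolding P_def using f sub by blast
  moreover have "P g" unfolding P_def by (rule g)
  moreover have "\<exists>!f. P f" unfolding P_def
    using gr[unfolded internal_grading_def, THEN conjunct2] xA by (rule bspec)
  ultimately have "f = g" by blast
  then have "f j = x" by (simp add: g_def)
  then show ?thesis using f(2) by metis
qed

locale std_graded =
  fixes R :: "('k::field, 'r::comm_ring_1) grad_alg"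
  assumes std: "standard_graded R"
begin

text \<open>
  The component \<open>R\<^sub>n\<close>, extended by \<open>0\<close> to negative \<open>n\<close>, so that degrees of scalars can be added to
  the integral degrees of modules.
\<close>
abbreviation rp :: "int \<Rightarrow> 'r set" where "rp \<equiv> piece (regular_mod R)"

lemma str_hom: "str R 1 = 1" "str R (a + b) = str R a + str R b" "str R (a * b) = str R a * str R b"
  using std unfolding standard_graded_def by auto

lemma str_0 [simp]: "str R 0 = 0"
  using str_hom(2)[of 0 0] by simp

lemma str_minus: "str R (- a) = - str R a"
  using str_hom(2)[of a "- a"] by (simp add: minus_unique)

lemma str_eq_0 [simp]: "str R a = 0 \<longleftrightarrow> a = 0"
proof
  assume "str R a = 0"
  then have "str R (a * inverse a) = 0" by (simp only: str_hom mult_zero_left)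
  then show "a = 0" using str_hom(1) by (cases "a = 0") auto
qed simp

lemma str_inj: "str R a = str R b \<longleftrightarrow> a = b"
proof -
  have "str R a - str R b = str R (a - b)" using str_hom(2)[of a "- b"] str_minus[of b] by simp
  then show ?thesis by (metis eq_iff_diff_eq_0 str_eq_0)
qed

lemma gr_grading: "internal_grading (gr R) UNIV"
  using std unfolding standard_graded_def by auto

lemma gr_0: "gr R 0 = range (str R)"
  using std unfolding standard_graded_def by auto

lemma gr_zero: "0 \<in> gr R n" and gr_diff: "x \<in> gr R n \<Longrightarrow> y \<in> gr R n \<Longrightarrow> x - y \<in> gr R n"
  using gr_grading unfolding internal_grading_def by auto

lemma gr_add: "x \<in> gr R n \<Longrightarrow> y \<in> gr R n \<Longrightarrow> x + y \<in> gr R n"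
  using gr_diff[of x n "- y"] gr_diff[of 0 n y] gr_zero[of n] by simp

lemma gr_mult: "x \<in> gr R i \<Longrightarrow> y \<in> gr R j \<Longrightarrow> x * y \<in> gr R (i + j)"
  using std unfolding standard_graded_def by auto

lemma rp_nat: "rp (int n) = gr R n"
  by (simp add: regular_mod_def)

lemma rp_neg: "n < 0 \<Longrightarrow> rp n = {0}"
  by (simp add: regular_mod_def)

lemma rp_0: "rp 0 = range (str R)"
  using rp_nat[of 0] gr_0 by simp

lemma rp_zero [simp]: "0 \<in> rp n"
  by (cases "n < 0") (auto simp: regular_mod_def gr_zero)

lemma rp_diff: "x \<in> rp n \<Longrightarrow> y \<in> rp n \<Longrightarrow> x - y \<in> rp n"
  by (cases "n < 0") (auto simp: regular_mod_def gr_diff)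

lemma rp_mult:
  assumes "x \<in> rp i" "y \<in> rp j" shows "x * y \<in> rp (i + j)"
proof (cases "i < 0 \<or> j < 0")
  case True
  then have "x = 0 \<or> y = 0" using assms rp_neg by blast
  then show ?thesis by auto
next
  case False
  then have "i = int (nat i)" "j = int (nat j)" "i + j = int (nat i + nat j)" by auto
  then show ?thesis using assms gr_mult rp_nat by metis
qed

lemma str_rp [simp]: "str R a \<in> rp 0"
  by (simp add: rp_0)

lemma one_rp [simp]: "1 \<in> rp 0"
  using str_rp[of 1] str_hom(1) by simp

lemma gr_fsums: "x \<in> fsums (gr R)"
  using internal_grading_fsums[OF gr_grading] by simp

abbreviation gr_products :: "nat \<Rightarrow> 'r set" where
  "gr_products n \<equiv> {x * y | x y. x \<in> gr R 1 \<and> y \<in> gr R n}"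

lemma subalgebra_UNIV:
  obtains X where "finite X" "X \<subseteq> gr R 1" "subalgebra_gen (str R) X = UNIV"
  using std unfolding standard_graded_def by auto

text \<open>
  The form in which generation in degree \<open>1\<close> is used: \<open>R\<^bsub>n+1\<^esub> = R\<^sub>1 R\<^sub>n\<close>. The direct sum of \<open>R\<^sub>0\<close> and
  the \<open>R\<^sub>1 R\<^sub>n\<close> is a subalgebra that contains the generators, hence it is all of \<open>R\<close>.
\<close>
lemma gr_Suc: "gr R (Suc n) \<subseteq> fsums (\<lambda>_::unit. gr_products n)"
proof
  fix r assume r: "r \<in> gr R (Suc n)"
  define P where "P n = fsums (\<lambda>_::unit. gr_products n)" for n
  define Q where "Q n = (case n of 0 \<Rightarrow> gr R 0 | Suc n \<Rightarrow> P n)" for n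
  have P0: "0 \<in> P n" for n by (simp add: P_def fsums.zero)
  have Padd: "x \<in> P n \<Longrightarrow> y \<in> P n \<Longrightarrow> x + y \<in> P n" for x y n by (simp add: P_def fsums_add)
  have Pgr: "P n \<subseteq> gr R (Suc n)" for n
  proof
    fix x assume "x \<in> P n"
    then show "x \<in> gr R (Suc n)" unfolding P_def
    proof (rule fsums_subset)
      fix q assume "q \<in> gr_products n"
      then show "q \<in> gr R (Suc n)" using gr_mult[of _ 1 _ n] by auto
    qed (simp_all add: gr_zero gr_add)
  qed
  have Qgr: "Q n \<subseteq> gr R n" for n using Pgr by (auto simp: Q_def split: nat.split)
  have Q0: "0 \<in> Q n" for n by (auto simp: Q_def gr_zero P0 split: nat.split)
  have Qadd: "x \<in> Q n \<Longrightarrow> y \<in> Q n \<Longrightarrow> x + y \<in> Q n" for x y n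
    by (auto simp: Q_def gr_add Padd split: nat.split_asm)
  have PQ: "x * y \<in> P (m + k)" if "x \<in> P m" "y \<in> gr R k" for x y m k
    using that(1) unfolding P_def
  proof (rule fsums_image)
    fix q assume "q \<in> gr_products m"
    then obtain a b where ab: "q = a * b" "a \<in> gr R 1" "b \<in> gr R m" by blast
    then have "q * y = a * (b * y)" "b * y \<in> gr R (m + k)" using gr_mult that by (auto simp: mult.assoc)
    then show "q * y \<in> fsums (\<lambda>_::unit. gr_products (m + k))"
      using ab by (intro fsums_in) blast
  qed (auto simp: algebra_simps)
  have QQ: "x * y \<in> Q (m + k)" if "x \<in> Q m" "y \<in> Q k" for x y m k
  proof (cases m)
    case (Suc m') then show ?thesis using that PQ[of x m' y k] Qgr[of k] by (auto simp: Q_def)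
  next
    case 0
    show ?thesis
    proof (cases k)
      case (Suc k') then show ?thesis using that PQ[of y k' x m] Qgr[of m] 0
        by (auto simp: Q_def mult.commute)
    next
      case 00: 0
      then show ?thesis using that gr_mult[of x 0 y 0] 0 by (simp add: Q_def)
    qed
  qed
  have HQ: "x * y \<in> fsums Q" if "x \<in> fsums Q" "y \<in> fsums Q" for x y
    using that(1)
  proof (rule fsums_image)
    fix i q assume q: "q \<in> Q i"
    from that(2) show "q * y \<in> fsums Q"
      by (rule fsums_image) (use QQ q in \<open>auto simp: distrib_left intro!: fsums_in[of _ Q "i + _"]\<close>)
  qed (auto simp: algebra_simps)
  obtain X where X: "finite X" "X \<subseteq> gr R 1" "subalgebra_gen (str R) X = UNIV"
    by (rule subalgebra_UNIV)
  have "x \<in> fsums Q" if "x \<in> subalgebra_gen (str R) X" for x using that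
  proof induction
    case (scalar a)
    show ?case by (rule fsums_in[of _ _ 0]) (simp add: Q_def gr_0)
  next
    case (gen x)
    have "x * str R 1 \<in> P 0" unfolding P_def
      by (rule fsums_in) (use gen X gr_0 in blast)
    then have "x \<in> Q 1" by (simp add: Q_def str_hom)
    then show ?case by (rule fsums_in)
  qed (auto intro: fsums_add HQ)
  then have "r \<in> fsums Q" using X by auto
  then have "r \<in> Q (Suc n)" using homogeneous_fsums[OF gr_grading _ r Q0 Qadd Qgr] by blast
  then show "r \<in> fsums (\<lambda>_::unit. gr_products n)"
    by (simp add: Q_def P_def)
qed

lemma vector_space_R: "vector_space (\<lambda>a x. str R a * x)"
  by unfold_locales (auto simp: algebra_simps str_hom)

text \<open>
  The monomials in finitely many algebra generators span \<open>R\<close> over \<open>K\<close>.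
\<close>
lemma countable_span_R: "\<exists>C. countable C \<and> module.span (\<lambda>a x. str R a * x) C = UNIV"
proof -
  interpret V: vector_space "\<lambda>a x. str R a * x" by (rule vector_space_R)
  obtain X where X: "finite X" "X \<subseteq> gr R 1" "subalgebra_gen (str R) X = UNIV"
    by (rule subalgebra_UNIV)
  define C where "C = prod_list ` lists X"
  have CC: "x * y \<in> C" if xC: "x \<in> C" and yC: "y \<in> C" for x y
  proof -
    obtain xs where "x = prod_list xs" "xs \<in> lists X"
      using xC unfolding C_def by (rule imageE)
    moreover obtain ys where "y = prod_list ys" "ys \<in> lists X"
      using yC unfolding C_def by (rule imageE)
    ultimately show ?thesis unfolding C_def
      by (intro image_eqI[of _ _ "xs @ ys"]) auto
  qed
  have SC: "x * y \<in> V.span C" if "x \<in> V.span C" "y \<in> V.span C" for x y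
    using that(1)
  proof (induction rule: V.span_induct_alt)
    case base show ?case by (simp add: V.span_zero)
  next
    case (step a c z)
    have "c * y \<in> V.span C" using that(2)
    proof (induction rule: V.span_induct_alt)
      case base show ?case by (simp add: V.span_zero)
    next
      case (step a d z')
      have "c * (str R a * d + z') = str R a * (c * d) + c * z'" by (simp add: algebra_simps)
      moreover have "str R a * (c * d) \<in> V.span C"
        using V.span_scale[OF V.span_base[OF CC[OF \<open>c \<in> C\<close> \<open>d \<in> C\<close>]], of a] .
      ultimately show ?case using step V.span_add by metis
    qed
    moreover have "(str R a * c + z) * y = str R a * (c * y) + z * y" by (simp add: algebra_simps)
    ultimately show ?case using step V.span_add V.span_scale by metis
  qed
  have "x \<in> V.span C" if "x \<in> subalgebra_gen (str R) X" for x using that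
  proof induction
    case (scalar a)
    have "1 \<in> C" unfolding C_def by (intro image_eqI[of _ _ "[]"]) auto
    then show ?case using V.span_scale[OF V.span_base, of 1 C a] by simp
  next
    case (gen x)
    have "x \<in> C" unfolding C_def by (rule image_eqI[of _ _ "[x]"]) (use gen in auto)
    then show ?case by (rule V.span_base)
  qed (auto intro: V.span_add SC)
  then have "V.span C = UNIV" using X by auto
  moreover have "countable C" unfolding C_def
    using X by (intro countable_image countable_lists countable_finite)
  ultimately show ?thesis by blast
qed

section \<open>The residue class map\<close>

abbreviation \<mm> where "\<mm> \<equiv> max_homog_ideal R"

lemma module_R: "module ((*) :: 'r \<Rightarrow> 'r \<Rightarrow> 'r)"
  by unfold_locales (auto simp: algebra_simps)

lemma mm_add: "x \<in> \<mm> \<Longrightarrow> y \<in> \<mm> \<Longrightarrow> x + y \<in> \<mm>"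
  and mm_diff: "x \<in> \<mm> \<Longrightarrow> y \<in> \<mm> \<Longrightarrow> x - y \<in> \<mm>"
  and mm_mult: "x \<in> \<mm> \<Longrightarrow> r * x \<in> \<mm>"
  and mm_zero: "0 \<in> \<mm>"
  and mm_gr: "x \<in> gr R n \<Longrightarrow> n > 0 \<Longrightarrow> x \<in> \<mm>"
  unfolding max_homog_ideal_def
  by (auto simp: module.span_add[OF module_R] module.span_diff[OF module_R]
      module.span_scale[OF module_R] module.span_zero[OF module_R]
      intro!: module.span_base[OF module_R])

text \<open>
  The ideal \<open>\<mm>\<close> is the sum of the \<open>R\<^sub>n\<close> with \<open>n > 0\<close>, so directness of the grading separates it from
  \<open>R\<^sub>0\<close>.
\<close>
lemma mm_gr0:
  assumes "x \<in> \<mm>" "x \<in> gr R 0" shows "x = 0"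
proof -
  define Q where "Q n = (if n = 0 then {0} else gr R n)" for n
  have "x \<in> fsums Q" using assms(1) unfolding max_homog_ideal_def
  proof (induction rule: module.span_induct_alt[OF module_R, consumes 1])
    case 1 show ?case by (rule fsums.zero)
  next
    case (2 r x y)
    then obtain n where n: "n > 0" "x \<in> gr R n" by auto
    have "r * x \<in> fsums Q" using gr_fsums[of r]
    proof (rule fsums_image)
      fix i q assume "q \<in> gr R i"
      then have "q * x \<in> Q (i + n)" using n gr_mult by (auto simp: Q_def)
      then show "q * x \<in> fsums Q" by (rule fsums_in)
    qed (auto simp: algebra_simps)
    then show ?case using 2 by (auto intro: fsums_add)
  qed
  then have "x \<in> Q 0" using assms(2)
    by (rule homogeneous_fsums[OF gr_grading]) (auto simp: Q_def gr_zero gr_add)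
  then show ?thesis by (simp add: Q_def)
qed

lemma residue_ex1: "\<exists>!a. r - str R a \<in> \<mm>"
proof (rule ex_ex1I)
  show "\<exists>a. r - str R a \<in> \<mm>" using gr_fsums[of r]
  proof induction
    case zero
    show ?case by (rule exI[of _ 0]) (simp add: mm_zero)
  next
    case (step q i y)
    then obtain a where a: "y - str R a \<in> \<mm>" by blast
    show ?case
    proof (cases "i = 0")
      case True
      then obtain b where "q = str R b" using step gr_0 by auto
      then show ?thesis using a by (intro exI[of _ "b + a"]) (simp add: str_hom algebra_simps)
    next
      case False
      then have "q \<in> \<mm>" using step mm_gr by auto
      then show ?thesis using mm_add[OF _ a, of q] by (intro exI[of _ a]) (simp add: algebra_simps)
    qed
  qed
next
  fix a b assume "r - str R a \<in> \<mm>" "r - str R b \<in> \<mm>"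
  then have "(r - str R b) - (r - str R a) \<in> \<mm>" by (rule mm_diff[rotated])
  then have "str R a - str R b \<in> \<mm>" by simp
  then have "str R a - str R b = 0" by (rule mm_gr0) (auto simp: gr_0 intro!: gr_diff[of _ 0, unfolded gr_0])
  then show "a = b" by (simp add: str_inj)
qed

abbreviation res where "res \<equiv> residue_map R"

lemma res_mm: "r - str R (res r) \<in> \<mm>"
  unfolding residue_map_def by (rule theI'[OF residue_ex1])

lemma res_eqI: "r - str R a \<in> \<mm> \<Longrightarrow> res r = a"
  unfolding residue_map_def using residue_ex1 by (rule the1_equality)

lemma res_str [simp]: "res (str R a) = a"
  by (rule res_eqI) (simp add: mm_zero)

lemma res_0 [simp]: "res 0 = 0"
  using res_str[of 0] by simp

lemma res_1 [simp]: "res 1 = 1"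
  using res_str[of 1] by (simp add: str_hom)

lemma res_add: "res (r + s) = res r + res s"
  using mm_add[OF res_mm[of r] res_mm[of s]] by (intro res_eqI) (simp add: str_hom algebra_simps)

lemma res_mult: "res (r * s) = res r * res s"
proof (rule res_eqI)
  have "r * s - str R (res r * res s) = r * (s - str R (res s)) + str R (res s) * (r - str R (res r))"
    by (simp add: str_hom algebra_simps)
  then show "r * s - str R (res r * res s) \<in> \<mm>" by (simp add: mm_add mm_mult res_mm)
qed

lemma res_pos: "r \<in> rp n \<Longrightarrow> n \<noteq> 0 \<Longrightarrow> res r = 0"
proof -
  assume r: "r \<in> rp n" "n \<noteq> 0"
  show ?thesis
  proof (cases "n < 0")
    case True then show ?thesis using r rp_neg by auto
  next
    case False
    then have "r \<in> \<mm>" using r mm_gr[of r "nat n"] by (simp add: regular_mod_def)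
    then show ?thesis by (intro res_eqI) simp
  qed
qed

lemma str_res: "r \<in> rp 0 \<Longrightarrow> str R (res r) = r"
  by (auto simp: rp_0)

end

context std_graded begin

section \<open>Graded modules\<close>

text \<open>
  The homology of \<open>F \<otimes> N\<close> depends on the components of \<open>N\<close> only. So modules are studied degree by
  degree, without reference to a carrier; kernels and images of homogeneous maps are then again modules.
\<close>
definition gmod :: "('r, 'n::ab_group_add) grad_mod \<Rightarrow> bool" where
  "gmod N \<longleftrightarrow> module (smult N) \<and>
     (\<forall>j. 0 \<in> piece N j \<and> (\<forall>x\<in>piece N j. \<forall>y\<in>piece N j. x - y \<in> piece N j)) \<and>
     (\<forall>n j. \<forall>r\<in>rp n. \<forall>x\<in>piece N j. smult N r x \<in> piece N (n + j))"

lemma gmod_module: "gmod N \<Longrightarrow> module (smult N)"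
  by (simp add: gmod_def)

lemma gm_0 [simp]: "gmod N \<Longrightarrow> 0 \<in> piece N j"
  by (simp add: gmod_def)

lemma gm_diff: "gmod N \<Longrightarrow> x \<in> piece N j \<Longrightarrow> y \<in> piece N j \<Longrightarrow> x - y \<in> piece N j"
  by (simp add: gmod_def)

lemma gm_uminus: "gmod N \<Longrightarrow> x \<in> piece N j \<Longrightarrow> - x \<in> piece N j"
  using gm_diff[of N 0 j x] by simp

lemma gm_add: "gmod N \<Longrightarrow> x \<in> piece N j \<Longrightarrow> y \<in> piece N j \<Longrightarrow> x + y \<in> piece N j"
  using gm_diff[of N x j "- y"] gm_uminus[of N y j] by simp

lemma gm_sum: "gmod N \<Longrightarrow> (\<And>i. i \<in> S \<Longrightarrow> f i \<in> piece N j) \<Longrightarrow> sum f S \<in> piece N j"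
  by (induction S rule: infinite_finite_induct) (auto intro: gm_add)

lemma gm_act: "gmod N \<Longrightarrow> r \<in> rp n \<Longrightarrow> x \<in> piece N j \<Longrightarrow> n + j = k \<Longrightarrow> smult N r x \<in> piece N k"
  by (auto simp: gmod_def)

lemma gm_act_nat:
  "gmod N \<Longrightarrow> r \<in> gr R n \<Longrightarrow> x \<in> piece N j \<Longrightarrow> int n + j = k \<Longrightarrow> smult N r x \<in> piece N k"
  by (rule gm_act[of N r "int n"]) (simp_all add: rp_nat)

lemma gm_str: "gmod N \<Longrightarrow> x \<in> piece N j \<Longrightarrow> smult N (str R a) x \<in> piece N j"
  by (rule gm_act[of N _ 0]) auto

lemma
  assumes "gmod N"
  shows sm_add_right: "smult N r (x + y) = smult N r x + smult N r y"
    and sm_add_left: "smult N (r + s) x = smult N r x + smult N s x"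
    and sm_diff_right: "smult N r (x - y) = smult N r x - smult N r y"
    and sm_0_left [simp]: "smult N 0 x = 0"
    and sm_0_right [simp]: "smult N r 0 = 0"
    and sm_1 [simp]: "smult N 1 x = x"
    and sm_mult: "smult N r (smult N s x) = smult N (r * s) x"
    and sm_sum_right: "smult N r (\<Sum>i\<in>S. f i) = (\<Sum>i\<in>S. smult N r (f i))"
    and sm_sum_left: "smult N (\<Sum>i\<in>S. g i) x = (\<Sum>i\<in>S. smult N (g i) x)"
    and sm_minus_right: "smult N r (- x) = - smult N r x"
proof -
  interpret module "smult N" by (rule gmod_module[OF assms])
  show "smult N r (x + y) = smult N r x + smult N r y" "smult N (r + s) x = smult N r x + smult N s x"
    "smult N r (x - y) = smult N r x - smult N r y" "smult N 0 x = 0" "smult N r 0 = 0"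
    "smult N 1 x = x" "smult N r (smult N s x) = smult N (r * s) x"
    "smult N r (\<Sum>i\<in>S. f i) = (\<Sum>i\<in>S. smult N r (f i))"
    "smult N (\<Sum>i\<in>S. g i) x = (\<Sum>i\<in>S. smult N (g i) x)"
    "smult N r (- x) = - smult N r x"
    by (simp_all add: scale_right_distrib scale_left_distrib scale_right_diff_distrib
        scale_sum_right scale_sum_left)
qed

lemma gmod_vector_space: "gmod N \<Longrightarrow> vector_space (\<lambda>a. smult N (str R a))"
  by unfold_locales (simp_all add: sm_add_right sm_add_left sm_mult str_hom)

lemma gmodI:
  assumes "module (smult N)" "\<And>j. 0 \<in> piece N j"
    and "\<And>j x y. x \<in> piece N j \<Longrightarrow> y \<in> piece N j \<Longrightarrow> x - y \<in> piece N j"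
    and "\<And>n j r x. 0 \<le> n \<Longrightarrow> r \<in> rp n \<Longrightarrow> x \<in> piece N j \<Longrightarrow> smult N r x \<in> piece N (n + j)"
  shows "gmod N"
proof -
  have "smult N r x \<in> piece N (n + j)" if "r \<in> rp n" "x \<in> piece N j" for n j r x
  proof (cases "n < 0")
    case True
    then have "smult N r x = 0" using that rp_neg module.scale_zero_left[OF assms(1)] by auto
    then show ?thesis using assms(2) by simp
  qed (use that assms(4) in auto)
  then show ?thesis using assms(1-3) by (simp add: gmod_def)
qed

lemma graded_module_gmod:
  assumes "graded_module R N" shows "gmod N"
proof (rule gmodI)
  show "module (smult N)" "\<And>j. 0 \<in> piece N j"
    "\<And>j x y. x \<in> piece N j \<Longrightarrow> y \<in> piece N j \<Longrightarrow> x - y \<in> piece N j"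
    using assms unfolding graded_module_def internal_grading_def by blast+
  fix n j :: int and r x assume "0 \<le> n" "r \<in> rp n" "x \<in> piece N j"
  then show "smult N r x \<in> piece N (n + j)"
    using assms rp_nat[of "nat n"] unfolding graded_module_def by force
qed

lemma gmod_regular: "gmod (regular_mod R)"
proof (rule gmodI)
  show "module (smult (regular_mod R))" using module_R by (simp add: regular_mod_def)
  fix n j :: int and r x assume "r \<in> rp n" "x \<in> rp j"
  then show "smult (regular_mod R) r x \<in> rp (n + j)"
    using rp_mult by (simp add: regular_mod_def)
qed (auto intro: rp_diff)

lemma smult_regular [simp]: "smult (regular_mod R) r x = r * x"
  by (simp add: regular_mod_def)

lemma smult_residue [simp]: "smult (residue_mod R) r a = res r * a"
  by (simp add: residue_mod_def)

lemma piece_residue [simp]: "piece (residue_mod R) j = (if j = 0 then UNIV else {0})"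
  by (simp add: residue_mod_def)

lemma gmod_residue: "gmod (residue_mod R)"
proof (rule gmodI)
  show "module (smult (residue_mod R))"
    by unfold_locales (auto simp: res_add res_mult algebra_simps)
  fix n j :: int and r x assume *: "r \<in> rp n" "x \<in> piece (residue_mod R) j"
  show "smult (residue_mod R) r x \<in> piece (residue_mod R) (n + j)"
    using * res_pos[of r n] by (auto split: if_splits)
qed (auto split: if_splits)

text \<open>
  Additivity is required within a component: maps that sum over the support of a function, such as the
  differential of a tensor complex, are not additive on functions with infinite support.
\<close>
definition ghom where
  "ghom A C f \<longleftrightarrow> (\<forall>j. \<forall>x\<in>piece A j. f x \<in> piece C j) \<and>
     (\<forall>j. \<forall>x\<in>piece A j. \<forall>y\<in>piece A j. f (x + y) = f x + f y) \<and>
     (\<forall>n j. \<forall>r\<in>rp n. \<forall>x\<in>piece A j. f (smult A r x) = smult C r (f x))"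

lemma ghom_piece: "ghom A C f \<Longrightarrow> x \<in> piece A j \<Longrightarrow> f x \<in> piece C j"
  and ghom_add: "ghom A C f \<Longrightarrow> x \<in> piece A j \<Longrightarrow> y \<in> piece A j \<Longrightarrow> f (x + y) = f x + f y"
  and ghom_smult: "ghom A C f \<Longrightarrow> r \<in> rp n \<Longrightarrow> x \<in> piece A j \<Longrightarrow> f (smult A r x) = smult C r (f x)"
  unfolding ghom_def by blast+

lemma ghom_0: "gmod A \<Longrightarrow> ghom A C f \<Longrightarrow> f (0::'n::ab_group_add) = (0::'m::ab_group_add)"
  using ghom_add[of A C f 0 _ 0] gm_0[of A] by simp

lemma ghom_diff:
  assumes "gmod A" "ghom A C f" "x \<in> piece A j" "y \<in> piece A j"
  shows "f (x - y) = (f x :: 'm::ab_group_add) - f (y :: 'n::ab_group_add)"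
  using ghom_add[OF assms(2) gm_diff[OF assms(1,3,4)] assms(4)] by simp

lemma ghom_sum:
  assumes "gmod A" "ghom A C f" "finite S" "\<And>i. i \<in> S \<Longrightarrow> x i \<in> piece A j"
  shows "f (\<Sum>i\<in>S. (x i :: 'n::ab_group_add)) = (\<Sum>i\<in>S. (f (x i) :: 'm::ab_group_add))"
  using assms(3,4)
proof (induction S)
  case empty then show ?case using ghom_0[OF assms(1,2)] by simp
next
  case (insert i S)
  then have "sum x S \<in> piece A j" using assms(1) by (auto intro: gm_sum)
  then show ?case using insert ghom_add[OF assms(2), of "x i" j "sum x S"] by simp
qed

definition ker_mod where
  "ker_mod A f = \<lparr>smult = smult A, piece = (\<lambda>j. {x \<in> piece A j. f x = 0})\<rparr>"

lemma smult_ker_mod [simp]: "smult (ker_mod A f) = smult A"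
  and piece_ker_mod [simp]: "piece (ker_mod A f) j = {x \<in> piece A j. f x = 0}"
  by (simp_all add: ker_mod_def)

definition img_mod where
  "img_mod A C f = \<lparr>smult = smult C, piece = (\<lambda>j. f ` piece A j)\<rparr>"

lemma smult_img_mod [simp]: "smult (img_mod A C f) = smult C"
  and piece_img_mod [simp]: "piece (img_mod A C f) j = f ` piece A j"
  by (simp_all add: img_mod_def)

lemma gmod_ker_mod:
  assumes "gmod A" "gmod C" "ghom A C f" shows "gmod (ker_mod A f)"
proof (rule gmodI)
  show "module (smult (ker_mod A f))" using gmod_module[OF assms(1)] by simp
qed (use assms ghom_0[OF assms(1,3)] ghom_diff[OF assms(1,3)] ghom_smult[OF assms(3)]
  in \<open>auto intro: gm_diff gm_act\<close>)

lemma gmod_img_mod: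
  assumes "gmod A" "gmod C" "ghom A C f" shows "gmod (img_mod A C f)"
proof (rule gmodI)
  show "module (smult (img_mod A C f))" using gmod_module[OF assms(2)] by simp
  show "0 \<in> piece (img_mod A C f) j" for j
    using ghom_0[OF assms(1,3)] gm_0[OF assms(1), of j] by force
  show "x - y \<in> piece (img_mod A C f) j" if "x \<in> piece (img_mod A C f) j" "y \<in> piece (img_mod A C f) j" for x y j
    using that ghom_diff[OF assms(1,3), symmetric, of _ j] gm_diff[OF assms(1), of _ j] by auto
  show "smult (img_mod A C f) r x \<in> piece (img_mod A C f) (n + j)"
    if "r \<in> rp n" "x \<in> piece (img_mod A C f) j" for n j r x
    using that ghom_smult[OF assms(3), symmetric, of r n _ j] gm_act[OF assms(1), of r n _ j] by auto
qed

lemma ghom_img_mod: "ghom A C f \<Longrightarrow> ghom A (img_mod A C f) f"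
  by (auto simp: ghom_def)

subsection \<open>Direct sums of shifts\<close>

text \<open>
  The module \<open>\<Oplus>s\<in>I. N(-e s)\<close>. Terms of complexes of free modules, their tensor products with a module,
  and Koszul modules \<open>M \<otimes> \<And>\<^sup>t R\<^sub>c\<close> are all of this kind.
\<close>
definition dsum :: "('r, 'n::ab_group_add) grad_mod \<Rightarrow> 's set \<Rightarrow> ('s \<Rightarrow> int) \<Rightarrow> ('r, 's \<Rightarrow> 'n) grad_mod" where
  "dsum N I e = \<lparr>smult = (\<lambda>r x s. smult N r (x s)),
     piece = (\<lambda>j. {x. finite {s. x s \<noteq> 0} \<and> {s. x s \<noteq> 0} \<subseteq> I \<and> (\<forall>s\<in>I. x s \<in> piece N (j - e s))})\<rparr>"

lemma smult_dsum [simp]: "smult (dsum N I e) r x = (\<lambda>s. smult N r (x s))"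
  by (simp add: dsum_def)

lemma piece_dsum: "piece (dsum N I e) j =
   {x. finite {s. x s \<noteq> 0} \<and> {s. x s \<noteq> 0} \<subseteq> I \<and> (\<forall>s\<in>I. x s \<in> piece N (j - e s))}"
  by (simp add: dsum_def)

lemma dsum_coord: "gmod N \<Longrightarrow> x \<in> piece (dsum N I e) j \<Longrightarrow> x s \<in> piece N (j - e s)"
  by (cases "s \<in> I"; cases "x s = 0") (auto simp: piece_dsum)

lemma dsum_0: "x \<in> piece (dsum N I e) j \<Longrightarrow> s \<notin> I \<Longrightarrow> x s = 0"
  by (auto simp: piece_dsum)

lemma gmod_dsum:
  assumes "gmod N" shows "gmod (dsum N I e)"
proof (rule gmodI)
  show "module (smult (dsum N I e))"
    by unfold_locales
      (simp_all add: assms fun_eq_iff sm_add_right[OF assms] sm_add_left[OF assms] sm_mult[OF assms])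
  show "0 \<in> piece (dsum N I e) j" for j using assms by (simp add: piece_dsum)
  show "x - y \<in> piece (dsum N I e) j" if "x \<in> piece (dsum N I e) j" "y \<in> piece (dsum N I e) j" for x y j
  proof -
    have "finite ({s. x s \<noteq> 0} \<union> {s. y s \<noteq> 0})" using that by (simp add: piece_dsum)
    then have "finite {s. (x - y) s \<noteq> 0}" by (rule rev_finite_subset) auto
    moreover have "{s. (x - y) s \<noteq> 0} \<subseteq> I"
      using dsum_0[OF that(1)] dsum_0[OF that(2)] by (auto intro: ccontr)
    moreover have "\<forall>s\<in>I. (x - y) s \<in> piece N (j - e s)" using that assms by (auto simp: piece_dsum intro: gm_diff)
    ultimately show ?thesis by (simp add: piece_dsum)
  qed
  show "smult (dsum N I e) r x \<in> piece (dsum N I e) (n + j)"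
    if "r \<in> rp n" "x \<in> piece (dsum N I e) j" for n j r x
  proof -
    have "finite {s. x s \<noteq> 0}" using that by (simp add: piece_dsum)
    then have "finite {s. smult N r (x s) \<noteq> 0}" by (rule rev_finite_subset) (auto simp: assms)
    moreover have "{s. smult N r (x s) \<noteq> 0} \<subseteq> I" using that assms by (auto simp: piece_dsum)
    moreover have "\<forall>s\<in>I. smult N r (x s) \<in> piece N (n + j - e s)"
      using that assms by (auto simp: piece_dsum intro!: gm_act[of N r n _ "j - e _"])
    ultimately show ?thesis by (simp add: piece_dsum)
  qed
qed

abbreviation single :: "'s \<Rightarrow> 'n::zero \<Rightarrow> 's \<Rightarrow> 'n" where
  "single s x \<equiv> (\<lambda>t. if t = s then x else 0)"

lemma dsum_single:
  assumes "gmod N" "s \<in> I" "x \<in> piece N (j - e s)"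
  shows "single s x \<in> piece (dsum N I e) j"
  using assms by (auto simp: piece_dsum)

subsection \<open>The part generated by the maximal ideal\<close>

text \<open>
  The component \<open>(\<mm>N)\<^sub>j\<close>.
\<close>
definition mpart where
  "mpart N j = fsums (\<lambda>n. {smult N r x | r x. 0 < n \<and> r \<in> gr R n \<and> x \<in> piece N (j - int n)})"

lemma mpart_0 [simp]: "0 \<in> mpart N j"
  by (simp add: mpart_def fsums.zero)

lemma mpart_add: "x \<in> mpart N j \<Longrightarrow> y \<in> mpart N j \<Longrightarrow> x + y \<in> mpart N j"
  by (simp add: mpart_def fsums_add)

lemma mpart_in:
  assumes "r \<in> rp n" "0 < n" "x \<in> piece N k" "n + k = j" shows "smult N r x \<in> mpart N j"
proof -
  have "r \<in> gr R (nat n)" "0 < nat n" "x \<in> piece N (j - int (nat n))"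
    using assms rp_nat[of "nat n"] by auto
  then show ?thesis unfolding mpart_def by (intro fsums_in[of _ _ "nat n"]) blast
qed

lemma mpart_induct [consumes 1, case_names zero step]:
  assumes "x \<in> mpart N j" "P 0"
    and "\<And>n r x y. 0 < n \<Longrightarrow> r \<in> rp n \<Longrightarrow> x \<in> piece N (j - n) \<Longrightarrow> y \<in> mpart N j \<Longrightarrow> P y \<Longrightarrow> P (smult N r x + y)"
  shows "P x"
  using assms(1) unfolding mpart_def
proof (induction rule: fsums.induct)
  case zero show ?case by (rule assms(2))
next
  case (step q n y)
  then obtain r x where "q = smult N r x" "0 < n" "r \<in> rp (int n)" "x \<in> piece N (j - int n)"
    by (auto simp: rp_nat)
  then show ?case using step assms(3)[of "int n" r x y] by (auto simp: mpart_def)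
qed

lemma mpart_piece:
  assumes "gmod N" "x \<in> mpart N j" shows "x \<in> piece N j"
  using assms(2)
proof (induction rule: mpart_induct)
  case (step n r x y)
  have "smult N r x \<in> piece N j" by (rule gm_act[OF assms(1) step(2,3)]) simp
  then show ?case using step assms(1) by (simp add: gm_add)
qed (use assms in simp)

lemma mpart_sum: "(\<And>i. i \<in> S \<Longrightarrow> f i \<in> mpart N j) \<Longrightarrow> (\<Sum>i\<in>S. f i) \<in> mpart N j"
  unfolding mpart_def by (rule fsums_sum)

lemma mpart_smult:
  assumes "gmod N" "x \<in> mpart N j" "r \<in> rp n" shows "smult N r x \<in> mpart N (n + j)"
  using assms(2)
proof (induction rule: mpart_induct)
  case zero then show ?case using assms(1) by simp
next
  case (step m s x y)
  have "smult N (s * r) x \<in> mpart N (n + j)"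
  proof -
    have "smult N r x \<in> piece N (n + j - m)"
      using step assms by (auto intro!: gm_act[of N r n _ "j - m"])
    then have "smult N s (smult N r x) \<in> mpart N (n + j)"
      using step by (intro mpart_in[of s m]) auto
    then show ?thesis by (simp add: sm_mult[OF assms(1)])
  qed
  then show ?case using step by (simp add: sm_add_right[OF assms(1)] sm_mult[OF assms(1)] mult.commute mpart_add)
qed

lemma mpart_ghom:
  assumes "gmod A" "ghom A C f" "x \<in> mpart A j" shows "f x \<in> mpart C j"
  using assms(3)
proof (induction rule: mpart_induct)
  case zero then show ?case using ghom_0[OF assms(1,2)] by simp
next
  case (step n r x y)
  have "smult A r x \<in> piece A j" by (rule gm_act[OF assms(1) step(2,3)]) simp
  moreover have "y \<in> piece A j" using step assms(1) mpart_piece by blast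
  ultimately have "f (smult A r x + y) = smult C r (f x) + f y"
    using ghom_add[OF assms(2)] ghom_smult[OF assms(2) step(2,3)] by simp
  moreover have "smult C r (f x) \<in> mpart C j"
    using step ghom_piece[OF assms(2) step(3)] by (intro mpart_in[of r n]) auto
  ultimately show ?case using step by (simp add: mpart_add)
qed

lemma mpart_lift:
  assumes "gmod A" "ghom A C f" "\<And>k. piece C k \<subseteq> f ` piece A k" "y \<in> mpart C j"
  shows "\<exists>x\<in>mpart A j. f x = y"
  using assms(4)
proof (induction rule: mpart_induct)
  case zero then show ?case using ghom_0[OF assms(1,2)] by (intro bexI[of _ 0]) auto
next
  case (step n r c y)
  then obtain x where x: "x \<in> mpart A j" "f x = y" by blast
  obtain a where a: "a \<in> piece A (j - n)" "f a = c" using step assms(3) by blast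
  have ra: "smult A r a \<in> mpart A j" using step a by (intro mpart_in[of r n]) auto
  have "f (smult A r a + x) = smult C r c + y"
    using ghom_add[OF assms(2) mpart_piece[OF assms(1) ra] mpart_piece[OF assms(1) x(1)]]
      ghom_smult[OF assms(2) step(2) a(1)] x a by simp
  then show ?case using ra x by (intro bexI[of _ "smult A r a + x"]) (auto intro: mpart_add)
qed

abbreviation products where
  "products N n k \<equiv> {smult N r x | r x. r \<in> gr R n \<and> x \<in> piece N k}"

text \<open>
  As \<open>\<mm>\<close> is generated by \<open>R\<^sub>1\<close>, products with linear forms suffice.
\<close>
lemma mpart_linear:
  assumes "gmod N" "x \<in> mpart N j"
  shows "x \<in> fsums (\<lambda>_::unit. products N 1 (j - 1))"
  using assms(2)
proof (induction rule: mpart_induct)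
  case zero show ?case by (rule fsums.zero)
next
  case (step n r x y)
  obtain m where m: "n = int (Suc m)" using step(1) by (metis gr0_implies_Suc pos_int_cases)
  have "r \<in> gr R (Suc m)" using step(2) rp_nat[of "Suc m"] unfolding m by blast
  then have "r \<in> fsums (\<lambda>_::unit. gr_products m)" using gr_Suc by blast
  then have "smult N r x \<in> fsums (\<lambda>_::unit. products N 1 (j - 1))"
  proof (rule fsums_image)
    fix q assume "q \<in> gr_products m"
    then obtain a b where ab: "q = a * b" "a \<in> gr R 1" "b \<in> gr R m" by blast
    have "smult N q x = smult N a (smult N b x)" using ab by (simp add: sm_mult[OF assms(1)])
    moreover have "smult N b x \<in> piece N (j - 1)"
      by (rule gm_act_nat[OF assms(1) ab(3) step(3)]) (simp add: m)
    ultimately show "smult N q x \<in> fsums (\<lambda>_::unit. products N 1 (j - 1))"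
      using ab by (intro fsums_in) blast
  qed (simp_all add: assms(1) sm_add_left)
  then show ?case using step by (simp add: fsums_add)
qed

end

context std_graded begin

section \<open>Tensoring a complex of free modules with a module\<close>

abbreviation "\<KK> \<equiv> residue_mod R"
abbreviation "\<RR> \<equiv> regular_mod R"

text \<open>
  The module \<open>F\<^sub>p \<otimes> N\<close>.
\<close>
definition tens where
  "tens F N p = dsum N (basis F p) (deg F p)"

abbreviation ch where "ch F N p j \<equiv> piece (tens F N p) j"

lemma ch_tensor_piece: "tensor_piece F N p j = ch F N p j"
  by (simp add: tensor_piece_def tens_def piece_dsum)

lemma smult_tens [simp]: "smult (tens F N p) r x = (\<lambda>s. smult N r (x s))"
  by (simp add: tens_def)

lemma gmod_tens: "gmod N \<Longrightarrow> gmod (tens F N p)"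
  by (simp add: tens_def gmod_dsum)

lemma ch_finite: "v \<in> ch F N p j \<Longrightarrow> finite {b. v b \<noteq> 0}"
  and ch_supp: "v \<in> ch F N p j \<Longrightarrow> v b \<noteq> 0 \<Longrightarrow> b \<in> basis F p"
  by (auto simp: tens_def piece_dsum)

lemma ch_coord: "gmod N \<Longrightarrow> v \<in> ch F N p j \<Longrightarrow> v b \<in> piece N (j - deg F p b)"
  unfolding tens_def by (rule dsum_coord)

lemma chI:
  assumes "gmod N" "finite S" "\<And>b. v b \<noteq> 0 \<Longrightarrow> b \<in> S \<and> b \<in> basis F p \<and> v b \<in> piece N (j - deg F p b)"
  shows "v \<in> ch F N p j"
proof -
  have "{b. v b \<noteq> 0} \<subseteq> S" using assms(3) by blast
  then have "finite {b. v b \<noteq> 0}" using assms(2) finite_subset by blast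
  moreover have "v b \<in> piece N (j - deg F p b)" for b
    using assms(1,3) by (cases "v b = 0") auto
  ultimately show ?thesis using assms(3) by (auto simp: tens_def piece_dsum)
qed

lemma ch_single:
  "gmod N \<Longrightarrow> b \<in> basis F p \<Longrightarrow> x \<in> piece N (j - deg F p b) \<Longrightarrow> single b x \<in> ch F N p j"
  unfolding tens_def by (rule dsum_single)

definition free_complex where
  "free_complex F \<longleftrightarrow> (\<forall>i. \<forall>b\<in>basis F (Suc i).
        finite {b'. coef F i b b' \<noteq> 0} \<and> {b'. coef F i b b' \<noteq> 0} \<subseteq> basis F i \<and>
        (\<forall>b'\<in>basis F i. coef F i b b' \<in> rp (deg F (Suc i) b - deg F i b')))"

lemma
  assumes "free_complex F" "b \<in> basis F (Suc i)"
  shows coef_finite: "finite {b'. coef F i b b' \<noteq> 0}"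
    and coef_supp: "coef F i b b' \<noteq> 0 \<Longrightarrow> b' \<in> basis F i"
    and coef_rp: "coef F i b b' \<in> rp (deg F (Suc i) b - deg F i b')"
proof -
  show "finite {b'. coef F i b b' \<noteq> 0}" "coef F i b b' \<noteq> 0 \<Longrightarrow> b' \<in> basis F i"
    using assms unfolding free_complex_def by blast+
  show "coef F i b b' \<in> rp (deg F (Suc i) b - deg F i b')"
  proof (cases "b' \<in> basis F i")
    case True then show ?thesis using assms unfolding free_complex_def by blast
  next
    case False
    then have "coef F i b b' = 0" using assms unfolding free_complex_def by blast
    then show ?thesis by simp
  qed
qed

abbreviation td where "td \<equiv> tensor_diff"

lemma td_sum:
  assumes "gmod N" "finite S" "{b. v b \<noteq> 0} \<subseteq> S"
  shows "td F N p v b' = (\<Sum>b\<in>S. smult N (coef F p b b') (v b))"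
  unfolding tensor_diff_def
  by (rule sum.mono_neutral_left) (use assms in auto)

lemma td_cong: "smult A = smult B \<Longrightarrow> td F A p = td F B p"
  by (simp add: tensor_diff_def fun_eq_iff)

lemma td_add:
  assumes "gmod N" "finite {b. v b \<noteq> 0}" "finite {b. w b \<noteq> 0}"
  shows "td F N p (v + w) = td F N p v + td F N p w"
proof (rule ext)
  fix b'
  let ?S = "{b. v b \<noteq> 0} \<union> {b. w b \<noteq> 0}"
  have "td F N p (v + w) b' = (\<Sum>b\<in>?S. smult N (coef F p b b') ((v + w) b))"
    using assms by (intro td_sum) auto
  moreover have "td F N p v b' = (\<Sum>b\<in>?S. smult N (coef F p b b') (v b))"
    using assms by (intro td_sum) auto
  moreover have "td F N p w b' = (\<Sum>b\<in>?S. smult N (coef F p b b') (w b))"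
    using assms by (intro td_sum) auto
  ultimately show "td F N p (v + w) b' = (td F N p v + td F N p w) b'"
    by (simp add: sm_add_right[OF assms(1)] sum.distrib)
qed

lemma ghom_td:
  assumes N: "gmod N" and F: "free_complex F"
  shows "ghom (tens F N (Suc p)) (tens F N p) (td F N p)"
proof -
  have "td F N p v \<in> ch F N p j" if v: "v \<in> ch F N (Suc p) j" for v j
  proof (rule chI[OF N])
    let ?S = "\<Union>b\<in>{b. v b \<noteq> 0}. {b'. coef F p b b' \<noteq> 0}"
    have bas: "v b \<noteq> 0 \<Longrightarrow> b \<in> basis F (Suc p)" for b using ch_supp[OF v] .
    show "finite ?S" using ch_finite[OF v] coef_finite[OF F bas] by auto
    fix b' assume ne: "td F N p v b' \<noteq> 0"
    obtain b where b: "v b \<noteq> 0" "coef F p b b' \<noteq> 0"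
    proof (rule ccontr)
      assume "\<not> thesis"
      then have "\<And>b. v b \<noteq> 0 \<Longrightarrow> coef F p b b' = 0" using that by blast
      then have "td F N p v b' = 0" unfolding tensor_diff_def by (intro sum.neutral) (simp add: N)
      then show False using ne by simp
    qed
    have "td F N p v b' \<in> piece N (j - deg F p b')" unfolding tensor_diff_def
    proof (rule gm_sum[OF N])
      fix b assume "b \<in> {b. v b \<noteq> 0}"
      then have "b \<in> basis F (Suc p)" using bas by simp
      then show "smult N (coef F p b b') (v b) \<in> piece N (j - deg F p b')"
        using ch_coord[OF N v, of b] by (intro gm_act[OF N coef_rp[OF F]]) auto
    qed
    then show "b' \<in> ?S \<and> b' \<in> basis F p \<and> td F N p v b' \<in> piece N (j - deg F p b')"
      using b coef_supp[OF F bas] by blast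
  qed
  moreover have "td F N p (v + w) = td F N p v + td F N p w"
    if "v \<in> ch F N (Suc p) j" "w \<in> ch F N (Suc p) j" for v w j
    by (rule td_add[OF N ch_finite[OF that(1)] ch_finite[OF that(2)]])
  moreover have "td F N p (\<lambda>s. smult N r (v s)) = (\<lambda>s. smult N r (td F N p v s))"
    if "v \<in> ch F N (Suc p) j" for v r j
  proof
    fix b'
    have "td F N p (\<lambda>s. smult N r (v s)) b' = (\<Sum>b | v b \<noteq> 0. smult N (coef F p b b') (smult N r (v b)))"
      using ch_finite[OF that] by (intro td_sum[OF N]) (auto simp: N)
    also have "\<dots> = smult N r (td F N p v b')"
      unfolding tensor_diff_def by (simp add: N sm_sum_right sm_mult mult.commute)
    finally show "td F N p (\<lambda>s. smult N r (v s)) b' = smult N r (td F N p v b')" .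
  qed
  ultimately show ?thesis by (simp add: ghom_def)
qed

lemma td_0: "td F N p 0 = 0"
  by (rule ext) (simp add: tensor_diff_def)

lemma td_in: "gmod N \<Longrightarrow> free_complex F \<Longrightarrow> v \<in> ch F N (Suc p) j \<Longrightarrow> td F N p v \<in> ch F N p j"
  by (rule ghom_piece[OF ghom_td])

lemma td_map:
  assumes A: "gmod A" and C: "gmod C" and f: "ghom A C f" and F: "free_complex F"
    and v: "v \<in> ch F A (Suc p) j"
  shows "td F C p (\<lambda>b. f (v b)) = (\<lambda>b'. f (td F A p v b'))"
proof
  fix b'
  have f0: "f 0 = 0" by (rule ghom_0[OF A f])
  have "f (td F A p v b') = (\<Sum>b | v b \<noteq> 0. f (smult A (coef F p b b') (v b)))"
    unfolding tensor_diff_def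
  proof (rule ghom_sum[OF A f])
    show "finite {b. v b \<noteq> 0}" by (rule ch_finite[OF v])
    fix b assume "b \<in> {b. v b \<noteq> 0}"
    then have "b \<in> basis F (Suc p)" using ch_supp[OF v] by simp
    then show "smult A (coef F p b b') (v b) \<in> piece A (j - deg F p b')"
      using ch_coord[OF A v, of b] by (intro gm_act[OF A coef_rp[OF F]]) auto
  qed
  also have "\<dots> = (\<Sum>b | v b \<noteq> 0. smult C (coef F p b b') (f (v b)))"
  proof (rule sum.cong[OF refl])
    fix b assume "b \<in> {b. v b \<noteq> 0}"
    then have "b \<in> basis F (Suc p)" using ch_supp[OF v] by simp
    then show "f (smult A (coef F p b b') (v b)) = smult C (coef F p b b') (f (v b))"
      using ch_coord[OF A v, of b] coef_rp[OF F] by (intro ghom_smult[OF f]) auto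
  qed
  also have "\<dots> = td F C p (\<lambda>b. f (v b)) b'"
    using ch_finite[OF v] f0 by (intro td_sum[OF C, symmetric]) auto
  finally show "td F C p (\<lambda>b. f (v b)) b' = f (td F A p v b')" by simp
qed

lemma ch_map:
  assumes A: "gmod A" and C: "gmod C" and f: "ghom A C f" and v: "v \<in> ch F A p j"
  shows "(\<lambda>b. f (v b)) \<in> ch F C p j"
proof (rule chI[OF C ch_finite[OF v]])
  fix b assume "f (v b) \<noteq> 0"
  then have "v b \<noteq> 0" using ghom_0[OF A f] by metis
  then show "b \<in> {b. v b \<noteq> 0} \<and> b \<in> basis F p \<and> f (v b) \<in> piece C (j - deg F p b)"
    using ch_supp[OF v] ghom_piece[OF f ch_coord[OF A v]] by blast
qed

lemma ch_lift:
  assumes A: "gmod A" and C: "gmod C" and f: "ghom A C f" and sur: "\<And>k. piece C k \<subseteq> f ` piece A k"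
    and w: "w \<in> ch F C p j"
  shows "\<exists>v \<in> ch F A p j. (\<lambda>b. f (v b)) = w"
proof -
  have "\<exists>x. x \<in> piece A (j - deg F p b) \<and> f x = w b \<and> (w b = 0 \<longrightarrow> x = 0)" for b
  proof (cases "w b = 0")
    case True then show ?thesis using A ghom_0[OF A f] by (intro exI[of _ 0]) auto
  next
    case False
    have "w b \<in> f ` piece A (j - deg F p b)" using sur ch_coord[OF C w, of b] by blast
    then show ?thesis using False by auto
  qed
  then obtain v where v: "\<And>b. v b \<in> piece A (j - deg F p b)" "\<And>b. f (v b) = w b" "\<And>b. w b = 0 \<Longrightarrow> v b = 0"
    by metis
  have "v \<in> ch F A p j"
    using v ch_finite[OF w] ch_supp[OF w] by (intro chI[OF A, of "{b. w b \<noteq> 0}"]) auto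
  then show ?thesis using v(2) by auto
qed

text \<open>
  For a chain \<open>w\<close> of \<open>F\<close> and \<open>x \<in> N\<close>, the next two lemmas treat the chain \<open>w \<otimes> x\<close> of \<open>F \<otimes> N\<close>; they
  transport facts about \<open>F\<close> to \<open>F \<otimes> N\<close>.
\<close>
lemma ch_outer:
  assumes N: "gmod N" and w: "w \<in> ch F \<RR> p n" and x: "x \<in> piece N k" and j: "n + k = j"
  shows "(\<lambda>b. smult N (w b) x) \<in> ch F N p j"
proof (rule chI[OF N])
  show "finite {b. w b \<noteq> 0}" by (rule ch_finite[OF w])
  fix b assume "smult N (w b) x \<noteq> 0"
  then have "w b \<noteq> 0" using N by auto
  then show "b \<in> {b. w b \<noteq> 0} \<and> b \<in> basis F p \<and> smult N (w b) x \<in> piece N (j - deg F p b)"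
    using ch_supp[OF w] ch_coord[OF gmod_regular w, of b] x j by (auto intro!: gm_act[OF N])
qed

lemma td_outer:
  assumes N: "gmod N" and w: "w \<in> ch F \<RR> (Suc p) n"
  shows "td F N p (\<lambda>b. smult N (w b) x) = (\<lambda>b. smult N (td F \<RR> p w b) x)"
proof
  fix b'
  have "td F N p (\<lambda>b. smult N (w b) x) b' = (\<Sum>b | w b \<noteq> 0. smult N (coef F p b b') (smult N (w b) x))"
    using ch_finite[OF w] N by (intro td_sum[OF N]) auto
  also have "\<dots> = smult N (td F \<RR> p w b') x"
    unfolding tensor_diff_def by (simp add: N sm_mult sm_sum_left)
  finally show "td F N p (\<lambda>b. smult N (w b) x) b' = smult N (td F \<RR> p w b') x" .
qed

lemma sum_fun_apply: "(\<Sum>i\<in>S. f i) x = (\<Sum>i\<in>S. f i x)"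
  by (induction S rule: infinite_finite_induct) auto

lemma ch_expand:
  assumes N: "gmod N" and v: "v \<in> ch F N p j"
  shows "v = (\<Sum>b | v b \<noteq> 0. single b (v b))"
proof
  fix t
  show "v t = (\<Sum>b | v b \<noteq> 0. single b (v b)) t"
    using ch_finite[OF v] by (simp add: sum_fun_apply if_distrib sum.delta' cong: if_cong)
qed

text \<open>
  A complex of free modules that is exact in positive degrees, without its augmentation.
\<close>
definition exact_complex where
  "exact_complex F \<longleftrightarrow> free_complex F \<and>
     (\<forall>i j. {v \<in> ch F \<RR> (Suc i) j. td F \<RR> i v = 0} = td F \<RR> (Suc i) ` ch F \<RR> (Suc (Suc i)) j)"

lemma exact_free: "exact_complex F \<Longrightarrow> free_complex F"
  by (simp add: exact_complex_def)

text \<open>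
  The identity holds on a basis element of \<open>F\<close>, where it is part of exactness, hence on each \<open>e\<^sub>b \<otimes> x\<close>.
\<close>
lemma td_td:
  assumes N: "gmod N" and F: "exact_complex F" and v: "v \<in> ch F N (Suc (Suc p)) j"
  shows "td F N p (td F N (Suc p) v) = 0"
proof -
  note fF = exact_free[OF F]
  have g2: "ghom (tens F N (Suc (Suc p))) (tens F N (Suc p)) (td F N (Suc p))"
    and g1: "ghom (tens F N (Suc p)) (tens F N p) (td F N p)" using ghom_td[OF N fF] by auto
  let ?e = "\<lambda>b t. if t = b then v b else 0"
  have *: "td F N p (td F N (Suc p) (?e b)) = 0" "?e b \<in> ch F N (Suc (Suc p)) j" if "v b \<noteq> 0" for b
  proof -
    have b: "b \<in> basis F (Suc (Suc p))" using ch_supp[OF v that] .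
    let ?w = "\<lambda>t. if t = b then 1 else (0::'r)"
    have w: "?w \<in> ch F \<RR> (Suc (Suc p)) (deg F (Suc (Suc p)) b)"
      by (rule ch_single[OF gmod_regular b]) simp
    have w': "td F \<RR> (Suc p) ?w \<in> ch F \<RR> (Suc p) (deg F (Suc (Suc p)) b)"
      by (rule td_in[OF gmod_regular fF w])
    have "td F \<RR> p (td F \<RR> (Suc p) ?w) = 0" using F w unfolding exact_complex_def by blast
    moreover have "?e b = (\<lambda>t. smult N (?w t) (v b))" using N by auto
    ultimately have "td F N p (td F N (Suc p) (?e b)) = (\<lambda>t. smult N (0 t) (v b))"
      by (simp only: td_outer[OF N w] td_outer[OF N w'])
    then show "td F N p (td F N (Suc p) (?e b)) = 0" using N by (simp add: fun_eq_iff)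
    show "?e b \<in> ch F N (Suc (Suc p)) j"
      by (rule ch_single[OF N b ch_coord[OF N v]])
  qed
  have fin: "finite {b. v b \<noteq> 0}" by (rule ch_finite[OF v])
  have "td F N (Suc p) v = (\<Sum>b | v b \<noteq> 0. td F N (Suc p) (?e b))"
    using ghom_sum[OF gmod_tens[OF N] g2 fin, of ?e j] *(2) ch_expand[OF N v] by simp
  then have "td F N p (td F N (Suc p) v) = (\<Sum>b | v b \<noteq> 0. td F N p (td F N (Suc p) (?e b)))"
    using ghom_sum[OF gmod_tens[OF N] g1 fin, of "\<lambda>b. td F N (Suc p) (?e b)" j]
      ghom_piece[OF g2 *(2)] by simp
  also have "\<dots> = 0" using * by simp
  finally show ?thesis .
qed

section \<open>Vanishing of the homology\<close>

text \<open>
  \<open>H\<^sub>p(F \<otimes> N)\<^sub>j = 0\<close>. If \<open>F\<close> resolves the residue field, this is \<open>Tor\<^sub>p(N,K)\<^sub>j = 0\<close>.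
\<close>
definition vanishes where
  "vanishes F N p j \<longleftrightarrow> tensor_cycles F N p j \<subseteq> tensor_boundaries F N p j"

lemma vanishes_0: "vanishes F N 0 j \<longleftrightarrow> ch F N 0 j \<subseteq> td F N 0 ` ch F N 1 j"
  by (simp add: vanishes_def tensor_cycles_def tensor_boundaries_def ch_tensor_piece)

lemma vanishes_Suc: "vanishes F N (Suc p) j \<longleftrightarrow>
    (\<forall>v\<in>ch F N (Suc p) j. td F N p v = 0 \<longrightarrow> v \<in> td F N (Suc p) ` ch F N (Suc (Suc p)) j)"
  by (auto simp: vanishes_def tensor_cycles_def tensor_boundaries_def ch_tensor_piece)

lemma vanishes_exact: "exact_complex F \<Longrightarrow> vanishes F \<RR> (Suc p) j"
  unfolding vanishes_Suc exact_complex_def by blast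

text \<open>
  Tor commutes with direct sums. A cycle has finite support in both directions, so the preimages
  chosen in the summands can be put together to a finitely supported chain.
\<close>
lemma vanishes_dsum:
  assumes N: "gmod N" and F: "free_complex F" and vanishes: "\<And>s. s \<in> I \<Longrightarrow> vanishes F N p (j - e s)"
  shows "vanishes F (dsum N I e) p j"
proof -
  let ?B = "dsum N I e"
  have B: "gmod ?B" by (rule gmod_dsum[OF N])
  have td_coord: "td F ?B q v b' s = td F N q (\<lambda>b. v b s) b'" if "v \<in> ch F ?B (Suc q) j" for v q b' s
  proof -
    have "td F N q (\<lambda>b. v b s) b' = (\<Sum>b | v b \<noteq> 0. smult N (coef F q b b') (v b s))"
      using ch_finite[OF that] by (intro td_sum[OF N]) auto
    then show ?thesis by (simp add: tensor_diff_def sum_fun_apply)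
  qed
  have coord: "(\<lambda>b. v b s) \<in> ch F N q (j - e s)" if v: "v \<in> ch F ?B q j" for v q s
  proof (rule chI[OF N ch_finite[OF v]])
    fix b assume *: "v b s \<noteq> 0"
    then have "v b \<noteq> 0" by auto
    moreover have "v b s \<in> piece N (j - e s - deg F q b)"
      using dsum_coord[OF N ch_coord[OF B v], of b s] by (simp add: algebra_simps)
    ultimately show "b \<in> {b. v b \<noteq> 0} \<and> b \<in> basis F q \<and> v b s \<in> piece N (j - e s - deg F q b)"
      using ch_supp[OF v] by auto
  qed
  have main: "v \<in> td F ?B p ` ch F ?B (Suc p) j"
    if v: "v \<in> ch F ?B p j" and
      bd: "\<And>s. s \<in> I \<Longrightarrow> (\<lambda>b. v b s) \<in> td F N p ` ch F N (Suc p) (j - e s)" for v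
  proof -
    have "\<exists>w. w \<in> ch F N (Suc p) (j - e s) \<and> td F N p w = (\<lambda>b. v b s) \<and> ((\<forall>b. v b s = 0) \<longrightarrow> w = 0)" for s
    proof (cases "\<forall>b. v b s = 0")
      case True
      then show ?thesis
        by (intro exI[of _ 0]) (auto simp: td_0 gm_0[OF gmod_tens[OF N]])
    next
      case False
      then have "s \<in> I" using dsum_0[OF ch_coord[OF B v]] by blast
      then show ?thesis using bd False by fastforce
    qed
    then obtain w where w: "\<And>s. w s \<in> ch F N (Suc p) (j - e s)" "\<And>s. td F N p (w s) = (\<lambda>b. v b s)"
      "\<And>s. (\<forall>b. v b s = 0) \<Longrightarrow> w s = 0" by metis
    define S where "S = (\<Union>b\<in>{b. v b \<noteq> 0}. {s. v b s \<noteq> 0})"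
    have "finite {s. v b s \<noteq> 0}" for b using ch_coord[OF B v, of b] by (simp add: piece_dsum)
    then have S: "finite S" "S \<subseteq> I" using ch_finite[OF v] dsum_0[OF ch_coord[OF B v]] by (auto simp: S_def)
    have wS: "w s b \<noteq> 0 \<Longrightarrow> s \<in> S" for s b using w(3)[of s] by (auto simp: S_def fun_eq_iff)
    define W where "W b s = w s b" for b s
    have "W \<in> ch F ?B (Suc p) j"
    proof (rule chI[OF B])
      show "finite (\<Union>s\<in>S. {b. w s b \<noteq> 0})" using S ch_finite[OF w(1)] by auto
      fix b assume "W b \<noteq> 0"
      then obtain s where s: "w s b \<noteq> 0" by (auto simp: W_def fun_eq_iff)
      have sub: "{s. W b s \<noteq> 0} \<subseteq> S" using wS by (auto simp: W_def)
      then have "finite {s. W b s \<noteq> 0}" using S finite_subset by blast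
      moreover have "W b s \<in> piece N (j - deg F (Suc p) b - e s)" for s
        using ch_coord[OF N w(1), of s b] by (simp add: W_def algebra_simps)
      ultimately have "W b \<in> piece ?B (j - deg F (Suc p) b)" using sub S by (simp add: piece_dsum)
      then show "b \<in> (\<Union>s\<in>S. {b. w s b \<noteq> 0}) \<and> b \<in> basis F (Suc p) \<and> W b \<in> piece ?B (j - deg F (Suc p) b)"
        using s wS ch_supp[OF w(1) s] by blast
    qed
    moreover have "td F ?B p W = v"
    proof (intro ext)
      fix b s
      have "td F ?B p W b s = td F N p (w s) b"
        using td_coord[OF \<open>W \<in> _\<close>] by (simp add: W_def)
      then show "td F ?B p W b s = v b s" using w(2) by simp
    qed
    ultimately show ?thesis by blast
  qed
  show ?thesis
  proof (cases p)
    case 0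
    have "v \<in> td F ?B 0 ` ch F ?B 1 j" if "v \<in> ch F ?B 0 j" for v
      using main[of v] vanishes coord[of v 0] that unfolding 0 vanishes_0 One_nat_def by blast
    then show ?thesis unfolding 0 vanishes_0 by blast
  next
    case (Suc q)
    have "v \<in> td F ?B (Suc q) ` ch F ?B (Suc (Suc q)) j"
      if v: "v \<in> ch F ?B (Suc q) j" "td F ?B q v = 0" for v
    proof -
      have "td F N q (\<lambda>b. v b s) = 0" for s
        using td_coord[OF v(1), of _ s] v(2) by (simp add: fun_eq_iff)
      then show ?thesis using main[of v] v vanishes coord[OF v(1)] unfolding Suc vanishes_Suc by blast
    qed
    then show ?thesis unfolding Suc vanishes_Suc by blast
  qed
qed

lemma vanishes_tens:
  assumes "exact_complex F" shows "vanishes F (tens G \<RR> q) (Suc p) j"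
  unfolding tens_def
  by (rule vanishes_dsum[OF gmod_regular exact_free[OF assms] vanishes_exact[OF assms]])

text \<open>
  For a submodule \<open>A\<close> of \<open>B\<close>: the map \<open>H\<^sub>p(F \<otimes> A)\<^sub>j \<rightarrow> H\<^sub>p(F \<otimes> B)\<^sub>j\<close> is injective. It is the one
  statement about maps between homology groups that the long exact sequence has to provide.
\<close>
definition boundary_injective where
  "boundary_injective F A B p j \<longleftrightarrow> (\<forall>v\<in>ch F A p j. v \<in> td F B p ` ch F B (Suc p) j \<longrightarrow> v \<in> td F A p ` ch F A (Suc p) j)"

lemma ker_mod_ch:
  assumes A: "gmod A" "gmod C" "ghom A C f"
  shows "ch F (ker_mod A f) p j = {v \<in> ch F A p j. (\<lambda>b. f (v b)) = (\<lambda>_. 0)}"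
proof -
  have f0: "f 0 = 0" by (rule ghom_0[OF A(1,3)])
  show ?thesis
  proof (intro equalityI subsetI)
    fix v assume v: "v \<in> ch F (ker_mod A f) p j"
    have "f (v b) = 0" for b
      using ch_coord[OF gmod_ker_mod[OF A] v, of b] by simp
    moreover have "v \<in> ch F A p j" using v by (auto simp: tens_def piece_dsum)
    ultimately show "v \<in> {v \<in> ch F A p j. (\<lambda>b. f (v b)) = (\<lambda>_. 0)}" by simp
  next
    fix v assume "v \<in> {v \<in> ch F A p j. (\<lambda>b. f (v b)) = (\<lambda>_. 0)}"
    then show "v \<in> ch F (ker_mod A f) p j" by (auto simp: tens_def piece_dsum fun_eq_iff)
  qed
qed

lemma td_ker_mod [simp]: "td F (ker_mod A f) p = td F A p"
  by (rule td_cong) simp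

context
  fixes F :: "('r, 'x) free_cx" and A :: "('r, 'n::ab_group_add) grad_mod"
    and C :: "('r, 'm::ab_group_add) grad_mod" and f
  assumes F: "exact_complex F" and A: "gmod A" and C: "gmod C" and f: "ghom A C f"
    and sur: "\<And>k. piece C k \<subseteq> f ` piece A k"
begin

text \<open>
  The kernel of \<open>H\<^sub>p(ker f) \<rightarrow> H\<^sub>p(A)\<close> is the image of the connecting homomorphism from
  \<open>H\<^bsub>p+1\<^esub>(C)\<close>. Instead of constructing that map, a bounding chain is corrected by a lift of a chain over \<open>C\<close>.
\<close>
lemma vanishes_imp_boundary_injective:
  assumes vanishes: "vanishes F C (Suc p) j"
  shows "boundary_injective F (ker_mod A f) A p j"
  unfolding boundary_injective_def
proof (intro ballI impI)
  note fF = exact_free[OF F]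
  fix x assume x: "x \<in> ch F (ker_mod A f) p j" and "x \<in> td F A p ` ch F A (Suc p) j"
  then obtain w where w: "w \<in> ch F A (Suc p) j" "x = td F A p w" by blast
  let ?w = "\<lambda>b. f (w b)"
  have w': "?w \<in> ch F C (Suc p) j" by (rule ch_map[OF A C f w(1)])
  have "td F C p ?w = 0"
    using td_map[OF A C f fF w(1)] x w(2) by (simp add: ker_mod_ch[OF A C f] zero_fun_def)
  then obtain v' where v': "v' \<in> ch F C (Suc (Suc p)) j" "?w = td F C (Suc p) v'"
    using vanishes w' unfolding vanishes_Suc by blast
  obtain v where v: "v \<in> ch F A (Suc (Suc p)) j" "(\<lambda>b. f (v b)) = v'"
    using ch_lift[OF A C f sur v'(1)] by blast
  let ?y = "w - td F A (Suc p) v"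
  have dv: "td F A (Suc p) v \<in> ch F A (Suc p) j" by (rule td_in[OF A fF v(1)])
  have y: "?y \<in> ch F A (Suc p) j" by (rule gm_diff[OF gmod_tens[OF A] w(1) dv])
  have "f (?y b) = 0" for b
  proof -
    have "f (?y b) = f (w b) - f (td F A (Suc p) v b)"
      using ghom_diff[OF A f ch_coord[OF A w(1)] ch_coord[OF A dv], of b] by simp
    then show ?thesis using td_map[OF A C f fF v(1)] v v'(2) by (simp add: fun_eq_iff)
  qed
  then have "?y \<in> ch F (ker_mod A f) (Suc p) j" using y by (simp add: ker_mod_ch[OF A C f])
  moreover have "td F A p ?y = x"
    using ghom_diff[OF gmod_tens[OF A] ghom_td[OF A fF] w(1) dv] td_td[OF A F v(1)] w(2) by simp
  ultimately show "x \<in> td F (ker_mod A f) p ` ch F (ker_mod A f) (Suc p) j" by auto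
qed

text \<open>
  Conversely, \<open>H\<^bsub>p+1\<^esub>(C)\<close> lies between \<open>H\<^bsub>p+1\<^esub>(A) = 0\<close> and the kernel of
  \<open>H\<^sub>p(ker f) \<rightarrow> H\<^sub>p(A)\<close>.
\<close>
lemma boundary_injective_imp_vanishes:
  assumes inj: "boundary_injective F (ker_mod A f) A p j" and vanishes: "vanishes F A (Suc p) j"
  shows "vanishes F C (Suc p) j"
  unfolding vanishes_Suc
proof (intro ballI impI)
  note fF = exact_free[OF F]
  fix w' assume w': "w' \<in> ch F C (Suc p) j" "td F C p w' = 0"
  obtain w where w: "w \<in> ch F A (Suc p) j" "(\<lambda>b. f (w b)) = w'"
    using ch_lift[OF A C f sur w'(1)] by blast
  have dw: "td F A p w \<in> ch F A p j" by (rule td_in[OF A fF w(1)])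
  have "td F A p w \<in> ch F (ker_mod A f) p j"
    using dw td_map[OF A C f fF w(1)] w w' by (simp add: ker_mod_ch[OF A C f] zero_fun_def)
  then obtain y where y: "y \<in> ch F (ker_mod A f) (Suc p) j" "td F A p w = td F A p y"
    using inj w(1) unfolding boundary_injective_def by fastforce
  have y': "y \<in> ch F A (Suc p) j" "\<And>b. f (y b) = 0" using y(1) by (auto simp: ker_mod_ch[OF A C f] fun_eq_iff)
  have "w - y \<in> ch F A (Suc p) j" by (rule gm_diff[OF gmod_tens[OF A] w(1) y'(1)])
  moreover have "td F A p (w - y) = 0"
    using ghom_diff[OF gmod_tens[OF A] ghom_td[OF A fF] w(1) y'(1)] y(2) by simp
  ultimately obtain v where v: "v \<in> ch F A (Suc (Suc p)) j" "w - y = td F A (Suc p) v"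
    using vanishes unfolding vanishes_Suc by blast
  have "f (w b) = f (td F A (Suc p) v b)" for b
    using ghom_diff[OF A f ch_coord[OF A w(1)] ch_coord[OF A y'(1)], of b] y'(2)
    by (simp flip: v(2))
  then have "w' = td F C (Suc p) (\<lambda>b. f (v b))"
    using w(2) td_map[OF A C f fF v(1)] by (simp add: fun_eq_iff)
  then show "w' \<in> td F C (Suc p) ` ch F C (Suc (Suc p)) j"
    using ch_map[OF A C f v(1)] by blast
qed

lemma vanishes_ker_mod:
  assumes "vanishes F A p j" "vanishes F C (Suc p) j"
  shows "vanishes F (ker_mod A f) p j"
proof -
  have inj: "boundary_injective F (ker_mod A f) A p j" by (rule vanishes_imp_boundary_injective[OF assms(2)])
  have sub: "ch F (ker_mod A f) p j \<subseteq> ch F A p j" for p by (auto simp: ker_mod_ch[OF A C f])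
  show ?thesis
  proof (cases p)
    case 0
    then show ?thesis using inj assms(1) sub[of 0] unfolding 0 vanishes_0 boundary_injective_def One_nat_def by blast
  next
    case (Suc q)
    then show ?thesis
      using inj assms(1) sub[of "Suc q"] unfolding Suc vanishes_Suc boundary_injective_def td_ker_mod by blast
  qed
qed

lemma vanishes_quot:
  assumes "vanishes F (ker_mod A f) p j" "vanishes F A (Suc p) j"
  shows "vanishes F C (Suc p) j"
proof (rule boundary_injective_imp_vanishes[OF _ assms(2)])
  show "boundary_injective F (ker_mod A f) A p j" unfolding boundary_injective_def
  proof (intro ballI impI)
    fix v assume v: "v \<in> ch F (ker_mod A f) p j" "v \<in> td F A p ` ch F A (Suc p) j"
    show "v \<in> td F (ker_mod A f) p ` ch F (ker_mod A f) (Suc p) j"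
    proof (cases p)
      case 0 then show ?thesis using v assms(1) unfolding 0 vanishes_0 by auto
    next
      case (Suc q)
      then have "td F A q v = 0" using v td_td[OF A F] by auto
      then show ?thesis using v assms(1) unfolding Suc vanishes_Suc by auto
    qed
  qed
qed

end

end

text \<open>
  Each finite subset of the spanning set has only finitely many elements of \<open>B\<close> in its span.
\<close>
lemma (in vector_space) countable_independent_in_span:
  assumes "independent B" "B \<subseteq> span C" "countable C"
  shows "countable B"
proof -
  have "B \<subseteq> (\<Union>T\<in>{T. finite T \<and> T \<subseteq> C}. B \<inter> span T)"
  proof
    fix b assume b: "b \<in> B"
    then have "b \<in> span C" using assms by blast
    then obtain T r where T: "finite T" "T \<subseteq> C" "b = (\<Sum>a\<in>T. scale (r a) a)"
      unfolding span_explicit by blast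
    have "b \<in> span T" unfolding T(3) by (intro span_sum span_scale span_base)
    then show "b \<in> (\<Union>T\<in>{T. finite T \<and> T \<subseteq> C}. B \<inter> span T)" using b T by blast
  qed
  moreover have "countable (\<Union>T\<in>{T. finite T \<and> T \<subseteq> C}. B \<inter> span T)"
  proof (rule countable_UN)
    show "countable {T. finite T \<and> T \<subseteq> C}" using assms(3) by (rule countable_Collect_finite_subset)
    fix T assume "T \<in> {T. finite T \<and> T \<subseteq> C}"
    then have "finite (B \<inter> span T)"
      using independent_span_bound[of T "B \<inter> span T"] independent_mono[OF assms(1)] by blast
    then show "countable (B \<inter> span T)" by (rule countable_finite)
  qed
  ultimately show ?thesis using countable_subset by blast
qed

context std_graded begin

section \<open>Minimal free covers and resolutions\<close>

text \<open>
  The map from a free module with basis elements \<open>e\<^sub>b\<close> that sends \<open>e\<^sub>b\<close> to \<open>g b\<close>.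
\<close>
definition lincomb where
  "lincomb N g v = (\<Sum>b | v b \<noteq> 0. smult N (v b) (g b))"

lemma lincomb_sum:
  assumes "gmod N" "finite S" "{b. v b \<noteq> 0} \<subseteq> S"
  shows "lincomb N g v = (\<Sum>b\<in>S. smult N (v b) (g b))"
  unfolding lincomb_def by (rule sum.mono_neutral_left) (use assms in auto)

lemma ghom_lincomb:
  assumes N: "gmod N" and g: "\<And>b. b \<in> I \<Longrightarrow> g b \<in> piece N (e b)"
  shows "ghom (dsum \<RR> I e) N (lincomb N g)"
proof -
  have "lincomb N g v \<in> piece N j" if v: "v \<in> piece (dsum \<RR> I e) j" for v j
    unfolding lincomb_def
  proof (rule gm_sum[OF N])
    fix b assume "b \<in> {b. v b \<noteq> 0}"
    then have "b \<in> I" using v by (auto simp: piece_dsum)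
    then show "smult N (v b) (g b) \<in> piece N j"
      using g dsum_coord[OF gmod_regular v, of b] by (intro gm_act[OF N, of _ "j - e b"]) auto
  qed
  moreover have "lincomb N g (v + w) = lincomb N g v + lincomb N g w"
    if v: "v \<in> piece (dsum \<RR> I e) j" and w: "w \<in> piece (dsum \<RR> I e) j" for v w j
  proof -
    let ?S = "{b. v b \<noteq> 0} \<union> {b. w b \<noteq> 0}"
    have S: "finite ?S" using v w by (auto simp: piece_dsum)
    have "lincomb N g (v + w) = (\<Sum>b\<in>?S. smult N ((v + w) b) (g b))" using S by (intro lincomb_sum[OF N]) auto
    moreover have "lincomb N g v = (\<Sum>b\<in>?S. smult N (v b) (g b))" using S by (intro lincomb_sum[OF N]) auto
    moreover have "lincomb N g w = (\<Sum>b\<in>?S. smult N (w b) (g b))" using S by (intro lincomb_sum[OF N]) auto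
    ultimately show ?thesis by (simp add: sm_add_left[OF N] sum.distrib)
  qed
  moreover have "lincomb N g (\<lambda>s. r * v s) = smult N r (lincomb N g v)"
    if v: "v \<in> piece (dsum \<RR> I e) j" for v r j
  proof -
    have "finite {b. v b \<noteq> 0}" using v by (auto simp: piece_dsum)
    then have "lincomb N g (\<lambda>s. r * v s) = (\<Sum>b | v b \<noteq> 0. smult N (r * v b) (g b))"
      by (intro lincomb_sum[OF N]) auto
    then show ?thesis unfolding lincomb_def by (simp add: sm_sum_right[OF N] sm_mult[OF N])
  qed
  ultimately show ?thesis by (simp add: ghom_def)
qed

text \<open>
  This property passes to graded submodules and to countable direct sums of shifts, hence to all
  syzygies. It is what allows bases indexed by natural numbers.
\<close>
definition countably_spanned where
  "countably_spanned N \<longleftrightarrow>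
     (\<exists>C. countable C \<and> (\<forall>j. piece N j \<subseteq> module.span (\<lambda>a. smult N (str R a)) C))"

lemma countably_spanned_regular: "countably_spanned \<RR>"
proof -
  have "smult \<RR> (str R a) = (*) (str R a)" for a by (simp add: fun_eq_iff)
  then show ?thesis using countable_span_R unfolding countably_spanned_def by fastforce
qed

lemma countably_spanned_ker_mod: "countably_spanned A \<Longrightarrow> countably_spanned (ker_mod A f)"
  unfolding countably_spanned_def by fastforce

lemma countably_spanned_dsum:
  assumes N: "gmod N" and C: "countably_spanned N" and I: "countable I"
  shows "countably_spanned (dsum N I e)"
proof -
  let ?Q = "dsum N I e"
  interpret W: vector_space "\<lambda>a. smult N (str R a)" by (rule gmod_vector_space[OF N])
  interpret V: vector_space "\<lambda>a. smult ?Q (str R a)" by (rule gmod_vector_space[OF gmod_dsum[OF N]])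
  obtain C where C: "countable C" "\<And>j. piece N j \<subseteq> W.span C"
    using C unfolding countably_spanned_def by blast
  define E where "E = (\<Union>s\<in>I. (\<lambda>c t. if t = s then c else 0) ` C)"
  have cE: "countable E" unfolding E_def using C I by auto
  have single: "single s x \<in> V.span E" if s: "s \<in> I" and x: "x \<in> W.span C" for s x
    using x
  proof (induction rule: W.span_induct_alt)
    case base
    have "single s 0 = (0 :: 'b \<Rightarrow> 'a)" by auto
    then show ?case using V.span_zero[of E] by (simp only:)
  next
    case (step a c x)
    have "single s c \<in> E" using step(1) s by (auto simp: E_def)
    then have "smult ?Q (str R a) (single s c) + single s x \<in> V.span E"
      by (intro V.span_add[OF V.span_scale[OF V.span_base] step(2)])
    moreover have "smult ?Q (str R a) (single s c) + single s x =
        single s (smult N (str R a) c + x)" by (auto simp: N)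
    ultimately show ?case by (simp only:)
  qed
  have "piece ?Q j \<subseteq> V.span E" for j
  proof
    fix v assume v: "v \<in> piece ?Q j"
    then have fin: "finite {b. v b \<noteq> 0}" by (simp add: piece_dsum)
    then have "v = (\<Sum>b | v b \<noteq> 0. single b (v b))"
      by (auto simp: sum_fun_apply fun_eq_iff sum.delta')
    moreover have "(\<Sum>b | v b \<noteq> 0. single b (v b)) \<in> V.span E"
    proof (rule V.span_sum)
      fix b assume "b \<in> {b. v b \<noteq> 0}"
      then have "b \<in> I" using v by (auto simp: piece_dsum)
      then show "single b (v b) \<in> V.span E"
        using single C(2) dsum_coord[OF N v, of b] by blast
    qed
    ultimately show "v \<in> V.span E" by simp
  qed
  then show ?thesis unfolding countably_spanned_def using cE by blast
qed

text \<open>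
  A free cover whose kernel lies in \<open>\<mm>F\<close>: a coordinate at a basis element of degree \<open>j\<close> of an element
  of degree \<open>j\<close> is a scalar, and all others lie in \<open>\<mm>\<close> automatically. The number \<open>k\<close> bounds the degrees of
  the basis from below.
\<close>
definition min_cover where
  "min_cover N k I e g \<longleftrightarrow> (\<forall>b\<in>I. g b \<in> piece N (e b) \<and> k \<le> e b) \<and>
     (\<forall>j. piece N j \<subseteq> lincomb N g ` piece (dsum \<RR> I e) j) \<and>
     (\<forall>j. \<forall>v\<in>piece (dsum \<RR> I e) j. lincomb N g v = 0 \<longrightarrow> (\<forall>b. e b = j \<longrightarrow> v b = 0))"

text \<open>
  A \<open>K\<close>-basis of \<open>(\<mm>N)\<^sub>j\<close> is extended to one of \<open>N\<^sub>j\<close>; the elements added form \<open>H\<close>.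
\<close>
lemma minimal_generators:
  assumes N: "gmod N" and C: "countably_spanned N"
  shows "\<exists>H. H \<subseteq> piece N j \<and> countable H \<and>
    (\<forall>x\<in>piece N j. \<exists>y\<in>mpart N j. \<exists>z\<in>module.span (\<lambda>a. smult N (str R a)) H. x = y + z) \<and>
    (\<forall>h\<in>H. h \<notin> module.span (\<lambda>a. smult N (str R a)) (mpart N j \<union> (H - {h})))"
proof -
  interpret V: vector_space "\<lambda>a. smult N (str R a)" by (rule gmod_vector_space[OF N])
  obtain C where C: "countable C" "piece N j \<subseteq> V.span C"
    using C unfolding countably_spanned_def by blast
  have sub: "V.subspace (mpart N j)"
    by (rule V.subspaceI) (use mpart_smult[OF N, of _ j _ 0] in \<open>auto intro: mpart_add\<close>)
  obtain B1 where B1: "B1 \<subseteq> mpart N j" "V.independent B1" "mpart N j \<subseteq> V.span B1"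
    using V.maximal_independent_subset[of "mpart N j"] by blast
  have "B1 \<subseteq> piece N j" using B1(1) mpart_piece[OF N] by blast
  then obtain B where B: "B1 \<subseteq> B" "B \<subseteq> piece N j" "V.independent B" "piece N j \<subseteq> V.span B"
    using V.maximal_independent_subset_extend[OF _ B1(2)] by metis
  have cB: "countable B"
    using V.countable_independent_in_span[OF B(3) _ C(1)] B(2) C(2) by blast
  let ?H = "B - B1"
  have "\<exists>y\<in>mpart N j. \<exists>z\<in>V.span ?H. x = y + z" if "x \<in> piece N j" for x
  proof -
    have "x \<in> V.span (B1 \<union> ?H)" using B that by (metis Un_Diff_cancel Un_absorb1 subsetD)
    then obtain y z where "y \<in> V.span B1" "z \<in> V.span ?H" "x = y + z"
      unfolding V.span_Un by blast
    moreover have "V.span B1 \<subseteq> mpart N j" using V.span_minimal[OF B1(1) sub] .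
    ultimately show ?thesis by blast
  qed
  moreover have "h \<notin> V.span (mpart N j \<union> (?H - {h}))" if h: "h \<in> ?H" for h
  proof
    assume "h \<in> V.span (mpart N j \<union> (?H - {h}))"
    moreover have "mpart N j \<union> (?H - {h}) \<subseteq> V.span (B - {h})"
    proof -
      have "B1 \<subseteq> B - {h}" using B(1) h by blast
      then have "mpart N j \<subseteq> V.span (B - {h})" using B1(3) V.span_mono by blast
      then show ?thesis using V.span_superset[of "B - {h}"] by blast
    qed
    ultimately have "h \<in> V.span (B - {h})" using V.span_minimal[OF _ V.subspace_span] by blast
    then show False using B(3) h unfolding V.dependent_def by blast
  qed
  moreover have "countable ?H" "?H \<subseteq> piece N j" using cB B by auto
  ultimately show ?thesis by (intro exI[of _ ?H]) blast
qed

text \<open>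
  The basis is the union over all \<open>j\<close> of the complements from \<open>minimal_generators\<close>. The graded form of
  the lemma of Nakayama, an induction on the degree, gives surjectivity; independence modulo \<open>\<mm>N\<close> puts
  the kernel into \<open>\<mm>F\<close>.
\<close>
lemma ex_min_cover:
  assumes N: "gmod N" and C: "countably_spanned N" and low: "\<And>j. j < k \<Longrightarrow> piece N j = {0}"
  shows "\<exists>(I :: nat set) e g. min_cover N k I e g"
proof -
  interpret V: vector_space "\<lambda>a. smult N (str R a)" by (rule gmod_vector_space[OF N])
  obtain H where H: "\<And>j. H j \<subseteq> piece N j" "\<And>j. countable (H j)"
    "\<And>j x. x \<in> piece N j \<Longrightarrow> \<exists>y\<in>mpart N j. \<exists>z\<in>V.span (H j). x = y + z"
    "\<And>j h. h \<in> H j \<Longrightarrow> h \<notin> V.span (mpart N j \<union> (H j - {h}))"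
    using minimal_generators[OF N C] by metis
  define A where "A = (SIGMA j:UNIV. H j)"
  have cA: "countable A" unfolding A_def using H(2) by auto
  define I where "I = to_nat_on A ` A"
  define e where "e b = fst (inv_into A (to_nat_on A) b)" for b
  define g where "g b = snd (inv_into A (to_nat_on A) b)" for b
  have inv: "inv_into A (to_nat_on A) (to_nat_on A a) = a" if "a \<in> A" for a
    using inj_on_to_nat_on[OF cA] that by (rule inv_into_f_f)
  have gH: "g b \<in> H (e b)" if "b \<in> I" for b
    using that inv by (auto simp: I_def e_def g_def A_def)
  have exb: "\<exists>b\<in>I. e b = j \<and> g b = h" if "h \<in> H j" for h j
  proof -
    have "(j, h) \<in> A" using that by (simp add: A_def)
    then show ?thesis using inv[of "(j, h)"] unfolding I_def e_def g_def by force
  qed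
  have uniq: "b = b'" if "b \<in> I" "b' \<in> I" "e b = e b'" "g b = g b'" for b b'
    using that inv unfolding I_def e_def g_def by (auto simp: prod_eq_iff)
  let ?F = "dsum \<RR> I e"
  have F: "gmod ?F" by (rule gmod_dsum[OF gmod_regular])
  have gp: "g b \<in> piece N (e b)" if "b \<in> I" for b using gH[OF that] H(1) by blast
  have lincomb: "ghom ?F N (lincomb N g)" by (rule ghom_lincomb[OF N gp])
  have ke: "k \<le> e b" if "b \<in> I" for b
  proof (rule ccontr)
    assume "\<not> k \<le> e b"
    then have "g b = 0" using low gp[OF that] by auto
    then show False using H(4)[OF gH[OF that]] V.span_zero by simp
  qed
  have sur: "piece N j \<subseteq> lincomb N g ` piece ?F j" for j
  proof (induction "nat (j - k + 1)" arbitrary: j rule: less_induct)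
    case less
    note ghom_0[OF F lincomb]
    then have im0: "0 \<in> lincomb N g ` piece ?F j" using F by (metis gm_0 image_eqI)
    have imadd: "x + y \<in> lincomb N g ` piece ?F j" if x: "x \<in> lincomb N g ` piece ?F j" and y: "y \<in> lincomb N g ` piece ?F j" for x y
    proof -
      obtain v w where v: "x = lincomb N g v" "v \<in> piece ?F j" and w: "y = lincomb N g w" "w \<in> piece ?F j"
        using x y by blast
      then have "x + y = lincomb N g (v + w)" using ghom_add[OF lincomb v(2) w(2)] by simp
      then show ?thesis using gm_add[OF F v(2) w(2)] by blast
    qed
    show ?case
    proof (cases "j < k")
      case True then show ?thesis using low im0 by auto
    next
      case False
      have mp: "y \<in> lincomb N g ` piece ?F j" if "y \<in> mpart N j" for y
        using that
      proof (induction rule: mpart_induct)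
        case zero show ?case by (rule im0)
      next
        case (step n r x y)
        have "x \<in> lincomb N g ` piece ?F (j - n)"
          by (rule subsetD[OF less]) (use step(1,3) False in auto)
        then obtain w where w: "x = lincomb N g w" "w \<in> piece ?F (j - n)" by blast
        have "smult N r x = lincomb N g (smult ?F r w)" using ghom_smult[OF lincomb step(2) w(2)] w(1) by simp
        moreover have "smult ?F r w \<in> piece ?F j" by (rule gm_act[OF F step(2) w(2)]) simp
        ultimately show ?case using imadd step(5) by blast
      qed
      have sp: "z \<in> lincomb N g ` piece ?F j" if "z \<in> V.span (H j)" for z
        using that
      proof (induction rule: V.span_induct_alt)
        case base show ?case by (rule im0)
      next
        case (step a h z)
        obtain b where b: "b \<in> I" "e b = j" "g b = h" using exb[OF step(1)] by blast
        let ?v = "\<lambda>t. if t = b then str R a else 0"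
        have "?v \<in> piece ?F j" by (rule dsum_single[OF gmod_regular b(1)]) (simp add: b)
        moreover have "lincomb N g ?v = smult N (str R a) h"
          by (subst lincomb_sum[OF N, of "{b}"]) (auto simp: b)
        ultimately have "smult N (str R a) h \<in> lincomb N g ` piece ?F j" by force
        then show ?case using imadd step by blast
      qed
      show ?thesis using H(3) mp sp imadd by blast
    qed
  qed
  have "v b0 = 0" if v: "v \<in> piece ?F j" "lincomb N g v = 0" and b0: "e b0 = j" for v j b0
  proof (rule ccontr)
    assume ne: "v b0 \<noteq> 0"
    have fin: "finite {b. v b \<noteq> 0}" and b0I: "b0 \<in> I" using v ne by (auto simp: piece_dsum)
    let ?S = "V.span (mpart N j \<union> (H j - {g b0}))"
    obtain a where a: "v b0 = str R a" using dsum_coord[OF gmod_regular v(1), of b0] b0 by (auto simp: rp_0)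
    then have a0: "a \<noteq> 0" using ne by auto
    have "lincomb N g v = smult N (v b0) (g b0) + (\<Sum>b\<in>{b. v b \<noteq> 0} - {b0}. smult N (v b) (g b))"
      unfolding lincomb_def using fin ne by (subst sum.remove[of _ b0]) auto
    then have "smult N (v b0) (g b0) = - (\<Sum>b\<in>{b. v b \<noteq> 0} - {b0}. smult N (v b) (g b))"
      using v(2) by (simp add: eq_neg_iff_add_eq_0)
    moreover have "(\<Sum>b\<in>{b. v b \<noteq> 0} - {b0}. smult N (v b) (g b)) \<in> ?S"
    proof (rule V.span_sum)
      fix b assume b: "b \<in> {b. v b \<noteq> 0} - {b0}"
      then have bI: "b \<in> I" using v by (auto simp: piece_dsum)
      have vb: "v b \<in> rp (j - e b)" by (rule dsum_coord[OF gmod_regular v(1)])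
      consider "e b = j" | "e b < j" | "e b > j" by linarith
      then show "smult N (v b) (g b) \<in> ?S"
      proof cases
        case 1
        then obtain a where "v b = str R a" using vb by (auto simp: rp_0)
        moreover have "g b \<in> H j - {g b0}" using gH[OF bI] uniq[OF bI b0I] b b0 1 by auto
        ultimately show ?thesis using V.span_scale[OF V.span_base, of "g b"] by simp
      next
        case 2
        then have "smult N (v b) (g b) \<in> mpart N j"
          using vb gp[OF bI] by (intro mpart_in[of _ "j - e b"]) auto
        then show ?thesis by (intro V.span_base) blast
      next
        case 3
        then show ?thesis using b vb rp_neg[of "j - e b"] by simp
      qed
    qed
    ultimately have "smult N (v b0) (g b0) \<in> ?S" by (simp only: V.span_neg)
    then have "smult N (str R (inverse a)) (smult N (v b0) (g b0)) \<in> ?S" by (rule V.span_scale)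
    moreover have "str R (inverse a) * v b0 = 1"
      unfolding a str_hom(3)[symmetric] using a0 str_hom(1) by simp
    ultimately have "g b0 \<in> ?S" by (simp only: sm_mult[OF N] sm_1[OF N])
    then show False using H(4) gH[OF b0I] b0 by simp
  qed
  then have "min_cover N k I e g" unfolding min_cover_def using gp ke sur by blast
  then show ?thesis by blast
qed

text \<open>
  As the kernel lies in \<open>\<mm>F\<close>, it starts at least one degree later than the module that is covered.
  This is why the degrees of the basis elements grow along a minimal resolution.
\<close>
lemma min_cover_kernel:
  assumes N: "gmod N" and mc: "min_cover N k (I :: nat set) e g"
  defines "Q \<equiv> ker_mod (dsum \<RR> I e) (lincomb N g)"
  shows "gmod Q" "countably_spanned Q" "\<And>j. j < k + 1 \<Longrightarrow> piece Q j = {0}"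
proof -
  let ?F = "dsum \<RR> I e"
  have F: "gmod ?F" by (rule gmod_dsum[OF gmod_regular])
  have lincomb: "ghom ?F N (lincomb N g)" using mc by (intro ghom_lincomb[OF N]) (auto simp: min_cover_def)
  show Q: "gmod Q" unfolding Q_def by (rule gmod_ker_mod[OF F N lincomb])
  show "piece Q j = {0}" if "j < k + 1" for j
  proof -
    have "v = 0" if v: "v \<in> piece Q j" for v
    proof
      fix b
      have vF: "v \<in> piece ?F j" "lincomb N g v = 0" using v by (auto simp: Q_def)
      show "v b = 0 b"
      proof (cases "b \<in> I \<and> e b \<noteq> j")
        case True
        then have "j - e b < 0" using mc \<open>j < k + 1\<close> by (auto simp: min_cover_def)
        then show ?thesis using dsum_coord[OF gmod_regular vF(1), of b] rp_neg by auto
      next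
        case False
        then show ?thesis using mc vF dsum_0[OF vF(1)] by (auto simp: min_cover_def)
      qed
    qed
    then show ?thesis using Q by auto
  qed
  show "countably_spanned Q" unfolding Q_def
    by (rule countably_spanned_ker_mod[OF countably_spanned_dsum[OF gmod_regular countably_spanned_regular]]) simp
qed

lemma graded_free_resolution_iff:
  "graded_free_resolution R N F \<longleftrightarrow> exact_complex F \<and>
     (\<forall>b\<in>basis F 0. augm F b \<in> piece N (deg F 0 b)) \<and>
     (\<forall>j. lincomb N (augm F) ` ch F \<RR> 0 j = piece N j) \<and>
     (\<forall>j. {v \<in> ch F \<RR> 0 j. lincomb N (augm F) v = 0} = td F \<RR> 0 ` ch F \<RR> (Suc 0) j)"
proof -
  have "augmentation F N = lincomb N (augm F)" by (simp add: fun_eq_iff augmentation_def lincomb_def)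
  then show ?thesis
    unfolding graded_free_resolution_def exact_complex_def free_complex_def ch_tensor_piece
    by auto
qed

lemma td_lincomb:
  assumes "finite {b. v b \<noteq> 0}" "smult Q = (\<lambda>r x s. r * x s)"
  shows "td F \<RR> p v = lincomb Q (coef F p) v"
  by (rule ext) (simp add: tensor_diff_def lincomb_def sum_fun_apply assms(2) mult.commute)

text \<open>
  Minimal covers are iterated. The first cover maps to the type of \<open>N\<close>, all later ones to functions
  \<open>nat \<Rightarrow> 'r\<close>, which is why the recursion starts with the first syzygy module.
\<close>
lemma ex_minimal_resolution:
  assumes N: "gmod N" and C: "countably_spanned N" and low: "\<And>j. j < k \<Longrightarrow> piece N j = {0}"
  shows "\<exists>F. graded_free_resolution R N F \<and>
    (\<forall>n. \<forall>b\<in>basis F n. k + int n \<le> deg F n b) \<and>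
    (\<forall>n. \<forall>b\<in>basis F (Suc n). \<forall>b'. deg F n b' = deg F (Suc n) b \<longrightarrow> coef F n b b' = 0)"
proof -
  obtain I0 e0 g0 where mc0: "min_cover N k (I0 :: nat set) e0 g0"
    using ex_min_cover[OF N C low] by blast
  define Q0 where "Q0 = ker_mod (dsum \<RR> I0 e0) (lincomb N g0)"
  note Q0 = min_cover_kernel[OF N mc0, folded Q0_def]
  define P where "P n = (\<lambda>(I :: nat set, e, g, Q :: ('r, nat \<Rightarrow> 'r) grad_mod).
    gmod Q \<and> min_cover Q (k + 1 + int n) I e g \<and> smult Q = (\<lambda>r x s. r * x s))" for n :: nat
  define S where "S = (\<lambda>n::nat. \<lambda>(I :: nat set, e, g, Q :: ('r, nat \<Rightarrow> 'r) grad_mod)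
      (I' :: nat set, e' :: nat \<Rightarrow> int, g' :: nat \<Rightarrow> nat \<Rightarrow> 'r, Q'). Q' = ker_mod (dsum \<RR> I e) (lincomb Q g))"
  have sm: "smult (dsum \<RR> I e) = (\<lambda>r x s. r * x s)" for I :: "nat set" and e
    by (simp add: fun_eq_iff)
  have "\<exists>I e g. min_cover Q0 (k + 1) (I :: nat set) e g"
    by (rule ex_min_cover[OF Q0(1,2)]) (rule Q0(3))
  then obtain I e g where "min_cover Q0 (k + 1) (I :: nat set) e g" by blast
  then have start: "P 0 (I, e, g, Q0)" using Q0(1) by (simp add: P_def Q0_def sm)
  have nxt: "\<exists>y. P (Suc n) y \<and> S n x y" if x: "P n x" for n x
  proof -
    obtain I e g Q where x': "x = (I, e, g, Q)" by (cases x)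
    have Q: "gmod Q" "min_cover Q (k + 1 + int n) I e g" using x by (auto simp: x' P_def)
    note Q' = min_cover_kernel[OF Q]
    let ?Q' = "ker_mod (dsum \<RR> I e) (lincomb Q g)"
    have "\<exists>I e g. min_cover ?Q' (k + 1 + int n + 1) (I :: nat set) e g"
      by (rule ex_min_cover[OF Q'(1,2)]) (rule Q'(3))
    then obtain I' e' g' where "min_cover ?Q' (k + 1 + int n + 1) (I' :: nat set) e' g'" by blast
    then have "P (Suc n) (I', e', g', ?Q')" using Q'(1) by (simp add: P_def sm algebra_simps)
    then show ?thesis by (intro exI[of _ "(I', e', g', ?Q')"]) (simp add: S_def x')
  qed
  have "\<exists>f. (\<forall>n. P n (f n)) \<and> (\<forall>n. S n (f n) (f (Suc n))) \<and> f 0 = (I, e, g, Q0)"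
  proof -
    define f where "f = rec_nat (I, e, g, Q0) (\<lambda>n x. SOME y. P (Suc n) y \<and> S n x y)"
    have f0: "f 0 = (I, e, g, Q0)" and fS: "f (Suc n) = (SOME y. P (Suc n) y \<and> S n (f n) y)" for n
      by (simp_all add: f_def)
    have Pf: "P n (f n)" for n
    proof (induction n)
      case 0 then show ?case using start f0 by simp
    next
      case (Suc n) then show ?case unfolding fS using someI_ex[OF nxt[OF Suc]] by blast
    qed
    have "S n (f n) (f (Suc n))" for n unfolding fS using someI_ex[OF nxt[OF Pf[of n]]] by blast
    then show ?thesis using Pf f0 by blast
  qed
  then obtain f where f: "\<And>n. P n (f n)" "\<And>n. S n (f n) (f (Suc n))" "f 0 = (I, e, g, Q0)" by blast
  define II where "II n = fst (f n)" for n
  define ee where "ee n = fst (snd (f n))" for n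
  define gg where "gg n = fst (snd (snd (f n)))" for n
  define QQ where "QQ n = snd (snd (snd (f n)))" for n
  have ff: "f n = (II n, ee n, gg n, QQ n)" for n by (simp add: II_def ee_def gg_def QQ_def)
  have Q: "gmod (QQ n)" "min_cover (QQ n) (k + 1 + int n) (II n) (ee n) (gg n)"
    "smult (QQ n) = (\<lambda>r x s. r * x s)" for n
    using f(1)[of n] by (simp_all add: ff P_def)
  have QS: "QQ (Suc n) = ker_mod (dsum \<RR> (II n) (ee n)) (lincomb (QQ n) (gg n))" for n
    using f(2)[of n] by (simp add: ff S_def)
  have Q00: "QQ 0 = Q0" using f(3) by (simp add: ff)
  define F where "F = \<lparr>basis = case_nat I0 II, deg = case_nat e0 ee, coef = gg, augm = g0\<rparr>"
  have F_simps [simp]: "basis F 0 = I0" "basis F (Suc n) = II n" "deg F 0 = e0" "deg F (Suc n) = ee n"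
    "coef F = gg" "augm F = g0" for n by (simp_all add: F_def)
  have tensF: "tens F \<RR> 0 = dsum \<RR> I0 e0" "tens F \<RR> (Suc n) = dsum \<RR> (II n) (ee n)" for n
    by (simp_all add: tens_def)
  have tdF: "td F \<RR> n v = lincomb (QQ n) (gg n) v" if "v \<in> ch F \<RR> (Suc n) j" for n v j
    using td_lincomb[OF ch_finite[OF that] Q(3), of F n n] by simp
  have Qch: "piece (QQ n) j \<subseteq> ch F \<RR> n j" for n j
    by (cases n) (auto simp: Q00 Q0_def QS tensF)
  have imQ: "td F \<RR> n ` ch F \<RR> (Suc n) j = piece (QQ n) j" for n j
  proof -
    have mc: "min_cover (QQ n) (k + 1 + int n) (II n) (ee n) (gg n)" by (rule Q)
    then have "ghom (dsum \<RR> (II n) (ee n)) (QQ n) (lincomb (QQ n) (gg n))"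
      by (intro ghom_lincomb[OF Q(1)]) (auto simp: min_cover_def)
    then have "lincomb (QQ n) (gg n) ` piece (dsum \<RR> (II n) (ee n)) j \<subseteq> piece (QQ n) j"
      using ghom_piece by blast
    moreover have "piece (QQ n) j \<subseteq> lincomb (QQ n) (gg n) ` piece (dsum \<RR> (II n) (ee n)) j"
      using mc by (simp add: min_cover_def)
    moreover have "td F \<RR> n ` ch F \<RR> (Suc n) j = lincomb (QQ n) (gg n) ` ch F \<RR> (Suc n) j"
      by (rule image_cong[OF refl]) (rule tdF)
    ultimately show ?thesis by (simp add: tensF)
  qed
  have ggQ: "gg n b \<in> piece (QQ n) (ee n b)" if "b \<in> II n" for n b
    using Q(2)[of n] that by (simp add: min_cover_def)
  have fF: "free_complex F" unfolding free_complex_def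
  proof (intro allI ballI)
    fix i b assume "b \<in> basis F (Suc i)"
    then have "b \<in> II i" by simp
    then have *: "gg i b \<in> ch F \<RR> i (ee i b)" using ggQ Qch by blast
    then show "finite {b'. coef F i b b' \<noteq> 0} \<and> {b'. coef F i b b' \<noteq> 0} \<subseteq> basis F i \<and>
        (\<forall>b'\<in>basis F i. coef F i b b' \<in> rp (deg F (Suc i) b - deg F i b'))"
      using ch_finite[OF *] ch_supp[OF *] ch_coord[OF gmod_regular *] by auto
  qed
  have ker: "{v \<in> ch F \<RR> (Suc i) j. td F \<RR> i v = 0} = piece (QQ (Suc i)) j" for i j
    using tdF[of _ i j] by (auto simp: QS tensF)
  have "exact_complex F" unfolding exact_complex_def using fF ker imQ by blast
  moreover have "\<forall>b\<in>basis F 0. augm F b \<in> piece N (deg F 0 b)"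
    using mc0 by (simp add: min_cover_def)
  moreover have "lincomb N (augm F) ` ch F \<RR> 0 j = piece N j" for j
  proof -
    have "ghom (dsum \<RR> I0 e0) N (lincomb N g0)"
      using mc0 by (intro ghom_lincomb[OF N]) (auto simp: min_cover_def)
    then show ?thesis using mc0 ghom_piece by (fastforce simp: min_cover_def tensF)
  qed
  moreover have "{v \<in> ch F \<RR> 0 j. lincomb N (augm F) v = 0} = td F \<RR> 0 ` ch F \<RR> (Suc 0) j" for j
    unfolding imQ Q00 Q0_def by (simp add: tensF)
  ultimately have "graded_free_resolution R N F" by (simp add: graded_free_resolution_iff)
  moreover have "\<forall>n. \<forall>b\<in>basis F n. k + int n \<le> deg F n b"
  proof (intro allI ballI)
    fix n b assume "b \<in> basis F n"
    then show "k + int n \<le> deg F n b"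
      using mc0 Q(2)[of "n - 1"] by (cases n) (auto simp: min_cover_def)
  qed
  moreover have "\<forall>n. \<forall>b\<in>basis F (Suc n). \<forall>b'. deg F n b' = deg F (Suc n) b \<longrightarrow> coef F n b b' = 0"
  proof (intro allI ballI impI)
    fix n b b' assume b: "b \<in> basis F (Suc n)" and eq: "deg F n b' = deg F (Suc n) b"
    have g: "gg n b \<in> piece (QQ n) (ee n b)" using ggQ b by simp
    show "coef F n b b' = 0"
    proof (cases n)
      case 0
      then show ?thesis using g eq mc0 by (auto simp: Q00 Q0_def min_cover_def)
    next
      case (Suc m)
      then show ?thesis using g eq Q(2)[of m] by (auto simp: QS min_cover_def)
    qed
  qed
  ultimately show ?thesis by blast
qed

end

context std_graded begin

section \<open>Reduction modulo the maximal ideal\<close>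

text \<open>
  A homogeneous scalar lies in \<open>\<mm>\<close> unless it is a nonzero element of degree \<open>0\<close>.
\<close>
lemma mpart_free:
  "v \<in> mpart (dsum \<RR> I e) j \<longleftrightarrow> v \<in> piece (dsum \<RR> I e) j \<and> (\<forall>b. e b = j \<longrightarrow> v b = 0)"
proof -
  let ?F = "dsum \<RR> I e"
  have F: "gmod ?F" by (rule gmod_dsum[OF gmod_regular])
  show ?thesis
  proof
    assume v: "v \<in> mpart ?F j"
    then have "\<forall>b. e b = j \<longrightarrow> v b = 0"
    proof (induction rule: mpart_induct)
      case (step n r x y)
      have "x b = 0" if "e b = j" for b
        using dsum_coord[OF gmod_regular step(3), of b] rp_neg[of "- n"] step(1) that by simp
      then show ?case using step by simp
    qed simp
    then show "v \<in> piece ?F j \<and> (\<forall>b. e b = j \<longrightarrow> v b = 0)" using mpart_piece[OF F v] by blast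
  next
    assume v: "v \<in> piece ?F j \<and> (\<forall>b. e b = j \<longrightarrow> v b = 0)"
    then have fin: "finite {b. v b \<noteq> 0}" by (simp add: piece_dsum)
    then have "v = (\<Sum>b | v b \<noteq> 0. single b (v b))"
      by (auto simp: sum_fun_apply fun_eq_iff sum.delta')
    moreover have "(\<Sum>b | v b \<noteq> 0. single b (v b)) \<in> mpart ?F j"
    proof (rule mpart_sum)
      fix b assume b: "b \<in> {b. v b \<noteq> 0}"
      have vb: "v b \<in> rp (j - e b)" using v by (intro dsum_coord[OF gmod_regular]) blast
      have "e b \<noteq> j" using v b by blast
      moreover have "\<not> j - e b < 0" using vb b rp_neg[of "j - e b"] by blast
      ultimately have pos: "0 < j - e b" by linarith
      have "b \<in> I" using v b by (auto simp: piece_dsum)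
      then have "single b 1 \<in> piece ?F (e b)"
        by (intro dsum_single[OF gmod_regular]) auto
      then have "smult ?F (v b) (single b 1) \<in> mpart ?F j"
        by (intro mpart_in[OF vb pos]) auto
      moreover have "smult ?F (v b) (single b 1) = single b (v b)"
        by auto
      ultimately show "single b (v b) \<in> mpart ?F j" by simp
    qed
    ultimately show "v \<in> mpart ?F j" by simp
  qed
qed

lemma ghom_res: "ghom \<RR> \<KK> res"
  using res_pos by (auto simp: ghom_def res_add res_mult)

lemma res_ch: "v \<in> ch F \<RR> p j \<Longrightarrow> (\<lambda>b. res (v b)) \<in> ch F \<KK> p j"
  by (rule ch_map[OF gmod_regular gmod_residue ghom_res])

lemma td_res:
  "free_complex F \<Longrightarrow> v \<in> ch F \<RR> (Suc p) j \<Longrightarrow>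
   td F \<KK> p (\<lambda>b. res (v b)) = (\<lambda>b. res (td F \<RR> p v b))"
  by (rule td_map[OF gmod_regular gmod_residue ghom_res])

lemma str_ch:
  assumes "v \<in> ch F \<KK> p j" shows "(\<lambda>b. str R (v b)) \<in> ch F \<RR> p j"
proof (rule chI[OF gmod_regular ch_finite[OF assms]])
  fix b assume "str R (v b) \<noteq> 0"
  then have "v b \<noteq> 0" by auto
  moreover from this have "j - deg F p b = 0" using ch_coord[OF gmod_residue assms, of b] by (auto split: if_splits)
  ultimately show "b \<in> {b. v b \<noteq> 0} \<and> b \<in> basis F p \<and> str R (v b) \<in> rp (j - deg F p b)"
    using ch_supp[OF assms] by simp
qed

lemma res_eq_0_iff:
  assumes "v \<in> ch F \<RR> p j"
  shows "(\<lambda>b. res (v b)) = 0 \<longleftrightarrow> v \<in> mpart (tens F \<RR> p) j"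
proof
  assume *: "(\<lambda>b. res (v b)) = 0"
  have "v b = 0" if "deg F p b = j" for b
  proof -
    have "v b \<in> rp 0" using ch_coord[OF gmod_regular assms, of b] that by simp
    then have "v b = str R (res (v b))" using str_res by simp
    also have "res (v b) = 0" using fun_cong[OF *, of b] by simp
    finally show ?thesis by simp
  qed
  then show "v \<in> mpart (tens F \<RR> p) j" using assms by (simp add: tens_def mpart_free)
next
  assume "v \<in> mpart (tens F \<RR> p) j"
  then have "\<And>b. deg F p b = j \<Longrightarrow> v b = 0" by (simp add: tens_def mpart_free)
  moreover have "res (v b) = 0" if "deg F p b \<noteq> j" for b
    using res_pos[OF ch_coord[OF gmod_regular assms, of b]] that by simp
  ultimately have "res (v b) = 0" for b by (cases "deg F p b = j") simp_all
  then show "(\<lambda>b. res (v b)) = 0" by (simp add: fun_eq_iff)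
qed

text \<open>
  Since \<open>F\<^sub>q \<otimes> K = F\<^sub>q/\<mm>F\<^sub>q\<close>, homology at \<open>F\<^sub>q \<otimes> K\<close> can be read off from a surjection \<open>D\<close> of \<open>F\<^sub>q\<close> onto
  \<open>C\<close> whose kernel is the image of \<open>F\<^bsub>q+1\<^esub>\<close>: a cycle, lifted to \<open>x \<in> F\<^sub>q\<close>, is a boundary if and only if
  \<open>D x \<in> D(\<mm>F\<^sub>q) = \<mm>C\<close>. The map \<open>D\<close> will be the augmentation, with every element a cycle, or the
  differential, with \<open>Z\<close> expressing that \<open>D x\<close> lies in \<open>\<mm>F\<^bsub>q-1\<^esub>\<close>.
\<close>
lemma residue_homology:
  assumes F: "exact_complex F" and D: "ghom (tens F \<RR> q) C D"
    and sur: "\<And>j. piece C j \<subseteq> D ` ch F \<RR> q j"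
    and ker: "\<And>j. {x \<in> ch F \<RR> q j. D x = 0} = td F \<RR> q ` ch F \<RR> (Suc q) j"
    and Z: "\<And>x. x \<in> ch F \<RR> q j \<Longrightarrow> cyc (\<lambda>b. res (x b)) \<longleftrightarrow> Z (D x)"
  shows "(\<forall>v\<in>ch F \<KK> q j. cyc v \<longrightarrow> v \<in> td F \<KK> q ` ch F \<KK> (Suc q) j) \<longleftrightarrow>
         (\<forall>y\<in>piece C j. Z y \<longrightarrow> y \<in> mpart C j)"
proof -
  note fF = exact_free[OF F]
  have T: "gmod (tens F \<RR> q)" by (rule gmod_tens[OF gmod_regular])
  have K: "gmod (tens F \<KK> q)" by (rule gmod_tens[OF gmod_residue])
  have resdiff: "(\<lambda>b. res ((x - y) b)) = (\<lambda>b. res (x b)) - (\<lambda>b. res (y b))" for x y :: "nat \<Rightarrow> 'r"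
    using res_add[of "x b - y b" "y b" for b] by (simp add: fun_eq_iff)
  show ?thesis
  proof
    assume H: "\<forall>v\<in>ch F \<KK> q j. cyc v \<longrightarrow> v \<in> td F \<KK> q ` ch F \<KK> (Suc q) j"
    show "\<forall>y\<in>piece C j. Z y \<longrightarrow> y \<in> mpart C j"
    proof (intro ballI impI)
      fix y assume y: "y \<in> piece C j" "Z y"
      then obtain x where x: "x \<in> ch F \<RR> q j" "y = D x" using sur by blast
      then have "(\<lambda>b. res (x b)) \<in> td F \<KK> q ` ch F \<KK> (Suc q) j"
        using H res_ch[OF x(1)] Z[OF x(1)] y by blast
      then obtain w where w: "w \<in> ch F \<KK> (Suc q) j" "(\<lambda>b. res (x b)) = td F \<KK> q w" by blast
      let ?w = "\<lambda>b. str R (w b)"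
      have w': "?w \<in> ch F \<RR> (Suc q) j" by (rule str_ch[OF w(1)])
      have dw: "td F \<RR> q ?w \<in> ch F \<RR> q j" by (rule td_in[OF gmod_regular fF w'])
      have "(\<lambda>b. res ((x - td F \<RR> q ?w) b)) = 0"
        unfolding resdiff using td_res[OF fF w'] w(2) by simp
      then have "x - td F \<RR> q ?w \<in> mpart (tens F \<RR> q) j"
        using res_eq_0_iff gm_diff[OF T x(1) dw] by blast
      then have "D (x - td F \<RR> q ?w) \<in> mpart C j" by (rule mpart_ghom[OF T D])
      moreover have "D (td F \<RR> q ?w) = 0" using ker[of j] w' by blast
      moreover have "D x = D ((x - td F \<RR> q ?w) + td F \<RR> q ?w)" by simp
      ultimately show "y \<in> mpart C j"
        using x(2) ghom_add[OF D gm_diff[OF T x(1) dw] dw] by simp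
    qed
  next
    assume H: "\<forall>y\<in>piece C j. Z y \<longrightarrow> y \<in> mpart C j"
    show "\<forall>v\<in>ch F \<KK> q j. cyc v \<longrightarrow> v \<in> td F \<KK> q ` ch F \<KK> (Suc q) j"
    proof (intro ballI impI)
      fix v assume v: "v \<in> ch F \<KK> q j" "cyc v"
      let ?x = "\<lambda>b. str R (v b)"
      have x: "?x \<in> ch F \<RR> q j" by (rule str_ch[OF v(1)])
      then have "Z (D ?x)" using Z[OF x] v by simp
      then have "D ?x \<in> mpart C j" using H ghom_piece[OF D x] by blast
      then obtain x' where x': "x' \<in> mpart (tens F \<RR> q) j" "D x' = D ?x"
        using mpart_lift[OF T D sur] by blast
      have x'c: "x' \<in> ch F \<RR> q j" by (rule mpart_piece[OF T x'(1)])
      have "D ?x = D ((?x - x') + x')" by simp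
      then have "D (?x - x') = 0" using ghom_add[OF D gm_diff[OF T x x'c] x'c] x'(2) by simp
      then obtain w where w: "w \<in> ch F \<RR> (Suc q) j" "?x - x' = td F \<RR> q w"
        using ker[of j] gm_diff[OF T x x'c] by blast
      have "v = (\<lambda>b. res (?x b))" by simp
      also have "\<dots> = (\<lambda>b. res ((?x - x') b))"
        using x'(1) unfolding resdiff res_eq_0_iff[OF x'c, symmetric] by simp
      also have "\<dots> = td F \<KK> q (\<lambda>b. res (w b))" unfolding w(2) using td_res[OF fF w(1)] by simp
      finally show "v \<in> td F \<KK> q ` ch F \<KK> (Suc q) j" using res_ch[OF w(1)] by blast
    qed
  qed
qed

end

section \<open>Computing Tor with a resolution of the residue field\<close>

text \<open>
  A minimal resolution \<open>G\<close> of the residue field is fixed. By minimality an entry of a differential is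
  zero when the degrees of its two basis elements agree.
\<close>
locale residue_resolution = std_graded R
  for R :: "('k::field, 'r::comm_ring_1) grad_alg" +
  fixes G :: "('r, 'k) free_cx"
  assumes G: "graded_free_resolution R (residue_mod R) G"
    and Gdeg: "b \<in> basis G n \<Longrightarrow> int n \<le> deg G n b"
    and Gmin: "b \<in> basis G (Suc n) \<Longrightarrow> deg G n b' = deg G (Suc n) b \<Longrightarrow> coef G n b b' = 0"
begin

lemma G_exact: "exact_complex G"
  and Gaug: "b \<in> basis G 0 \<Longrightarrow> augm G b \<in> piece \<KK> (deg G 0 b)"
  and Gsur: "lincomb \<KK> (augm G) ` ch G \<RR> 0 j = piece \<KK> j"
  and Gker: "{v \<in> ch G \<RR> 0 j. lincomb \<KK> (augm G) v = 0} = td G \<RR> 0 ` ch G \<RR> (Suc 0) j"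
  using G unfolding graded_free_resolution_iff by blast+

lemma G_free: "free_complex G" by (rule exact_free[OF G_exact])

lemma coef_degree_less:
  assumes "b \<in> basis G (Suc n)" "coef G n b b' \<noteq> 0" shows "deg G n b' < deg G (Suc n) b"
proof -
  have "\<not> deg G (Suc n) b - deg G n b' < 0"
    using coef_rp[OF G_free assms(1), of b'] rp_neg[of "deg G (Suc n) b - deg G n b'"] assms(2) by blast
  moreover have "deg G n b' \<noteq> deg G (Suc n) b" using Gmin[OF assms(1)] assms(2) by blast
  ultimately show ?thesis by linarith
qed

lemma boundary_mpart:
  assumes N: "gmod N" and v: "v \<in> ch G N (Suc n) j"
  shows "td G N n v b' \<in> mpart N (j - deg G n b')"
  unfolding tensor_diff_def
proof (rule mpart_sum)
  fix b assume "b \<in> {b. v b \<noteq> 0}"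
  then have b: "b \<in> basis G (Suc n)" using ch_supp[OF v] by simp
  show "smult N (coef G n b b') (v b) \<in> mpart N (j - deg G n b')"
  proof (cases "coef G n b b' = 0")
    case False
    then show ?thesis using coef_degree_less[OF b False] ch_coord[OF N v, of b]
      by (intro mpart_in[OF coef_rp[OF G_free b, of b']]) auto
  qed (simp add: N)
qed

lemma mpart_residue: "mpart \<KK> j = {0}"
proof -
  have "x = 0" if "x \<in> mpart \<KK> j" for x
    using that
  proof (induction rule: mpart_induct)
    case (step n r x y)
    then show ?case using res_pos[of r n] by simp
  qed simp
  then show ?thesis by auto
qed

text \<open>
  By minimality the differential of \<open>G \<otimes> K\<close> is zero, so every basis element of \<open>G\<close> contributes to Tor.
\<close>
lemma Tor_nonzero_residue:
  assumes b: "b \<in> basis G n" shows "Tor_nonzero R \<KK> \<KK> n (deg G n b)"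
proof -
  let ?v = "(single b 1) :: nat \<Rightarrow> 'k"
  have v: "?v \<in> ch G \<KK> n (deg G n b)" by (rule ch_single[OF gmod_residue b]) simp
  have td0: "td G \<KK> n w = 0" if "w \<in> ch G \<KK> (Suc n) j" for w n j
    using boundary_mpart[OF gmod_residue that] by (simp add: mpart_residue fun_eq_iff)
  have "?v \<in> tensor_cycles G \<KK> n (deg G n b)"
    using v td0[of _ "n - 1"] by (cases n) (auto simp: tensor_cycles_def ch_tensor_piece)
  moreover have "?v \<notin> tensor_boundaries G \<KK> n (deg G n b)"
  proof
    assume "?v \<in> tensor_boundaries G \<KK> n (deg G n b)"
    then have "?v = 0" using td0 by (auto simp: tensor_boundaries_def ch_tensor_piece)
    then have "?v b = 0 b" by (rule fun_cong)
    then show False by simp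
  qed
  ultimately show ?thesis using G unfolding Tor_nonzero_def by blast
qed

lemma mpart_regular_0: "mpart \<RR> 0 = {0}"
proof -
  have "x = 0" if "x \<in> mpart \<RR> 0" for x
    using that
  proof (induction rule: mpart_induct)
    case (step n r x y) then show ?case using rp_neg[of "- n"] by simp
  qed simp
  then show ?thesis by auto
qed

text \<open>
  A basis element of \<open>G\<^sub>0\<close> in another degree would be mapped to \<open>0\<close>, so it would be a boundary, while
  boundaries have coordinates in \<open>\<mm>\<close>.
\<close>
lemma Gdeg0: assumes b: "b \<in> basis G 0" shows "deg G 0 b = 0"
proof (rule ccontr)
  assume ne: "deg G 0 b \<noteq> 0"
  let ?v = "(single b 1) :: nat \<Rightarrow> 'r"
  have v: "?v \<in> ch G \<RR> 0 (deg G 0 b)" by (rule ch_single[OF gmod_regular b]) simp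
  have "augm G b = 0" using Gaug[OF b] ne by (simp split: if_splits)
  then have "lincomb \<KK> (augm G) ?v = 0" by (subst lincomb_sum[OF gmod_residue, of "{b}"]) auto
  then obtain w where w: "w \<in> ch G \<RR> (Suc 0) (deg G 0 b)" "?v = td G \<RR> 0 w" using Gker v by blast
  have "?v b \<in> mpart \<RR> 0"
    using boundary_mpart[OF gmod_regular w(1), of b] unfolding w(2)[symmetric] by simp
  then show False by (simp add: mpart_regular_0)
qed

lemma Gbasis0: "basis G 0 \<noteq> {}"
proof
  assume "basis G 0 = {}"
  then have "ch G \<RR> 0 0 \<subseteq> {0}" by (auto simp: tens_def piece_dsum fun_eq_iff)
  then have "lincomb \<KK> (augm G) ` ch G \<RR> 0 0 \<subseteq> {0}" by (auto simp: lincomb_def)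
  then show False unfolding Gsur using one_neq_zero[where 'a = 'k] by (metis UNIV_I piece_residue singletonD subsetD)
qed

text \<open>
  The image of \<open>G\<^sub>1\<close> in \<open>G\<^sub>0\<close> is \<open>\<mm>G\<^sub>0\<close>, the kernel of the augmentation.
\<close>
lemma boundaries0:
  assumes N: "gmod N"
  shows "td G N 0 ` ch G N (Suc 0) j = {v \<in> ch G N 0 j. \<forall>b. v b \<in> mpart N j}"
proof (intro equalityI subsetI)
  fix v assume "v \<in> td G N 0 ` ch G N (Suc 0) j"
  then obtain w where w: "w \<in> ch G N (Suc 0) j" "v = td G N 0 w" by blast
  have v: "v \<in> ch G N 0 j" unfolding w(2) by (rule td_in[OF N G_free w(1)])
  have "v b \<in> mpart N j" for b
  proof (cases "v b = 0")
    case False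
    then have "b \<in> basis G 0" using ch_supp[OF v] by blast
    then show ?thesis using boundary_mpart[OF N w(1), of b] Gdeg0 w(2) by simp
  qed simp
  then show "v \<in> {v \<in> ch G N 0 j. \<forall>b. v b \<in> mpart N j}" using v by blast
next
  fix v assume "v \<in> {v \<in> ch G N 0 j. \<forall>b. v b \<in> mpart N j}"
  then have v: "v \<in> ch G N 0 j" "\<And>b. v b \<in> mpart N j" by auto
  have T: "gmod (tens G N (Suc 0))" by (rule gmod_tens[OF N])
  let ?B = "td G N 0 ` ch G N (Suc 0) j"
  have B0: "0 \<in> ?B" using td_0 gm_0[OF T] by (metis image_eqI)
  have Badd: "x + y \<in> ?B" if x: "x \<in> ?B" and y: "y \<in> ?B" for x y
  proof -
    obtain v w where v: "x = td G N 0 v" "v \<in> ch G N (Suc 0) j"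
      and w: "y = td G N 0 w" "w \<in> ch G N (Suc 0) j" using x y by blast
    then have "x + y = td G N 0 (v + w)" using ghom_add[OF ghom_td[OF N G_free] v(2) w(2)] by simp
    then show ?thesis using gm_add[OF T v(2) w(2)] by blast
  qed
  have Bsum: "sum f S \<in> ?B" if "\<And>i. i \<in> S \<Longrightarrow> f i \<in> ?B" for f :: "nat \<Rightarrow> nat \<Rightarrow> 'a" and S
    using that by (induction S rule: infinite_finite_induct) (simp_all add: B0 Badd del: image_iff)
  have single: "single b y \<in> ?B" if b: "b \<in> basis G 0" and y: "y \<in> mpart N j" for b y
    using y
  proof (induction rule: mpart_induct)
    case zero
    have "single b 0 = (0 :: nat \<Rightarrow> 'a)" by auto
    then show ?case using B0 by simp
  next
    case (step n r x y)
    let ?r = "(single b r) :: nat \<Rightarrow> 'r"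
    have "?r \<in> ch G \<RR> 0 n" by (rule ch_single[OF gmod_regular b]) (simp add: Gdeg0[OF b] step)
    moreover have "lincomb \<KK> (augm G) ?r = 0"
      using res_pos[OF step(2)] step(1) by (subst lincomb_sum[OF gmod_residue, of "{b}"]) auto
    ultimately obtain w where w: "w \<in> ch G \<RR> (Suc 0) n" "?r = td G \<RR> 0 w" using Gker by blast
    have "(\<lambda>b. smult N (w b) x) \<in> ch G N (Suc 0) j" by (rule ch_outer[OF N w(1) step(3)]) simp
    moreover have "td G N 0 (\<lambda>b. smult N (w b) x) = single b (smult N r x)"
      unfolding td_outer[OF N w(1)] w(2)[symmetric] using N by auto
    ultimately have "single b (smult N r x) \<in> ?B" by (metis image_eqI)
    then have "single b (smult N r x) + single b y \<in> ?B"
      by (rule Badd[OF _ step(5)])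
    moreover have "single b (smult N r x) + single b y =
        single b (smult N r x + y)" by auto
    ultimately show ?case by simp
  qed
  have "(\<Sum>b | v b \<noteq> 0. single b (v b)) \<in> ?B"
    by (rule Bsum, rule single) (use ch_supp[OF v(1)] v(2) in auto)
  then show "v \<in> ?B" using ch_expand[OF N v(1)] by simp
qed

lemma single0:
  assumes "gmod N" "b \<in> basis G 0"
  shows "single b x \<in> ch G N 0 j \<longleftrightarrow> x \<in> piece N j"
proof
  assume "single b x \<in> ch G N 0 j"
  from ch_coord[OF assms(1) this, of b] show "x \<in> piece N j" by (simp add: Gdeg0[OF assms(2)])
next
  assume "x \<in> piece N j"
  then show "single b x \<in> ch G N 0 j"
    by (intro ch_single[OF assms]) (simp add: Gdeg0[OF assms(2)])
qed

lemma ch0_coord: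
  assumes "gmod N" "v \<in> ch G N 0 j" shows "v b \<in> piece N j"
proof (cases "v b = 0")
  case False
  then show ?thesis using ch_coord[OF assms, of b] ch_supp[OF assms(2)] Gdeg0 by simp
qed (simp add: assms(1))

lemma vanishes_0_iff:
  assumes N: "gmod N" shows "vanishes G N 0 j \<longleftrightarrow> piece N j \<subseteq> mpart N j"
proof
  assume vanishes: "vanishes G N 0 j"
  obtain b where b: "b \<in> basis G 0" using Gbasis0 by blast
  show "piece N j \<subseteq> mpart N j"
  proof
    fix x assume "x \<in> piece N j"
    then have "single b x \<in> ch G N 0 j" using single0[OF N b] by blast
    then have "single b x \<in> td G N 0 ` ch G N (Suc 0) j"
      using vanishes unfolding vanishes_0 One_nat_def by blast
    then have "(if b = b then x else 0) \<in> mpart N j" unfolding boundaries0[OF N] by blast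
    then show "x \<in> mpart N j" by simp
  qed
next
  assume "piece N j \<subseteq> mpart N j"
  then show "vanishes G N 0 j" unfolding vanishes_0 One_nat_def boundaries0[OF N]
    using ch0_coord[OF N] by blast
qed

text \<open>
  In homological degree \<open>0\<close> injectivity concerns the map \<open>A/\<mm>A \<rightarrow> B/\<mm>B\<close>.
\<close>
lemma boundary_injective_0_iff:
  assumes A: "gmod A" and B: "gmod B" and sub: "\<And>j. piece A j \<subseteq> piece B j"
  shows "boundary_injective G A B 0 j \<longleftrightarrow> (\<forall>x\<in>piece A j. x \<in> mpart B j \<longrightarrow> x \<in> mpart A j)"
proof
  assume inj: "boundary_injective G A B 0 j"
  obtain b where b: "b \<in> basis G 0" using Gbasis0 by blast
  show "\<forall>x\<in>piece A j. x \<in> mpart B j \<longrightarrow> x \<in> mpart A j"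
  proof (intro ballI impI)
    fix x assume x: "x \<in> piece A j" "x \<in> mpart B j"
    let ?v = "\<lambda>t. if t = b then x else 0"
    have "?v \<in> ch G A 0 j" "?v \<in> ch G B 0 j"
      using x single0[OF A b] single0[OF B b] sub by blast+
    moreover have "\<forall>t. ?v t \<in> mpart B j" using x by simp
    ultimately have "?v \<in> td G A 0 ` ch G A (Suc 0) j"
      using inj unfolding boundary_injective_def boundaries0[OF B] by blast
    then have "(if b = b then x else 0) \<in> mpart A j" unfolding boundaries0[OF A] by blast
    then show "x \<in> mpart A j" by simp
  qed
next
  assume *: "\<forall>x\<in>piece A j. x \<in> mpart B j \<longrightarrow> x \<in> mpart A j"
  then show "boundary_injective G A B 0 j"
    unfolding boundary_injective_def boundaries0[OF A] boundaries0[OF B] using ch0_coord[OF A] by blast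
qed

lemma vanishes_trivial:
  assumes N: "gmod N" and "\<And>b. b \<in> basis G a \<Longrightarrow> piece N (j - deg G a b) = {0}"
  shows "vanishes G N a j"
proof -
  have "v = 0" if v: "v \<in> ch G N a j" for v
  proof
    fix b
    show "v b = 0 b" using ch_coord[OF N v, of b] ch_supp[OF v, of b] assms(2)[of b] by fastforce
  qed
  moreover have "0 \<in> td G N p ` ch G N (Suc p) j" for p
    using td_0 gm_0[OF gmod_tens[OF N]] by (metis image_eqI)
  ultimately show ?thesis
    unfolding vanishes_def tensor_cycles_def tensor_boundaries_def ch_tensor_piece
    by (cases a) force+
qed

context
  fixes F :: "('r, 'm::ab_group_add) free_cx" and N :: "('r, 'm) grad_mod"
  assumes N: "gmod N" and F: "graded_free_resolution R N F"
begin

private lemma FE: "exact_complex F"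
  and Fsur: "lincomb N (augm F) ` ch F \<RR> 0 j = piece N j"
  and Fker: "{v \<in> ch F \<RR> 0 j. lincomb N (augm F) v = 0} = td F \<RR> 0 ` ch F \<RR> (Suc 0) j"
  using F unfolding graded_free_resolution_iff by blast+

private lemma FF: "free_complex F" by (rule exact_free[OF FE])

private lemma Fhom: "ghom (tens F \<RR> 0) N (lincomb N (augm F))"
  using F unfolding tens_def graded_free_resolution_iff by (intro ghom_lincomb[OF N]) blast

private lemma FT: "gmod (tens F \<RR> p)" by (rule gmod_tens[OF gmod_regular])

private definition syz where "syz p = img_mod (tens F \<RR> (Suc p)) (tens F \<RR> p) (td F \<RR> p)"

private lemma syz_hom: "ghom (tens F \<RR> (Suc p)) (syz p) (td F \<RR> p)"
  unfolding syz_def by (rule ghom_img_mod[OF ghom_td[OF gmod_regular FF]])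

private lemma syz_gmod: "gmod (syz p)"
  unfolding syz_def by (rule gmod_img_mod[OF FT FT ghom_td[OF gmod_regular FF]])

private lemma syz_0: "syz 0 = ker_mod (tens F \<RR> 0) (lincomb N (augm F))"
  unfolding syz_def img_mod_def ker_mod_def using Fker by auto

private lemma syz_Suc: "syz (Suc p) = ker_mod (tens F \<RR> (Suc p)) (td F \<RR> p)"
  unfolding syz_def img_mod_def ker_mod_def using FE unfolding exact_complex_def by auto

private lemma syz_piece: "piece (syz p) j \<subseteq> ch F \<RR> p j"
  unfolding syz_def using td_in[OF gmod_regular FF] by auto

private lemma vanishes_F_0: "vanishes F \<KK> 0 j \<longleftrightarrow> vanishes G N 0 j"
proof -
  have "(\<forall>v\<in>ch F \<KK> 0 j. True \<longrightarrow> v \<in> td F \<KK> 0 ` ch F \<KK> (Suc 0) j) \<longleftrightarrow>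
        (\<forall>y\<in>piece N j. True \<longrightarrow> y \<in> mpart N j)"
    by (rule residue_homology[OF FE Fhom _ Fker]) (auto simp: Fsur)
  moreover have "vanishes F \<KK> 0 j \<longleftrightarrow> (\<forall>v\<in>ch F \<KK> 0 j. v \<in> td F \<KK> 0 ` ch F \<KK> (Suc 0) j)"
    unfolding vanishes_0 One_nat_def by blast
  ultimately show ?thesis unfolding vanishes_0_iff[OF N] by blast
qed

private lemma vanishes_F_Suc: "vanishes F \<KK> (Suc p) j \<longleftrightarrow> boundary_injective G (syz p) (tens F \<RR> p) 0 j"
proof -
  have "(\<forall>v\<in>ch F \<KK> (Suc p) j. td F \<KK> p v = 0 \<longrightarrow> v \<in> td F \<KK> (Suc p) ` ch F \<KK> (Suc (Suc p)) j) \<longleftrightarrow>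
        (\<forall>y\<in>piece (syz p) j. y \<in> mpart (tens F \<RR> p) j \<longrightarrow> y \<in> mpart (syz p) j)"
  proof (rule residue_homology[OF FE syz_hom])
    show "piece (syz p) j \<subseteq> td F \<RR> p ` ch F \<RR> (Suc p) j" for j by (simp add: syz_def)
    show "{x \<in> ch F \<RR> (Suc p) j. td F \<RR> p x = 0} = td F \<RR> (Suc p) ` ch F \<RR> (Suc (Suc p)) j" for j
      using FE unfolding exact_complex_def by blast
    show "td F \<KK> p (\<lambda>b. res (x b)) = 0 \<longleftrightarrow> td F \<RR> p x \<in> mpart (tens F \<RR> p) j"
      if "x \<in> ch F \<RR> (Suc p) j" for x
      unfolding td_res[OF FF that] by (rule res_eq_0_iff[OF td_in[OF gmod_regular FF that]])
  qed
  then show ?thesis unfolding boundary_injective_0_iff[OF syz_gmod FT syz_piece] vanishes_Suc .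
qed

private lemma vanishes_syz: "vanishes G (syz k) (Suc m) j \<longleftrightarrow> vanishes F \<KK> (Suc (Suc (k + m))) j"
proof (induction m arbitrary: k)
  case 0
  have sur: "piece (syz k) i \<subseteq> td F \<RR> k ` ch F \<RR> (Suc k) i" for i by (simp add: syz_def)
  show ?case
    unfolding vanishes_F_Suc syz_Suc add_0_right
    using vanishes_imp_boundary_injective[OF G_exact FT syz_gmod syz_hom sur] boundary_injective_imp_vanishes[OF G_exact FT syz_gmod syz_hom sur]
      vanishes_tens[OF G_exact] by blast
next
  case (Suc m)
  have sur: "piece (syz k) i \<subseteq> td F \<RR> k ` ch F \<RR> (Suc k) i" for i by (simp add: syz_def)
  have "vanishes G (syz k) (Suc (Suc m)) j \<longleftrightarrow> vanishes G (syz (Suc k)) (Suc m) j"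
    unfolding syz_Suc
    using vanishes_ker_mod[OF G_exact FT syz_gmod syz_hom sur] vanishes_quot[OF G_exact FT syz_gmod syz_hom sur]
      vanishes_tens[OF G_exact] by blast
  then show ?case using Suc by simp
qed

text \<open>
  Both sides are shifted along the syzygies of \<open>N\<close> down to the injectivity of \<open>C/\<mm>C \<rightarrow> F\<^sub>p/\<mm>F\<^sub>p\<close> for a
  syzygy module \<open>C \<subseteq> F\<^sub>p\<close>: on the left by \<open>residue_homology\<close>, on the right by the long exact sequence
  and the vanishing of \<open>H\<^sub>p(G \<otimes> F\<^sub>q)\<close> for \<open>p > 0\<close>.
\<close>
theorem Tor_balanced: "vanishes F \<KK> p j \<longleftrightarrow> vanishes G N p j"
proof -
  have sur: "piece N i \<subseteq> lincomb N (augm F) ` ch F \<RR> 0 i" for i by (simp add: Fsur)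
  consider "p = 0" | "p = Suc 0" | m where "p = Suc (Suc m)"
    by (metis not0_implies_Suc)
  then show ?thesis
  proof cases
    case 1 then show ?thesis using vanishes_F_0 by simp
  next
    case 2
    show ?thesis unfolding 2 vanishes_F_Suc syz_0
      using vanishes_imp_boundary_injective[OF G_exact FT N Fhom sur] boundary_injective_imp_vanishes[OF G_exact FT N Fhom sur]
        vanishes_tens[OF G_exact] by blast
  next
    case (3 m)
    have "vanishes G N (Suc (Suc m)) j \<longleftrightarrow> vanishes G (syz 0) (Suc m) j"
      unfolding syz_0
      using vanishes_ker_mod[OF G_exact FT N Fhom sur] vanishes_quot[OF G_exact FT N Fhom sur]
        vanishes_tens[OF G_exact] by blast
    then show ?thesis using vanishes_syz[of 0 m j] by (simp add: 3)
  qed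
qed

end

lemma Tor_nonzero_imp: "gmod N \<Longrightarrow> Tor_nonzero R N \<KK> p j \<Longrightarrow> \<not> vanishes G N p j"
  using Tor_balanced unfolding Tor_nonzero_def vanishes_def[symmetric] by blast

lemma Tor_nonzero_iff:
  assumes "gmod N" "countably_spanned N" "\<And>j. j < k \<Longrightarrow> piece N j = {0}"
  shows "Tor_nonzero R N \<KK> p j \<longleftrightarrow> \<not> vanishes G N p j"
proof -
  obtain F where "graded_free_resolution R N F" using ex_minimal_resolution[OF assms] by blast
  then show ?thesis
    using Tor_nonzero_imp[OF assms(1)] Tor_balanced[OF assms(1)] unfolding Tor_nonzero_def vanishes_def[symmetric]
    by blast
qed

end

context std_graded begin

lemma countably_spanned_residue: "countably_spanned \<KK>"
proof -
  interpret V: vector_space "\<lambda>a. smult \<KK> (str R a)" by (rule gmod_vector_space[OF gmod_residue])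
  have "x \<in> V.span {1}" for x :: 'k
    using V.span_scale[OF V.span_base, of 1 "{1}" x] by simp
  then show ?thesis unfolding countably_spanned_def by (intro exI[of _ "{1}"]) auto
qed

lemma ex_residue_resolution: "\<exists>G. residue_resolution R G"
proof -
  obtain F where "graded_free_resolution R \<KK> F"
    "\<forall>n. \<forall>b\<in>basis F n. 0 + int n \<le> deg F n b"
    "\<forall>n. \<forall>b\<in>basis F (Suc n). \<forall>b'. deg F n b' = deg F (Suc n) b \<longrightarrow> coef F n b b' = 0"
    using ex_minimal_resolution[OF gmod_residue countably_spanned_residue, of 0] by auto
  then have "residue_resolution R F" by unfold_locales auto
  then show ?thesis by blast
qed

end

section \<open>Koszul complexes\<close>

locale koszul_setting = residue_resolution R G
  for R :: "('k::field, 'r::comm_ring_1) grad_alg" and G :: "('r, 'k) free_cx" +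
  fixes M :: "('r, 'm::ab_group_add) grad_mod" and c D :: nat and u :: "nat \<Rightarrow> 'r"
  assumes M: "gmod M" and u: "K_basis R c D u"
begin

text \<open>
  The sign in \<open>e\<^sub>s \<and> e\<^sub>T = \<plusminus> e\<^bsub>T \<union> {s}\<^esub>\<close>.
\<close>
definition sg :: "nat \<Rightarrow> nat set \<Rightarrow> 'r" where "sg s T = (-1) ^ card {r \<in> T. r < s}"

text \<open>
  Contraction with the dual basis vector of \<open>e\<^sub>s\<close> and left multiplication by \<open>e\<^sub>s\<close> on \<open>M \<otimes> \<And>R\<^sub>c\<close>. The
  Koszul differential is \<open>\<Sum>s. u\<^sub>s \<cdot> contract s\<close>, so its properties follow from the relations between
  these two families of operators.
\<close>
definition contract where
  "contract s x = (\<lambda>T. if s \<in> T then 0 else smult M (sg s T) (x (insert s T)))"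

definition wedge where
  "wedge s x = (\<lambda>T. if s \<in> T then smult M (sg s T) (x (T - {s})) else 0)"

abbreviation dK where "dK \<equiv> koszul_diff M D u"

lemma sg_sq: "sg s T * sg s T = 1"
  by (simp add: sg_def flip: power_add)

lemma sg_insert: "r \<noteq> s \<Longrightarrow> r \<notin> T \<Longrightarrow> sg s (insert r T) = (if r < s then - sg s T else sg s T)"
proof -
  assume "r \<noteq> s" "r \<notin> T"
  then have "r < s \<Longrightarrow> {q \<in> insert r T. q < s} = insert r {q \<in> T. q < s}"
    and "\<not> r < s \<Longrightarrow> {q \<in> insert r T. q < s} = {q \<in> T. q < s}" by auto
  moreover have "finite {q \<in> T. q < s}" by (rule finite_subset[of _ "{..<s}"]) auto
  ultimately show ?thesis using \<open>r \<notin> T\<close> by (simp add: sg_def)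
qed

lemma sg_self [simp]: "sg s (insert s T) = sg s T" "sg s (T - {s}) = sg s T"
proof -
  have "{q \<in> insert s T. q < s} = {q \<in> T. q < s}" "{q \<in> T - {s}. q < s} = {q \<in> T. q < s}" by auto
  then show "sg s (insert s T) = sg s T" "sg s (T - {s}) = sg s T" by (simp_all add: sg_def)
qed

lemma smult_minus_left: "smult M (- r) x = - smult M r x"
proof -
  interpret module "smult M" by (rule gmod_module[OF M])
  show ?thesis by simp
qed

lemmas M_simps = sm_add_right[OF M] sm_diff_right[OF M] sm_0_left[OF M] sm_0_right[OF M] sm_1[OF M]
  sm_mult[OF M] sm_minus_right[OF M] smult_minus_left sm_sum_right[OF M]

lemma contract_contract: "contract r (contract s x) = - contract s (contract r x)"
proof
  fix T
  show "contract r (contract s x) T = (- contract s (contract r x)) T"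
  proof (cases "r = s \<or> r \<in> T \<or> s \<in> T")
    case True
    then show ?thesis by (auto simp: contract_def M_simps)
  next
    case False
    then have "sg r T * sg s (insert r T) = - (sg s T * sg r (insert s T))"
      by (auto simp: sg_insert)
    then show ?thesis using False by (simp add: contract_def M_simps insert_commute)
  qed
qed

lemma contract_self: "contract s (contract s x) = 0"
  by (rule ext) (simp add: contract_def M_simps)

lemma contract_wedge_self: "contract s (wedge s x) + wedge s (contract s x) = x"
proof
  fix T
  show "(contract s (wedge s x) + wedge s (contract s x)) T = x T"
    by (cases "s \<in> T") (simp_all add: contract_def wedge_def M_simps sg_sq insert_absorb)
qed

lemma contract_wedge:
  assumes "r \<noteq> s" shows "contract r (wedge s x) + wedge s (contract r x) = 0"
proof
  fix T
  show "(contract r (wedge s x) + wedge s (contract r x)) T = 0 T"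
  proof (cases "r \<notin> T \<and> s \<in> T")
    case False
    then show ?thesis using assms by (auto simp: contract_def wedge_def M_simps)
  next
    case True
    define T' where "T' = T - {s}"
    have T: "T = insert s T'" "s \<notin> T'" "r \<notin> T'" using True by (auto simp: T'_def)
    have "insert r T - {s} = insert r T'" using T assms by auto
    moreover have "sg r T * sg s (insert r T) = - (sg s T * sg r T')"
      using T assms by (auto simp: sg_insert insert_commute[of r s])
    ultimately show ?thesis using True assms T(3)
      by (simp add: contract_def wedge_def M_simps flip: T'_def)
  qed
qed

lemma contract_add: "contract s (x + y) = contract s x + contract s y"
  and contract_smult: "contract s (\<lambda>T. smult M r (x T)) = (\<lambda>T. smult M r (contract s x T))"
  and contract_0: "contract s 0 = 0"
  by (auto simp: contract_def fun_eq_iff M_simps mult.commute)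

lemma wedge_add: "wedge s (x + y) = wedge s x + wedge s y"
  and wedge_smult: "wedge s (\<lambda>T. smult M r (x T)) = (\<lambda>T. smult M r (wedge s x T))"
  and wedge_0: "wedge s 0 = 0"
  by (auto simp: wedge_def fun_eq_iff M_simps mult.commute)

lemma contract_sum: "contract s (\<Sum>i\<in>A. f i) = (\<Sum>i\<in>A. contract s (f i))"
proof (induction A rule: infinite_finite_induct)
  case (insert i A)
  show ?case unfolding sum.insert[OF insert(1,2)] contract_add insert(3) ..
qed (simp_all only: sum.infinite sum.empty contract_0 not_False_eq_True)

lemma wedge_sum: "wedge s (\<Sum>i\<in>A. f i) = (\<Sum>i\<in>A. wedge s (f i))"
proof (induction A rule: infinite_finite_induct)
  case (insert i A)
  show ?case unfolding sum.insert[OF insert(1,2)] wedge_add insert(3) ..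
qed (simp_all only: sum.infinite sum.empty wedge_0 not_False_eq_True)

lemma dK_contract: "dK x = (\<Sum>s<D. (\<lambda>T. smult M (u s) (contract s x T)))"
proof
  fix T
  have "dK x T = (\<Sum>s\<in>{..<D} - T. smult M (u s) (contract s x T))"
    unfolding koszul_diff_def
    by (rule sum.cong[OF refl]) (simp add: contract_def sg_def M_simps mult.commute)
  also have "\<dots> = (\<Sum>s<D. smult M (u s) (contract s x T))"
    by (rule sum.mono_neutral_left) (auto simp: contract_def M_simps)
  finally show "dK x T = (\<Sum>s<D. (\<lambda>T. smult M (u s) (contract s x T))) T"
    by (simp add: sum_fun_apply)
qed

lemma dK_add: "dK (x + y) = dK x + dK y"
  by (simp add: dK_contract contract_add M_simps fun_eq_iff sum_fun_apply sum.distrib)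

lemma dK_0: "dK 0 = 0"
  by (simp add: dK_contract contract_0 M_simps fun_eq_iff sum_fun_apply)

lemma dK_diff: "dK (x - y) = dK x - dK y"
  using dK_add[of "x - y" y] by simp

lemma dK_smult: "dK (\<lambda>T. smult M r (x T)) = (\<lambda>T. smult M r (dK x T))"
  by (simp add: dK_contract contract_smult M_simps fun_eq_iff sum_fun_apply mult.commute)

lemma contract_dK: "contract r (dK x) = - dK (contract r x)"
proof -
  have "contract r (dK x) = (\<Sum>s<D. (\<lambda>T. smult M (u s) (contract r (contract s x) T)))"
    unfolding dK_contract contract_sum contract_smult ..
  also have "\<dots> = (\<Sum>s<D. - (\<lambda>T. smult M (u s) (contract s (contract r x) T)))"
    by (rule sum.cong[OF refl]) (simp add: contract_contract[of r] M_simps fun_eq_iff)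
  finally show ?thesis by (simp add: dK_contract sum_negf)
qed

text \<open>
  Multiplication by \<open>e\<^sub>s\<close> is a homotopy between multiplication by \<open>u\<^sub>s\<close> and zero; this is why \<open>\<mm>\<^sup>c\<close>
  annihilates Koszul homology.
\<close>
lemma dK_wedge:
  assumes s: "s < D"
  shows "dK (wedge s x) = (\<lambda>T. smult M (u s) (x T)) - wedge s (dK x)"
proof -
  have *: "contract r (wedge s x) = (if r = s then x else 0) - wedge s (contract r x)" for r
    using contract_wedge_self[of s x] contract_wedge[of r s x] by (auto simp: eq_diff_eq)
  have "dK (wedge s x) =
      (\<Sum>r<D. (\<lambda>T. smult M (u r) ((if r = s then x else 0) T)) - (\<lambda>T. smult M (u r) (wedge s (contract r x) T)))"
    unfolding dK_contract * by (rule sum.cong[OF refl]) (simp add: M_simps fun_eq_iff)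
  also have "\<dots> = (\<Sum>r<D. (\<lambda>T. smult M (u r) ((if r = s then x else 0) T))) - wedge s (dK x)"
    unfolding dK_contract wedge_sum wedge_smult by (rule sum_subtractf)
  also have "(\<Sum>r<D. (\<lambda>T. smult M (u r) ((if r = s then x else 0) T))) =
      (\<Sum>r<D. if r = s then (\<lambda>T. smult M (u s) (x T)) else 0)"
    by (rule sum.cong[OF refl]) (auto simp: M_simps fun_eq_iff)
  also have "\<dots> = (\<lambda>T. smult M (u s) (x T))" using s by simp
  finally show ?thesis .
qed

text \<open>
  The vanishing on the diagonal is a separate hypothesis because \<open>2\<close> may be zero.
\<close>
lemma sum_alternating:
  fixes f :: "nat \<Rightarrow> nat \<Rightarrow> 'x::ab_group_add"
  assumes "\<And>r s. f r s = - f s r" "\<And>r. f r r = 0"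
  shows "(\<Sum>r<n. \<Sum>s<n. f r s) = 0"
proof (induction n)
  case (Suc n)
  have "(\<Sum>r<n. f r n) = - (\<Sum>s<n. f n s)" by (subst assms(1)) (simp add: sum_negf)
  then show ?case using Suc by (simp add: sum.distrib assms(2))
qed simp

lemma dK_dK: "dK (dK x) = 0"
proof -
  let ?f = "\<lambda>r s. (\<lambda>T. smult M (u r * u s) (contract r (contract s x) T))"
  have "dK (dK x) = (\<Sum>r<D. \<Sum>s<D. ?f r s)"
    unfolding dK_contract[of "dK x"] unfolding dK_contract[of x] contract_sum contract_smult
    by (simp add: M_simps fun_eq_iff sum_fun_apply)
  also have "\<dots> = 0"
  proof (rule sum_alternating)
    show "?f r s = - ?f s r" for r s
      by (simp add: contract_contract[of r s] M_simps fun_eq_iff mult.commute)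
    show "?f r r = 0" for r by (simp add: contract_self M_simps fun_eq_iff)
  qed
  finally show ?thesis .
qed

definition Kz :: "nat \<Rightarrow> ('r, nat set \<Rightarrow> 'm) grad_mod" where
  "Kz t = dsum M {S. S \<subseteq> {..<D} \<and> card S = t} (\<lambda>_. int (t * c))"

lemma gmod_Kz: "gmod (Kz t)" unfolding Kz_def by (rule gmod_dsum[OF M])

lemma smult_Kz: "smult (Kz t) r x = (\<lambda>T. smult M r (x T))" by (simp add: Kz_def)

lemma Kz_iff:
  "x \<in> piece (Kz t) j \<longleftrightarrow>
    (\<forall>S. x S \<in> piece M (j - int (t * c))) \<and> (\<forall>S. \<not> (S \<subseteq> {..<D} \<and> card S = t) \<longrightarrow> x S = 0)"
proof
  assume *: "(\<forall>S. x S \<in> piece M (j - int (t * c))) \<and> (\<forall>S. \<not> (S \<subseteq> {..<D} \<and> card S = t) \<longrightarrow> x S = 0)"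
  then have sub: "{S. x S \<noteq> 0} \<subseteq> {S. S \<subseteq> {..<D} \<and> card S = t}" by blast
  moreover have "{S. S \<subseteq> {..<D} \<and> card S = t} \<subseteq> Pow {..<D}" by blast
  ultimately have "finite {S. x S \<noteq> 0}" by (meson finite_Pow_iff finite_lessThan finite_subset)
  then show "x \<in> piece (Kz t) j" using * sub by (simp add: Kz_def piece_dsum)
next
  assume *: "x \<in> piece (Kz t) j"
  then show "(\<forall>S. x S \<in> piece M (j - int (t * c))) \<and> (\<forall>S. \<not> (S \<subseteq> {..<D} \<and> card S = t) \<longrightarrow> x S = 0)"
    using dsum_coord[OF M *[unfolded Kz_def]] dsum_0[OF *[unfolded Kz_def]] by blast
qed

lemma koszul_piece_Kz: "koszul_piece M c D t j = piece (Kz t) j"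
proof (intro equalityI subsetI)
  fix x assume "x \<in> koszul_piece M c D t j"
  then have *: "\<And>S. S \<subseteq> {..<D} \<and> card S = t \<Longrightarrow> x S \<in> piece M (j - int (t * c))"
    "\<And>S. \<not> (S \<subseteq> {..<D} \<and> card S = t) \<Longrightarrow> x S = 0" by (simp_all only: koszul_piece_def mem_Collect_eq) blast+
  then have "x S \<in> piece M (j - int (t * c))" for S
    by (cases "S \<subseteq> {..<D} \<and> card S = t") (simp_all add: M)
  then show "x \<in> piece (Kz t) j" using * by (simp add: Kz_iff)
next
  fix x assume "x \<in> piece (Kz t) j"
  then show "x \<in> koszul_piece M c D t j" by (simp add: Kz_iff koszul_piece_def)
qed

lemma sg_rp [simp]: "sg s T \<in> rp 0"
proof -
  have "(-1) ^ n = str R ((-1) ^ n)" for n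
    by (induction n) (simp_all add: str_hom str_minus)
  then show ?thesis unfolding sg_def using str_rp by metis
qed

lemma u_gr: "s < D \<Longrightarrow> u s \<in> gr R c"
proof -
  interpret V: vector_space "\<lambda>a x. str R a * x" by (rule vector_space_R)
  assume "s < D"
  then have "u s \<in> V.span (u ` {..<D})" by (intro V.span_base) auto
  then show ?thesis using u by (simp add: K_basis_def)
qed

lemma gr_c_expand: "r \<in> gr R c \<Longrightarrow> \<exists>a. r = (\<Sum>s<D. str R (a s) * u s)"
proof -
  interpret V: vector_space "\<lambda>a x. str R a * x" by (rule vector_space_R)
  assume "r \<in> gr R c"
  then have "r \<in> V.span (u ` {..<D})" using u by (simp add: K_basis_def)
  then obtain a where "r = (\<Sum>x\<in>u ` {..<D}. str R (a x) * x)"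
    using V.span_finite[of "u ` {..<D}"] by auto
  also have "\<dots> = (\<Sum>s<D. str R (a (u s)) * u s)"
    using u by (subst sum.reindex) (auto simp: K_basis_def)
  finally show ?thesis by (intro exI[of _ "\<lambda>s. a (u s)"])
qed

lemma wedge_Kz:
  assumes x: "x \<in> piece (Kz t) j" and s: "s < D" shows "wedge s x \<in> piece (Kz (Suc t)) (j + int c)"
  unfolding Kz_iff
proof (intro conjI allI impI)
  fix S
  have "x (S - {s}) \<in> piece M (j - int (t * c))" using x by (simp add: Kz_iff)
  then show "wedge s x S \<in> piece M (j + int c - int (Suc t * c))"
    unfolding wedge_def using M by (auto intro!: gm_act[OF M, of _ 0])
  assume S: "\<not> (S \<subseteq> {..<D} \<and> card S = Suc t)"
  show "wedge s x S = 0"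
  proof (cases "s \<in> S")
    case True
    have "\<not> (S - {s} \<subseteq> {..<D} \<and> card (S - {s}) = t)"
    proof
      assume a: "S - {s} \<subseteq> {..<D} \<and> card (S - {s}) = t"
      then have "S \<subseteq> {..<D}" using s by auto
      moreover from this have "card S = Suc t" using a True card.remove[of S s] finite_subset by fastforce
      ultimately show False using S by simp
    qed
    then have "x (S - {s}) = 0" using x by (simp add: Kz_iff)
    then show ?thesis by (simp add: wedge_def M_simps)
  qed (simp add: wedge_def)
qed

lemma contract_Kz:
  assumes x: "x \<in> piece (Kz (Suc t)) j" shows "contract s x \<in> piece (Kz t) (j - int c)"
  unfolding Kz_iff
proof (intro conjI allI impI)
  fix S
  have "x (insert s S) \<in> piece M (j - int (Suc t * c))" using x by (simp add: Kz_iff)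
  then show "contract s x S \<in> piece M (j - int c - int (t * c))"
    unfolding contract_def using M by (auto intro!: gm_act[OF M, of _ 0])
  assume S: "\<not> (S \<subseteq> {..<D} \<and> card S = t)"
  show "contract s x S = 0"
  proof (cases "s \<in> S")
    case False
    have "\<not> (insert s S \<subseteq> {..<D} \<and> card (insert s S) = Suc t)"
      using S False finite_subset[of S "{..<D}"] by auto
    then have "x (insert s S) = 0" using x by (simp add: Kz_iff)
    then show ?thesis by (simp add: contract_def M_simps)
  qed (simp add: contract_def)
qed

lemma ghom_dK: "ghom (Kz (Suc t)) (Kz t) dK"
proof -
  have "dK x \<in> piece (Kz t) j" if x: "x \<in> piece (Kz (Suc t)) j" for x j
    unfolding dK_contract
  proof (rule gm_sum[OF gmod_Kz])
    fix s assume "s \<in> {..<D}"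
    then have "smult (Kz t) (u s) (contract s x) \<in> piece (Kz t) j"
      by (intro gm_act_nat[OF gmod_Kz u_gr contract_Kz[OF x]]) auto
    then show "(\<lambda>T. smult M (u s) (contract s x T)) \<in> piece (Kz t) j" by (simp add: smult_Kz)
  qed
  then show ?thesis by (auto simp: ghom_def dK_add dK_smult smult_Kz)
qed

lemma dK_Kz0: "x \<in> piece (Kz 0) j \<Longrightarrow> dK x = 0"
proof -
  assume x: "x \<in> piece (Kz 0) j"
  have "x (insert s T) = 0" for s T
  proof -
    have "\<not> (insert s T \<subseteq> {..<D} \<and> card (insert s T) = 0)"
      using finite_subset[of "insert s T" "{..<D}"] card_0_eq[of "insert s T"] by blast
    then show ?thesis using x unfolding Kz_iff by blast
  qed
  then show ?thesis unfolding koszul_diff_def by (simp add: M_simps fun_eq_iff)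
qed

definition Z where "Z i = ker_mod (Kz i) dK"
definition B where "B i = img_mod (Kz (Suc i)) (Kz i) dK"

lemma koszul_cycles_Z: "koszul_cycles M c D u i = Z i"
  unfolding koszul_cycles_def Z_def ker_mod_def koszul_piece_Kz by (simp add: fun_eq_iff smult_Kz)

lemma gmod_Z: "gmod (Z i)"
proof (cases i)
  case 0
  have "ghom (Kz 0) (Kz 0) dK" by (simp add: ghom_def dK_add dK_smult smult_Kz dK_Kz0 gmod_Kz)
  then show ?thesis unfolding Z_def 0 by (rule gmod_ker_mod[OF gmod_Kz gmod_Kz])
next
  case (Suc t)
  show ?thesis unfolding Z_def Suc by (rule gmod_ker_mod[OF gmod_Kz gmod_Kz ghom_dK])
qed

lemma gmod_B: "gmod (B i)"
  unfolding B_def by (rule gmod_img_mod[OF gmod_Kz gmod_Kz ghom_dK])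

lemma Z_iff: "x \<in> piece (Z i) j \<longleftrightarrow> x \<in> piece (Kz i) j \<and> dK x = 0"
  by (simp add: Z_def)

lemma B_iff: "x \<in> piece (B i) j \<longleftrightarrow> (\<exists>y\<in>piece (Kz (Suc i)) j. x = dK y)"
  by (auto simp: B_def)

lemma smult_Z: "smult (Z i) = smult (Kz i)" and smult_B: "smult (B i) = smult (Kz i)"
  by (simp_all add: Z_def B_def)

lemma B_subset_Z: "piece (B i) j \<subseteq> piece (Z i) j"
  using ghom_piece[OF ghom_dK] dK_dK by (auto simp: B_iff Z_iff)

lemma smult_u_boundary:
  assumes "z \<in> piece (Z i) e" "s < D"
  shows "smult (Z i) (u s) z = dK (wedge s z)" "wedge s z \<in> piece (Kz (Suc i)) (e + int c)"
  using assms by (simp_all add: dK_wedge Z_iff wedge_0 smult_Z smult_Kz wedge_Kz)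

section \<open>Generation in low degrees\<close>

text \<open>
  Without minimal generators in degrees \<open>e - n + 1, \<dots>, e\<close> one has \<open>N\<^sub>k = R\<^sub>1 N\<^bsub>k-1\<^esub>\<close> in all of them.
\<close>
lemma generated_gr:
  assumes N: "gmod N" and gen: "\<And>k. e - int n < k \<Longrightarrow> k \<le> e \<Longrightarrow> piece N k \<subseteq> mpart N k"
  shows "piece N e \<subseteq> fsums (\<lambda>_::unit. products N n (e - int n))"
  using gen
proof (induction n)
  case 0
  have "x \<in> fsums (\<lambda>_::unit. products N 0 (e - int 0))"
    if "x \<in> piece N e" for x
  proof (rule fsums_in)
    have "1 \<in> gr R 0" using one_rp rp_nat[of 0] by (metis of_nat_0)
    then show "x \<in> products N 0 (e - int 0)"
      using that sm_1[OF N, of x] by force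
  qed
  then show ?case by blast
next
  case (Suc n)
  let ?H = "fsums (\<lambda>_::unit. products N (Suc n) (e - int (Suc n)))"
  have "x \<in> ?H" if "x \<in> piece N e" for x
  proof -
    have "x \<in> fsums (\<lambda>_::unit. products N n (e - int n))"
      using Suc that by force
    then show ?thesis
    proof (rule fsums_subset)
      fix q assume "q \<in> products N n (e - int n)"
      then obtain r y where q: "q = smult N r y" "r \<in> gr R n" "y \<in> piece N (e - int n)" by blast
      have "y \<in> mpart N (e - int n)" using Suc.prems[of "e - int n"] q(3) by auto
      then have "y \<in> fsums (\<lambda>_::unit. products N 1 (e - int n - 1))"
        by (rule mpart_linear[OF N])
      then show "q \<in> ?H" unfolding q(1)
      proof (rule fsums_image)
        fix p assume "p \<in> products N 1 (e - int n - 1)"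
        then obtain s z where p: "p = smult N s z" "s \<in> gr R 1" "z \<in> piece N (e - int n - 1)" by blast
        have "r * s \<in> gr R (Suc n)" using gr_mult[OF q(2) p(2)] by simp
        moreover have "z \<in> piece N (e - int (Suc n))" using p(3) by (simp add: algebra_simps)
        ultimately show "smult N r p \<in> ?H"
          unfolding p(1) sm_mult[OF N] by (intro fsums_in) blast
      qed (simp_all add: sm_add_right[OF N] N)
    qed (auto intro: fsums_add fsums.zero)
  qed
  then show ?case by blast
qed

lemma generated_u:
  assumes N: "gmod N" and vanishes: "\<And>k. e - int c < k \<Longrightarrow> k \<le> e \<Longrightarrow> vanishes G N 0 k"
    and x: "x \<in> piece N e"
  shows "x \<in> fsums (\<lambda>s. {smult N (u s) z | z. s < D \<and> z \<in> piece N (e - int c)})"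
proof -
  have "x \<in> fsums (\<lambda>_::unit. products N c (e - int c))"
    using generated_gr[OF N] vanishes x unfolding vanishes_0_iff[OF N] by blast
  then show ?thesis
  proof (rule fsums_subset)
    fix q assume "q \<in> products N c (e - int c)"
    then obtain r y where q: "q = smult N r y" "r \<in> gr R c" "y \<in> piece N (e - int c)" by blast
    obtain a where a: "r = (\<Sum>s<D. str R (a s) * u s)" using gr_c_expand[OF q(2)] by blast
    have "q = (\<Sum>s<D. smult N (u s) (smult N (str R (a s)) y))"
      unfolding q(1) a by (simp add: sm_sum_left[OF N] sm_mult[OF N] mult.commute)
    also have "\<dots> \<in> fsums (\<lambda>s. {smult N (u s) z | z. s < D \<and> z \<in> piece N (e - int c)})"
    proof (rule fsums_sum)
      fix s assume "s \<in> {..<D}"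
      then have "smult N (u s) (smult N (str R (a s)) y) \<in>
          {smult N (u s) z | z. s < D \<and> z \<in> piece N (e - int c)}"
        using gm_str[OF N q(3)] by blast
      then show "smult N (u s) (smult N (str R (a s)) y) \<in>
          fsums (\<lambda>s. {smult N (u s) z | z. s < D \<and> z \<in> piece N (e - int c)})"
        by (rule fsums_in[of _ _ s])
    qed
    finally show "q \<in> fsums (\<lambda>s. {smult N (u s) z | z. s < D \<and> z \<in> piece N (e - int c)})" .
  qed (auto intro: fsums_add fsums.zero)
qed

text \<open>
  Here \<open>Z\<^sub>i\<close> is generated by \<open>R\<^sub>c\<close> from degree \<open>e - c\<close>, and \<open>R\<^sub>c Z\<^sub>i \<subseteq> B\<^sub>i\<close>.
\<close>
lemma Z_subset_B:
  assumes "\<And>k. e - int c < k \<Longrightarrow> k \<le> e \<Longrightarrow> vanishes G (Z i) 0 k"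
  shows "piece (Z i) e \<subseteq> piece (B i) e"
proof
  fix x assume x: "x \<in> piece (Z i) e"
  have "x \<in> fsums (\<lambda>s. {smult (Z i) (u s) z | z. s < D \<and> z \<in> piece (Z i) (e - int c)})"
    by (rule generated_u[OF gmod_Z assms x])
  then show "x \<in> piece (B i) e"
  proof (rule fsums_subset)
    fix s q assume "q \<in> {smult (Z i) (u s) z | z. s < D \<and> z \<in> piece (Z i) (e - int c)}"
    then obtain z where "q = smult (Z i) (u s) z" "s < D" "z \<in> piece (Z i) (e - int c)" by blast
    then show "q \<in> piece (B i) e" using smult_u_boundary[of z i "e - int c" s] by (auto simp: B_iff)
  qed (auto intro: gm_add gmod_B simp: gmod_B)
qed

section \<open>Tor of the Koszul cycles\<close>

lemma vanishes_Kz: "vanishes G M a (j - int (i * c)) \<Longrightarrow> vanishes G (Kz i) a j"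
  unfolding Kz_def by (rule vanishes_dsum[OF M G_free]) simp

text \<open>
  The second hypothesis says \<open>(G\<^bsub>a+2\<^esub> \<otimes> Z\<^sub>i/B\<^sub>i)\<^sub>j = 0\<close>. It replaces the vanishing of
  \<open>Tor\<^bsub>a+2\<^esub>(Z\<^sub>i/B\<^sub>i,K)\<^sub>j\<close> in the long exact sequence, so the quotient need not be formed.
\<close>
lemma vanishes_B:
  assumes Z: "vanishes G (Z i) (Suc a) j"
    and eq: "\<And>b. b \<in> basis G (Suc (Suc a)) \<Longrightarrow> piece (Z i) (j - deg G (Suc (Suc a)) b) \<subseteq> piece (B i) (j - deg G (Suc (Suc a)) b)"
  shows "vanishes G (B i) (Suc a) j"
  unfolding vanishes_Suc
proof (intro ballI impI)
  have td: "td G (B i) p = td G (Z i) p" for p by (rule td_cong) (simp add: smult_Z smult_B)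
  fix v assume v: "v \<in> ch G (B i) (Suc a) j" "td G (B i) a v = 0"
  have "v \<in> ch G (Z i) (Suc a) j" using v(1) B_subset_Z unfolding tens_def piece_dsum by blast
  then obtain w where w: "w \<in> ch G (Z i) (Suc (Suc a)) j" "v = td G (Z i) (Suc a) w"
    using Z v(2) unfolding vanishes_Suc td by blast
  have "w \<in> ch G (B i) (Suc (Suc a)) j" using w(1) eq unfolding tens_def piece_dsum by blast
  then show "v \<in> td G (B i) (Suc a) ` ch G (B i) (Suc (Suc a)) j" using w(2) td by auto
qed

lemma vanishes_Z_Suc: "vanishes G (Kz (Suc i)) a j \<Longrightarrow> vanishes G (B i) (Suc a) j \<Longrightarrow> vanishes G (Z (Suc i)) a j"
  unfolding Z_def
proof (rule vanishes_ker_mod[OF G_exact gmod_Kz gmod_B, where f = dK])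
  show "ghom (Kz (Suc i)) (B i) dK" unfolding B_def by (rule ghom_img_mod[OF ghom_dK])
  show "piece (B i) k \<subseteq> dK ` piece (Kz (Suc i)) k" for k by (auto simp: B_iff)
qed

text \<open>
  The three hypotheses on \<open>\<phi>\<close> correspond to the three sources of \<open>Tor\<^sub>a(Z\<^bsub>i+1\<^esub>,K)\<close>: the Koszul module
  \<open>K\<^bsub>i+1\<^esub>\<close>, the previous cycles one step further in the resolution, and the homology \<open>H\<^sub>i\<close>, which lives in
  degrees at most \<open>t\<^sub>0(Z\<^sub>i) + c - 1\<close>.
\<close>
lemma cycles_bound:
  fixes \<phi> :: "nat \<Rightarrow> nat \<Rightarrow> ereal"
  assumes \<phi>M: "\<And>a i j. \<not> vanishes G M a j \<Longrightarrow> ereal (real_of_int (j + int (i * c))) \<le> \<phi> a i"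
    and \<phi>Suc: "\<And>a i. \<phi> (Suc a) i \<le> \<phi> a (Suc i)"
    and \<phi>H: "\<And>a i b. b \<in> basis G (Suc (Suc a)) \<Longrightarrow>
      \<phi> 0 i + ereal (real_of_int (int c - 1 + deg G (Suc (Suc a)) b)) \<le> \<phi> a (Suc i)"
    and ne: "\<not> vanishes G (Z i) a j"
  shows "ereal (real_of_int j) \<le> \<phi> a i"
  using ne
proof (induction i arbitrary: a j)
  case 0
  have "Z 0 = Kz 0" unfolding Z_def ker_mod_def using dK_Kz0 by (auto simp: Kz_def dsum_def)
  then have "\<not> vanishes G M a (j - int (0 * c))" using 0 vanishes_Kz[of a j 0] by auto
  then show ?case using \<phi>M[of a j 0] by simp
next
  case (Suc i)
  show ?case
  proof (cases "vanishes G (Kz (Suc i)) a j")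
    case False
    then have "\<not> vanishes G M a (j - int (Suc i * c))" using vanishes_Kz by blast
    then show ?thesis using \<phi>M[of a "j - int (Suc i * c)" "Suc i"] by simp
  next
    case True
    then have nB: "\<not> vanishes G (B i) (Suc a) j" using vanishes_Z_Suc Suc.prems by blast
    show ?thesis
    proof (cases "vanishes G (Z i) (Suc a) j")
      case False
      then show ?thesis using Suc.IH \<phi>Suc order_trans by blast
    next
      case True
      then obtain b where b: "b \<in> basis G (Suc (Suc a))"
        "\<not> piece (Z i) (j - deg G (Suc (Suc a)) b) \<subseteq> piece (B i) (j - deg G (Suc (Suc a)) b)"
        using vanishes_B nB by blast
      then obtain k where k: "j - deg G (Suc (Suc a)) b - int c < k" "\<not> vanishes G (Z i) 0 k"
        using Z_subset_B by blast
      have "ereal (real_of_int j) \<le> ereal (real_of_int k) + ereal (real_of_int (int c - 1 + deg G (Suc (Suc a)) b))"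
        using k(1) by simp
      also have "\<dots> \<le> \<phi> 0 i + ereal (real_of_int (int c - 1 + deg G (Suc (Suc a)) b))"
        by (rule add_right_mono[OF Suc.IH[OF k(2)]])
      also have "\<dots> \<le> \<phi> a (Suc i)" by (rule \<phi>H[OF b(1)])
      finally show ?thesis .
    qed
  qed
qed

lemma cycles_beyond_top: "D < i \<Longrightarrow> vanishes G (Z i) a j"
proof -
  assume i: "D < i"
  have "piece (Z i) k = {0}" for k
  proof -
    have "x = 0" if "x \<in> piece (Z i) k" for x
    proof
      fix S
      have "\<not> (S \<subseteq> {..<D} \<and> card S = i)" using i card_mono[of "{..<D}" S] by auto
      then show "x S = 0 S" using that by (simp add: Z_iff Kz_iff)
    qed
    then show ?thesis using gmod_Z by auto
  qed
  then show ?thesis by (intro vanishes_trivial gmod_Z)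
qed

text \<open>
  As \<open>B\<^sub>D = 0\<close>, the module \<open>Z\<^sub>D\<close> itself is annihilated by \<open>\<mm>\<^sup>c\<close>, so it lives within \<open>c - 1\<close> degrees above
  one of its minimal generators.
\<close>
lemma top_cycles_bound:
  assumes "\<not> vanishes G (Z D) a j"
  shows "\<exists>b\<in>basis G a. \<exists>k. \<not> vanishes G (Z D) 0 k \<and> j < k + int c + deg G a b"
proof -
  obtain b where b: "b \<in> basis G a" "piece (Z D) (j - deg G a b) \<noteq> {0}"
    using vanishes_trivial[OF gmod_Z] assms by blast
  have "piece (B D) e = {0}" for e
  proof -
    have "y = 0" if "y \<in> piece (Kz (Suc D)) e" for y
    proof
      fix S
      have "\<not> (S \<subseteq> {..<D} \<and> card S = Suc D)" using card_mono[of "{..<D}" S] by auto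
      then show "y S = 0 S" using that by (simp add: Kz_iff)
    qed
    then have "piece (B D) e \<subseteq> {0}" using dK_0 unfolding B_iff subset_iff by (metis singletonI)
    then show ?thesis using gm_0[OF gmod_B] by blast
  qed
  then have "\<not> piece (Z D) (j - deg G a b) \<subseteq> piece (B D) (j - deg G a b)"
    using b(2) gm_0[OF gmod_Z] by blast
  then obtain k where "j - deg G a b - int c < k" "\<not> vanishes G (Z D) 0 k" using Z_subset_B by blast
  then show ?thesis using b(1) by (intro bexI[of _ b] exI[of _ k]) auto
qed

lemma mpart_Z_coord:
  assumes "z \<in> mpart (Z i) j" shows "z S \<in> mpart M (j - int (i * c))"
  using assms
proof (induction rule: mpart_induct)
  case (step n r x y)
  have "x S \<in> piece M (j - n - int (i * c))" using step(3) by (simp add: Z_iff Kz_iff)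
  then have "smult M r (x S) \<in> mpart M (j - int (i * c))"
    using step(1,2) by (intro mpart_in[of r n]) auto
  then show ?case using step(5) by (simp add: smult_Z smult_Kz mpart_add)
qed simp

lemma mpart_sg: "x \<in> mpart M k \<Longrightarrow> smult M (sg s T) x \<in> mpart M k"
  using mpart_smult[OF M _ sg_rp, of x k s T] by simp

text \<open>
  If \<open>Z\<^sub>i\<close> had no minimal generator in degrees \<open>\<ge> n = t + ic\<close>, then all its elements of degree \<open>n\<close> would
  have coefficients in \<open>\<mm>M\<close>. A cycle of degree \<open>n\<close> with a coefficient outside \<open>\<mm>M\<close> arises by contracting
  a cycle one step higher, which exists for \<open>i < D\<close>.
\<close>
lemma cycles_generator_above:
  assumes i: "i < D" and t: "\<not> vanishes G M 0 t"
  shows "\<exists>k \<ge> t + int (i * c). \<not> vanishes G (Z i) 0 k"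
proof (rule ccontr)
  define n where "n = t + int (i * c)"
  assume "\<not> ?thesis"
  then have vanishes: "\<And>k. n \<le> k \<Longrightarrow> vanishes G (Z i) 0 k" by (auto simp: n_def)
  have coord: "z S \<in> mpart M t" if "z \<in> piece (Z i) n" for z S
    using mpart_Z_coord[of z i n S] vanishes[of n] that unfolding vanishes_0_iff[OF gmod_Z] by (auto simp: n_def)
  have "m \<in> mpart M t" if m: "m \<in> piece M t" for m
  proof -
    define T where "T = {..<Suc i}"
    have T: "T \<subseteq> {..<D}" "card T = Suc i" using i by (auto simp: T_def)
    \<comment> \<open>The element \<open>m \<otimes> e\<^sub>T\<close>, whose boundary lies in \<open>R\<^sub>c Z\<^sub>i\<close>.\<close>
    define e where "e = single T m"
    have e: "e \<in> piece (Kz (Suc i)) (n + int c)"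
      using m T M by (auto simp: Kz_iff e_def n_def algebra_simps)
    have "dK e \<in> piece (Z i) (n + int c)" using ghom_piece[OF ghom_dK e] dK_dK by (simp add: Z_iff)
    then have "dK e \<in> fsums (\<lambda>s. {smult (Z i) (u s) z | z. s < D \<and> z \<in> piece (Z i) (n + int c - int c)})"
      using vanishes by (intro generated_u[OF gmod_Z]) auto
    \<comment> \<open>A second chain \<open>w = \<Sum>s. e\<^sub>s \<and> z\<^sub>s\<close> with the same boundary, and with coefficients in \<open>\<mm>M\<close>.\<close>
    then have "\<exists>w. w \<in> piece (Kz (Suc i)) (n + int c) \<and> dK w = dK e \<and> (\<forall>S. w S \<in> mpart M t)"
    proof induction
      case zero
      show ?case by (intro exI[of _ 0] conjI allI gm_0[OF gmod_Kz] dK_0) simp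
    next
      case (step q s y)
      then obtain w where w: "w \<in> piece (Kz (Suc i)) (n + int c)" "dK w = y" "\<And>S. w S \<in> mpart M t" by blast
      obtain z where z: "q = smult (Z i) (u s) z" "s < D" "z \<in> piece (Z i) n" using step(1) by auto
      have "wedge s z S \<in> mpart M t" for S unfolding wedge_def using coord[OF z(3)] mpart_sg by simp
      then have "(wedge s z + w) S \<in> mpart M t" for S
        using mpart_add[of "wedge s z S" M t "w S"] w(3) by simp
      moreover have "dK (wedge s z + w) = q + y"
        using w(2) z(1) smult_u_boundary(1)[OF z(3,2)] dK_add[of "wedge s z" w] by metis
      moreover have "wedge s z + w \<in> piece (Kz (Suc i)) (n + int c)"
        by (rule gm_add[OF gmod_Kz smult_u_boundary(2)[OF z(3,2)] w(1)])
      ultimately show ?case by blast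
    qed
    then obtain w where w: "w \<in> piece (Kz (Suc i)) (n + int c)" "dK w = dK e" "\<And>S. w S \<in> mpart M t" by blast
    have y: "e - w \<in> piece (Kz (Suc i)) (n + int c)" "dK (e - w) = 0"
      using gm_diff[OF gmod_Kz e w(1)] w(2) by (simp_all add: dK_diff)
    \<comment> \<open>Contraction anticommutes with the differential, so it preserves cycles.\<close>
    have "dK (contract i (e - w)) = 0"
      using contract_dK[of i "e - w"] y(2) by (simp add: contract_0)
    then have "contract i (e - w) \<in> piece (Z i) n"
      using contract_Kz[OF y(1), of i] by (simp add: Z_iff)
    then have "contract i (e - w) (T - {i}) \<in> mpart M t" by (rule coord)
    moreover have "insert i (T - {i}) = T" by (auto simp: T_def)
    ultimately have "smult M (sg i T) (m - w T) \<in> mpart M t" by (simp add: contract_def e_def)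
    then have "smult M (sg i T) (smult M (sg i T) (m - w T)) \<in> mpart M t" by (rule mpart_sg)
    then have "m - w T \<in> mpart M t" by (simp add: sm_mult[OF M] sg_sq sm_1[OF M])
    then have "(m - w T) + w T \<in> mpart M t" using w(3) by (rule mpart_add)
    then show ?thesis by simp
  qed
  then show False using t vanishes_0_iff[OF M] by blast
qed

end

context std_graded begin

section \<open>Finitely generated modules\<close>

text \<open>
  The component in degree \<open>j\<close> of the submodule generated by homogeneous elements \<open>y\<close> with recorded
  degrees \<open>d\<close>.
\<close>
abbreviation generated_by where
  "generated_by N Y j \<equiv> fsums (\<lambda>(d, y). {smult N r y | r n. (d, y) \<in> Y \<and> r \<in> gr R n \<and> int n + d = j})"

text \<open>
  The homogeneous components of the given generators generate the module, degree by degree.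
\<close>
lemma fin_gen_homogeneous:
  assumes gm: "graded_module R N" and fg: "fin_gen N"
  shows "\<exists>Y. finite Y \<and> (\<forall>(d, y)\<in>Y. y \<in> piece N d) \<and>
    (\<forall>j. piece N j \<subseteq> generated_by N Y j)"
proof -
  have N: "gmod N" by (rule graded_module_gmod[OF gm])
  have mN: "module (smult N)" by (rule gmod_module[OF N])
  have gr: "internal_grading (piece N) (mod_carrier N)" using gm unfolding graded_module_def by blast
  obtain X where X: "finite X" "module.span (smult N) X = mod_carrier N"
    using fg unfolding fin_gen_def by blast
  have "\<exists>f. finite {i. f i \<noteq> 0} \<and> (\<forall>i. f i \<in> piece N i) \<and> x = (\<Sum>i | f i \<noteq> 0. f i)"
    if "x \<in> X" for x
  proof -
    have "x \<in> mod_carrier N" using module.span_base[OF mN that] X(2) by simp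
    then show ?thesis
      by (intro fsums_decomposition[OF internal_grading_fsums[OF gr]]) (simp_all add: N gm_add)
  qed
  then obtain f where f: "\<And>x. x \<in> X \<Longrightarrow> finite {i. f x i \<noteq> 0}"
    "\<And>x i. x \<in> X \<Longrightarrow> f x i \<in> piece N i" "\<And>x. x \<in> X \<Longrightarrow> x = (\<Sum>i | f x i \<noteq> 0. f x i)"
    by metis
  define Y where "Y = (\<Union>x\<in>X. (\<lambda>i. (i, f x i)) ` {i. f x i \<noteq> 0})"
  define Q where "Q j = generated_by N Y j" for j
  have fY: "finite Y" using X f by (auto simp: Y_def)
  have Yp: "y \<in> piece N d" if "(d, y) \<in> Y" for d y using that f by (auto simp: Y_def)
  have QN: "Q j \<subseteq> piece N j" for j
  proof
    fix x assume "x \<in> Q j"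
    then show "x \<in> piece N j" unfolding Q_def
      by (rule fsums_subset) (auto simp: N gm_add intro!: gm_act_nat[OF N _ Yp])
  qed
  have mem: "smult N r y \<in> fsums Q" if Y: "(d, y) \<in> Y" for r d y
    using gr_fsums[of r]
  proof (rule fsums_image)
    fix n q assume "q \<in> gr R n"
    then have "smult N q y \<in> Q (int n + d)" unfolding Q_def using Y
      by (intro fsums_in[of _ _ "(d, y)"]) auto
    then show "smult N q y \<in> fsums Q" by (rule fsums_in)
  qed (simp_all add: N sm_add_left)
  have span: "x \<in> fsums Q" if "x \<in> module.span (smult N) X" for x
    using that
  proof (induction rule: module.span_induct_alt[OF mN, consumes 1])
    case 1 show ?case by (rule fsums.zero)
  next
    case (2 r x z)
    have "smult N r x = (\<Sum>i | f x i \<noteq> 0. smult N r (f x i))"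
      using f(3)[OF 2(1)] sm_sum_right[OF N] by metis
    also have "\<dots> \<in> fsums Q" using 2(1) by (intro fsums_sum mem) (auto simp: Y_def)
    finally show ?case using 2(2) by (rule fsums_add)
  qed
  have "piece N j \<subseteq> Q j" for j
  proof
    fix x assume x: "x \<in> piece N j"
    then have "x \<in> mod_carrier N" using gr unfolding internal_grading_def by blast
    then have "x \<in> fsums Q" using span X(2) by blast
    then show "x \<in> Q j" using x
      by (rule homogeneous_fsums[OF gr]) (use QN in \<open>auto simp: Q_def fsums.zero fsums_add\<close>)
  qed
  then show ?thesis using fY Yp unfolding Q_def by (intro exI[of _ Y]) blast
qed

text \<open>
  Take for \<open>k\<close> and \<open>l\<close> bounds for the degrees of finitely many homogeneous generators; above \<open>l\<close> every
  element has coefficients of positive degree.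
\<close>
lemma fin_gen_bounds:
  assumes gm: "graded_module R N" and fg: "fin_gen N"
  obtains k l where "\<And>j. j < k \<Longrightarrow> piece N j = {0}" "\<And>j. l < j \<Longrightarrow> piece N j \<subseteq> mpart N j"
    "countably_spanned N"
proof -
  have N: "gmod N" by (rule graded_module_gmod[OF gm])
  obtain Y where Y: "finite Y" "\<And>d y. (d, y) \<in> Y \<Longrightarrow> y \<in> piece N d"
    and gen: "\<And>j. piece N j \<subseteq> generated_by N Y j"
    using fin_gen_homogeneous[OF assms] by auto
  have fin: "finite (insert 0 (fst ` Y))" using Y(1) by simp
  define k where "k = Min (insert 0 (fst ` Y))"
  define l where "l = Max (insert 0 (fst ` Y))"
  have kl: "k \<le> d" "d \<le> l" if "(d, y) \<in> Y" for d y
    using that fin by (auto simp: k_def l_def intro!: Min_le Max_ge image_eqI[of _ fst "(d, y)"])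
  have "piece N j = {0}" if "j < k" for j
  proof -
    have "x = 0" if "x \<in> piece N j" for x
    proof -
      have "x \<in> generated_by N Y j"
        using gen that by blast
      then have "x \<in> {0}"
        by (rule fsums_subset) (use \<open>j < k\<close> kl in force)+
      then show ?thesis by simp
    qed
    then show ?thesis using N by auto
  qed
  moreover have "piece N j \<subseteq> mpart N j" if "l < j" for j
  proof
    fix x assume "x \<in> piece N j"
    then have "x \<in> generated_by N Y j"
      using gen by blast
    then show "x \<in> mpart N j"
    proof (rule fsums_subset)
      fix p q assume "q \<in> (case p of (d, y) \<Rightarrow> {smult N r y | r n. (d, y) \<in> Y \<and> r \<in> gr R n \<and> int n + d = j})"
      then obtain d y r n where *: "q = smult N r y" "(d, y) \<in> Y" "r \<in> gr R n" "int n + d = j"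
        by (cases p) auto
      then have "0 < int n" "r \<in> rp (int n)" using kl(2)[of d y] \<open>l < j\<close> rp_nat by auto
      then show "q \<in> mpart N j" unfolding *(1) using Y(2)[OF *(2)] *(4) by (intro mpart_in) auto
    qed (auto intro: mpart_add)
  qed
  moreover have "countably_spanned N"
  proof -
    interpret W: vector_space "\<lambda>a x. str R a * x" by (rule vector_space_R)
    interpret V: vector_space "\<lambda>a. smult N (str R a)" by (rule gmod_vector_space[OF N])
    obtain C where C: "countable C" "W.span C = UNIV" using countable_span_R by blast
    define E where "E = (\<Union>(d, y)\<in>Y. (\<lambda>c. smult N c y) ` C)"
    have "countable E" unfolding E_def
    proof (rule countable_UN)
      show "countable Y" using Y(1) by (rule countable_finite)
      show "countable (case p of (d, y) \<Rightarrow> (\<lambda>c. smult N c y) ` C)" for p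
        using C by (cases p) simp
    qed
    moreover have ry: "smult N r y \<in> V.span E" if "(d, y) \<in> Y" for r d y
    proof -
      have "r \<in> W.span C" using C by simp
      then show ?thesis
      proof (induction rule: W.span_induct_alt)
        case base show ?case using V.span_zero by (simp add: N)
      next
        case (step a c r)
        have "smult N c y \<in> E" using step(1) that by (auto simp: E_def)
        then have "smult N (str R a) (smult N c y) + smult N r y \<in> V.span E"
          by (intro V.span_add[OF V.span_scale[OF V.span_base] step(2)])
        then show ?case by (simp add: sm_add_left[OF N] sm_mult[OF N])
      qed
    qed
    moreover have "piece N j \<subseteq> V.span E" for j
    proof
      fix x assume "x \<in> piece N j"
      then have "x \<in> generated_by N Y j"
        using gen by blast
      then show "x \<in> V.span E"
        by (rule fsums_subset) (use ry in \<open>auto intro: V.span_add V.span_zero\<close>)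
    qed
    ultimately show ?thesis unfolding countably_spanned_def by blast
  qed
  ultimately show ?thesis by (rule that)
qed

end

context residue_resolution begin

section \<open>Degrees in the resolution of the residue field\<close>

lemma t_inv_le:
  assumes "gmod N" "\<And>j. \<not> vanishes G N a j \<Longrightarrow> ereal (real_of_int j) \<le> b"
  shows "t_inv R N a \<le> b"
  unfolding t_inv_def by (rule Sup_least) (use assms Tor_nonzero_imp in blast)

lemma t_inv_ge:
  assumes "gmod N" "countably_spanned N" "\<And>j. j < k \<Longrightarrow> piece N j = {0}" "\<not> vanishes G N a j"
  shows "ereal (real_of_int j) \<le> t_inv R N a"
  unfolding t_inv_def by (rule Sup_upper) (use assms Tor_nonzero_iff in blast)

lemma t_inv_minf: "gmod N \<Longrightarrow> (\<And>j. vanishes G N a j) \<Longrightarrow> t_inv R N a = - \<infinity>"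
  using t_inv_le[of N a "- \<infinity>"] by simp

lemma deg_le_t_inv: "b \<in> basis G a \<Longrightarrow> ereal (real_of_int (deg G a b)) \<le> t_inv R \<KK> a"
  unfolding t_inv_def by (rule Sup_upper) (use Tor_nonzero_residue in blast)

text \<open>
  The basis of \<open>G\<^sub>a\<close> lives in degrees \<open>\<ge> a\<close>.
\<close>
lemma t_inv_residue_ge:
  assumes "t_inv R \<KK> a \<noteq> - \<infinity>" shows "ereal (real a) \<le> t_inv R \<KK> a"
proof -
  obtain j where "\<not> vanishes G \<KK> a j" using assms t_inv_minf[OF gmod_residue] by blast
  then obtain b where b: "b \<in> basis G a" using vanishes_trivial[OF gmod_residue] by blast
  have "ereal (real a) \<le> ereal (real_of_int (deg G a b))" using Gdeg[OF b] by simp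
  also have "\<dots> \<le> t_inv R \<KK> a" by (rule deg_le_t_inv[OF b])
  finally show ?thesis .
qed

lemma Rate_upper:
  assumes "1 < i" "t_inv R \<KK> i \<noteq> - \<infinity>"
  shows "(t_inv R \<KK> i - 1) / ereal (real i - 1) \<le> Rate R"
proof -
  have "\<not> (\<forall>i>1. t_inv R \<KK> i = - \<infinity>)" using assms by blast
  then show ?thesis unfolding Rate_def using assms by (simp only: if_False) (rule Sup_upper, blast)
qed

lemma Rate_ge_1: "1 \<le> Rate R"
proof (cases "\<forall>i>1. t_inv R \<KK> i = - \<infinity>")
  case False
  then obtain i where i: "1 < i" "t_inv R \<KK> i \<noteq> - \<infinity>" by blast
  have "ereal (real i) - 1 \<le> t_inv R \<KK> i - 1" using t_inv_residue_ge[OF i(2)] by (rule ereal_minus_mono) simp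
  then have "(1::ereal) * ereal (real i - 1) \<le> t_inv R \<KK> i - 1" by (simp add: one_ereal_def)
  then have "1 \<le> (t_inv R \<KK> i - 1) / ereal (real i - 1)"
    using i(1) by (subst ereal_le_divide_pos) (auto simp: mult.commute)
  also have "\<dots> \<le> Rate R" by (rule Rate_upper[OF i])
  finally show ?thesis .
qed (simp add: Rate_def)

text \<open>
  The first syzygy of \<open>K\<close> is \<open>\<mm>\<close>, which is generated by \<open>R\<^sub>1\<close>. A basis element of degree \<open>n \<ge> 2\<close> would
  have a boundary in \<open>R\<^sub>1 \<cdot> R\<^bsub>n-1\<^esub> G\<^sub>0\<close>, so the element would be congruent to a cycle modulo \<open>\<mm>G\<^sub>1\<close>, contrary to
  minimality. This case is outside the range of the supremum that defines the rate.
\<close>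
lemma deg_basis_1:
  assumes b: "b \<in> basis G (Suc 0)" shows "deg G (Suc 0) b = 1"
proof (rule ccontr)
  define n where "n = deg G (Suc 0) b"
  assume "deg G (Suc 0) b \<noteq> 1"
  then have n: "2 \<le> n" using Gdeg[OF b] by (simp add: n_def)
  let ?e = "(single b 1) :: nat \<Rightarrow> 'r"
  let ?F = "tens G \<RR> (Suc 0)"
  have F: "gmod ?F" by (rule gmod_tens[OF gmod_regular])
  have d: "ghom ?F (tens G \<RR> 0) (td G \<RR> 0)" by (rule ghom_td[OF gmod_regular G_free])
  have e: "?e \<in> piece ?F n" by (rule ch_single[OF gmod_regular b]) (simp add: n_def)
  \<comment> \<open>The boundaries of elements of \<open>\<mm>G\<^sub>1\<close>; the aim is that they contain all of \<open>R\<^sub>n G\<^sub>0\<close>.\<close>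
  define I where "I = td G \<RR> 0 ` mpart ?F n"
  have I0: "0 \<in> I" unfolding I_def using td_0 mpart_0 by (metis image_eqI)
  have Iadd: "x + y \<in> I" if x: "x \<in> I" and y: "y \<in> I" for x y
  proof -
    obtain v w where v: "x = td G \<RR> 0 v" "v \<in> mpart ?F n" and w: "y = td G \<RR> 0 w" "w \<in> mpart ?F n"
      using x y unfolding I_def by blast
    then have "x + y = td G \<RR> 0 (v + w)"
      using ghom_add[OF d mpart_piece[OF F v(2)] mpart_piece[OF F w(2)]] by simp
    then show ?thesis unfolding I_def using mpart_add[OF v(2) w(2)] by blast
  qed
  have single: "single b' r \<in> I" if b': "b' \<in> basis G 0" and r: "r \<in> rp n" for b' r
  proof -
    have "r \<in> gr R (Suc (nat (n - 1)))" using r n rp_nat[of "Suc (nat (n - 1))"] by simp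
    then have "r \<in> fsums (\<lambda>_::unit. gr_products (nat (n - 1)))"
      using gr_Suc by blast
    then have "r \<in> {r. single b' r \<in> I}"
    proof (rule fsums_subset)
      have "single b' 0 = (0 :: nat \<Rightarrow> 'r)" by auto
      then show "0 \<in> {r. single b' r \<in> I}" using I0 by simp
    next
      fix x y assume "x \<in> {r. single b' r \<in> I}" "y \<in> {r. single b' r \<in> I}"
      then have "single b' x + single b' y \<in> I" by (auto intro: Iadd)
      moreover have "single b' x + single b' y =
        single b' (x + y)" by auto
      ultimately show "x + y \<in> {r. single b' r \<in> I}" by simp
    next
      fix q assume "q \<in> gr_products (nat (n - 1))"
      then obtain p s where q: "q = p * s" "p \<in> gr R 1" "s \<in> gr R (nat (n - 1))" by blast
      have p: "p \<in> rp 1" and s: "s \<in> rp (n - 1)"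
        using q rp_nat[of 1] rp_nat[of "nat (n - 1)"] n by simp_all
      let ?s = "\<lambda>t. if t = b' then s else 0"
      have "smult \<RR> s 1 \<in> mpart \<RR> (n - 1)" using s n by (intro mpart_in[of s "n - 1" 1 \<RR> 0]) auto
      moreover have "?s \<in> ch G \<RR> 0 (n - 1)"
        using single0[OF gmod_regular b'] s by blast
      ultimately have "?s \<in> td G \<RR> 0 ` ch G \<RR> (Suc 0) (n - 1)"
        unfolding boundaries0[OF gmod_regular] by simp
      then obtain w where w: "w \<in> piece ?F (n - 1)" "?s = td G \<RR> 0 w" by blast
      have "smult ?F p w \<in> mpart ?F n" using p w by (intro mpart_in[of p 1 w ?F "n - 1"]) auto
      moreover have "td G \<RR> 0 (smult ?F p w) = single b' q"
        unfolding ghom_smult[OF d p w(1)] w(2)[symmetric] q(1) by auto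
      ultimately show "q \<in> {r. single b' r \<in> I}" unfolding I_def by force
    qed
    then show ?thesis by simp
  qed
  define x where "x = td G \<RR> 0 ?e"
  have x: "x \<in> ch G \<RR> 0 n" unfolding x_def by (rule td_in[OF gmod_regular G_free e])
  have sumI: "(\<Sum>b\<in>S. single b (x b)) \<in> I" if "S \<subseteq> basis G 0" for S
    using that
  proof (induction S rule: infinite_finite_induct)
    case (insert b S)
    have "single b (x b) \<in> I"
      using insert ch0_coord[OF gmod_regular x] by (intro single) auto
    then show ?case unfolding sum.insert[OF insert(1,2)] using insert by (intro Iadd) auto
  qed (use I0 in \<open>simp_all only: sum.infinite sum.empty not_False_eq_True\<close>)
  have "(\<Sum>b | x b \<noteq> 0. single b (x b)) \<in> I"
    by (rule sumI) (use ch_supp[OF x] in blast)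
  then have "x \<in> I" using ch_expand[OF gmod_regular x] by simp
  then obtain y where y: "y \<in> mpart ?F n" "x = td G \<RR> 0 y" unfolding I_def by blast
  have yF: "y \<in> piece ?F n" by (rule mpart_piece[OF F y(1)])
  have "td G \<RR> 0 (?e - y) = 0" using ghom_diff[OF F d e yF] y(2) by (simp add: x_def)
  then obtain w where w: "w \<in> ch G \<RR> (Suc (Suc 0)) n" "?e - y = td G \<RR> (Suc 0) w"
    using G_exact gm_diff[OF F e yF] unfolding exact_complex_def by blast
  have "(?e - y) b \<in> mpart \<RR> 0"
    using boundary_mpart[OF gmod_regular w(1), of b] unfolding w(2)[symmetric] n_def by simp
  moreover have "y b = 0" using y(1) unfolding tens_def mpart_free by (simp add: n_def)
  ultimately have "1 \<in> mpart \<RR> 0" by simp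
  then show False by (simp add: mpart_regular_0)
qed

lemma deg_le_Rate:
  assumes b: "b \<in> basis G (Suc a)"
  shows "ereal (real_of_int (deg G (Suc a) b)) \<le> 1 + ereal (real a) * Rate R"
proof (cases a)
  case 0
  then show ?thesis using deg_basis_1[of b] b by (simp add: one_ereal_def zero_ereal_def[symmetric])
next
  case (Suc a')
  let ?t = "t_inv R \<KK> (Suc a)" and ?d = "ereal (real_of_int (deg G (Suc a) b))"
  have dt: "?d \<le> ?t" by (rule deg_le_t_inv[OF b])
  then have ne: "?t \<noteq> - \<infinity>" by auto
  have "(?t - 1) / ereal (real (Suc a) - 1) \<le> Rate R"
    by (rule Rate_upper[OF _ ne]) (simp add: Suc)
  then have "?t - 1 \<le> ereal (real a) * Rate R"
    using Suc by (simp add: ereal_divide_le_pos)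
  then have "?d - 1 \<le> ereal (real a) * Rate R"
    using dt by (meson ereal_minus_mono order_refl order_trans)
  then show ?thesis by (simp add: ereal_minus_le add.commute)
qed

lemma Nakayama:
  assumes N: "gmod N" and low: "\<And>j. j < k \<Longrightarrow> piece N j = {0}" and vanishes: "\<And>j. vanishes G N 0 j"
  shows "piece N j = {0}"
proof (induction "nat (j - k + 1)" arbitrary: j rule: less_induct)
  case less
  show ?case
  proof (cases "j < k")
    case False
    have "x = 0" if "x \<in> mpart N j" for x
      using that
    proof (induction rule: mpart_induct)
      case (step n r x y)
      have "piece N (j - n) = {0}" by (rule less) (use step(1) False in auto)
      then show ?case using step N by simp
    qed simp
    then show ?thesis using vanishes vanishes_0_iff[OF N, of j] N by auto
  qed (rule low)
qed

end

section \<open>Slope and regularity of the Koszul cycles\<close>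

context koszul_setting
begin

lemma cycles_vanish: "(\<And>a j. vanishes G M a j) \<Longrightarrow> vanishes G (Z i) a j"
  using cycles_bound[of "\<lambda>_ _. - \<infinity>" i a j] by auto

context
  fixes k l :: int
  assumes low: "\<And>j. j < k \<Longrightarrow> piece M j = {0}"
    and up: "\<And>j. l < j \<Longrightarrow> piece M j \<subseteq> mpart M j"
    and cs: "countably_spanned M"
begin

lemma M_ge: "\<not> vanishes G M a j \<Longrightarrow> ereal (real_of_int j) \<le> t_inv R M a"
  by (rule t_inv_ge[OF M cs low])

lemma Z_ge:
  assumes "\<not> vanishes G (Z i) a j" shows "ereal (real_of_int j) \<le> t_inv R (Z i) a"
proof (rule t_inv_ge[OF gmod_Z _ _ assms])
  have "finite {S. S \<subseteq> {..<D} \<and> card S = i}" by (rule finite_subset[of _ "Pow {..<D}"]) auto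
  then show "countably_spanned (Z i)" unfolding Z_def Kz_def
    by (intro countably_spanned_ker_mod countably_spanned_dsum M cs countable_finite)
  show "piece (Z i) j = {0}" if "j < k + int (i * c)" for j
  proof -
    have "x = 0" if "x \<in> piece (Z i) j" for x
    proof
      fix S
      have "x S \<in> piece M (j - int (i * c))" using that by (simp add: Z_iff Kz_iff)
      then show "x S = 0 S" using low[of "j - int (i * c)"] \<open>j < k + int (i * c)\<close> by simp
    qed
    then show ?thesis using gmod_Z by auto
  qed
qed

text \<open>
  The degrees of minimal generators of \<open>M\<close> form a finite set, so \<open>t\<^sub>0(M)\<close> is attained unless the set is
  empty, and then \<open>M = 0\<close> by the lemma of Nakayama.
\<close>
lemma M_zero_or_max:
  "(\<forall>a j. vanishes G M a j) \<or> (\<exists>t. \<not> vanishes G M 0 t \<and> t_inv R M 0 = ereal (real_of_int t))"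
proof (cases "\<exists>j. \<not> vanishes G M 0 j")
  case False
  then have "piece M j = {0}" for j using Nakayama[OF M low] by blast
  then show ?thesis using vanishes_trivial[OF M] by blast
next
  case True
  define T where "T = {j. \<not> vanishes G M 0 j}"
  have "T \<subseteq> {k..l}"
  proof
    fix j assume "j \<in> T"
    then have nv: "\<not> piece M j \<subseteq> mpart M j" using vanishes_0_iff[OF M] by (simp add: T_def)
    have "\<not> j < k" using nv low[of j] by auto
    moreover have "\<not> l < j" using nv up by blast
    ultimately show "j \<in> {k..l}" by simp
  qed
  then have fin: "finite T" using finite_subset by blast
  have ne: "T \<noteq> {}" using True by (simp add: T_def)
  have nv: "\<not> vanishes G M 0 (Max T)" using Max_in[OF fin ne] by (simp add: T_def)
  have "t_inv R M 0 \<le> ereal (real_of_int (Max T))"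
    by (rule t_inv_le[OF M]) (use Max_ge[OF fin] in \<open>auto simp: T_def\<close>)
  then have "t_inv R M 0 = ereal (real_of_int (Max T))" using M_ge[OF nv] by (rule antisym)
  then show ?thesis using nv by blast
qed

lemma M_slope:
  assumes "\<not> vanishes G M a j" "t_inv R M 0 = ereal \<tau>"
  shows "ereal (real_of_int j) \<le> ereal \<tau> + ereal (real a) * slope R M"
proof (cases "a = 0")
  case True
  then show ?thesis using M_ge[OF assms(1)] assms(2) by (simp add: zero_ereal_def[symmetric])
next
  case False
  have jt: "ereal (real_of_int j) \<le> t_inv R M a" by (rule M_ge[OF assms(1)])
  then have ne: "t_inv R M a \<noteq> - \<infinity>" by auto
  have "(t_inv R M a - t_inv R M 0) / ereal (real a) \<le> slope R M"
    unfolding slope_def by (rule Sup_upper) (use False ne in blast)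
  then have "t_inv R M a - ereal \<tau> \<le> ereal (real a) * slope R M"
    using False assms(2) by (simp add: ereal_divide_le_pos)
  then have "ereal (real_of_int j) - ereal \<tau> \<le> ereal (real a) * slope R M"
    using jt by (meson ereal_minus_mono order_refl order_trans)
  then show ?thesis by (cases "ereal (real a) * slope R M") simp_all
qed

text \<open>
  The bound is a function \<open>\<phi>\<close> as in \<open>cycles_bound\<close>. Compatibility with the step from \<open>a + 1\<close> to \<open>i + 1\<close>
  uses \<open>slope(M) \<le> c\<close>, and that with \<open>H\<^sub>i\<close> uses \<open>t\<^bsub>a+2\<^esub>(K) \<le> 1 + (a + 1) Rate(R)\<close>.
\<close>
lemma t_inv_cycles_le:
  assumes sc: "slope R M \<le> ereal (real c)"
  shows "t_inv R (Z i) a \<le> t_inv R M 0 + ereal (real (i * c)) +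
      max (ereal (real a) * slope R M) (ereal (real (a + i)) * Rate R)"
  using M_zero_or_max
proof
  assume "\<forall>a j. vanishes G M a j"
  then have "t_inv R (Z i) a = - \<infinity>" by (intro t_inv_minf gmod_Z cycles_vanish) blast
  then show ?thesis by simp
next
  assume "\<exists>t. \<not> vanishes G M 0 t \<and> t_inv R M 0 = ereal (real_of_int t)"
  then obtain t where t: "t_inv R M 0 = ereal (real_of_int t)" by blast
  define \<phi> where "\<phi> a i = t_inv R M 0 + ereal (real (i * c)) +
      max (ereal (real a) * slope R M) (ereal (real (a + i)) * Rate R)" for a i
  have \<phi>M: "ereal (real_of_int (j + int (i * c))) \<le> \<phi> a i" if "\<not> vanishes G M a j" for a i j
  proof -
    have "ereal (real_of_int (j + int (i * c))) = ereal (real_of_int j) + ereal (real (i * c))" by simp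
    also have "\<dots> \<le> (ereal (real_of_int t) + ereal (real a) * slope R M) + ereal (real (i * c))"
      by (rule add_right_mono[OF M_slope[OF that t]])
    also have "\<dots> = t_inv R M 0 + ereal (real (i * c)) + ereal (real a) * slope R M"
      by (simp only: t ac_simps)
    also have "\<dots> \<le> \<phi> a i" unfolding \<phi>_def by (intro add_left_mono) simp
    finally show ?thesis .
  qed
  have slope_cases: "slope R M = - \<infinity> \<or> (\<exists>s. slope R M = ereal s \<and> s \<le> real c)"
    using sc by (cases "slope R M") auto
  have R1: "1 \<le> Rate R" by (rule Rate_ge_1)
  have \<phi>Suc: "\<phi> (Suc a) i \<le> \<phi> a (Suc i)" for a i
  proof (cases "Rate R")
    case (real \<rho>)
    then have \<rho>: "1 \<le> \<rho>" using R1 by simp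
    from slope_cases show ?thesis
    proof
      assume "slope R M = - \<infinity>"
      then show ?thesis using real \<rho> by (cases "a = 0") (simp_all add: \<phi>_def t algebra_simps zero_ereal_def[symmetric])
    next
      assume "\<exists>s. slope R M = ereal s \<and> s \<le> real c"
      then obtain s where "slope R M = ereal s" "s \<le> real c" by blast
      then show ?thesis using real \<rho> by (simp add: \<phi>_def t algebra_simps max_def)
    qed
  qed (use R1 in \<open>simp_all add: \<phi>_def t\<close>)
  have \<phi>H: "\<phi> 0 i + ereal (real_of_int (int c - 1 + deg G (Suc (Suc a)) b)) \<le> \<phi> a (Suc i)"
    if b: "b \<in> basis G (Suc (Suc a))" for a i b
  proof (cases "Rate R")
    case (real \<rho>)
    then have \<rho>: "1 \<le> \<rho>" using R1 by simp
    have d: "real_of_int (deg G (Suc (Suc a)) b) \<le> 1 + real (Suc a) * \<rho>"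
      using deg_le_Rate[OF b] by (simp add: real one_ereal_def)
    \<comment> \<open>At \<open>a = 0\<close> the product is \<open>0\<close> even if the slope is \<open>-\<infinity>\<close>.\<close>
    have "0 * slope R M = 0" by simp
    then have "\<phi> 0 i = ereal (real_of_int t + real (i * c) + real i * \<rho>)"
      using \<rho> by (simp add: \<phi>_def t real zero_ereal_def[symmetric] max_def)
    then have "\<phi> 0 i + ereal (real_of_int (int c - 1 + deg G (Suc (Suc a)) b)) \<le>
        ereal (real_of_int t + real (Suc i * c) + real (a + Suc i) * \<rho>)"
      using d by (simp add: algebra_simps)
    also have "\<dots> = t_inv R M 0 + ereal (real (Suc i * c)) + ereal (real (a + Suc i)) * Rate R"
      by (simp add: t real)
    also have "\<dots> \<le> \<phi> a (Suc i)" unfolding \<phi>_def by (intro add_left_mono) simp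
    finally show ?thesis .
  qed (use R1 in \<open>simp_all add: \<phi>_def t\<close>)
  have "t_inv R (Z i) a \<le> \<phi> a i"
    by (rule t_inv_le[OF gmod_Z cycles_bound]) (use \<phi>M \<phi>Suc \<phi>H in auto)
  then show ?thesis by (simp only: \<phi>_def)
qed

text \<open>
  Let \<open>\<beta>\<close> be the claimed bound and \<open>a > 0\<close>. If \<open>t\<^sub>0(Z\<^sub>i) \<ge> t\<^sub>0(M) + ic\<close>, subtract this from the bound for
  \<open>t\<^sub>a(Z\<^sub>i)\<close> and use \<open>a + i \<le> a(1 + i)\<close>. Otherwise \<open>i = D\<close> and \<open>c \<le> \<beta>\<close>, and
  \<open>t\<^sub>a(Z\<^sub>D) \<le> t\<^sub>0(Z\<^sub>D) + c - 1 + t\<^sub>a(K) \<le> t\<^sub>0(Z\<^sub>D) + c + (a - 1) Rate(R) \<le> t\<^sub>0(Z\<^sub>D) + a\<beta>\<close>.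
\<close>
lemma slope_cycles_le:
  assumes sc: "slope R M \<le> ereal (real c)"
    and top: "i = D \<Longrightarrow> t_inv R (Z i) 0 = - \<infinity> \<or>
      t_inv R M 0 + ereal (real (i * c)) \<le> t_inv R (Z i) 0 \<or>
      ereal (real c) \<le> max (slope R M) (ereal (real (1 + i)) * Rate R)"
  shows "slope R (Z i) \<le> max (slope R M) (ereal (real (1 + i)) * Rate R)"
proof (cases "Rate R = \<infinity>")
  case True
  then show ?thesis by simp
next
  case False
  then obtain \<rho> where \<rho>: "Rate R = ereal \<rho>" "1 \<le> \<rho>" using Rate_ge_1 by (cases "Rate R") auto
  have "max (slope R M) (ereal (real (1 + i)) * Rate R) \<noteq> \<infinity>" using sc \<rho> by (auto simp: max_def)
  moreover have "max (slope R M) (ereal (real (1 + i)) * Rate R) \<noteq> - \<infinity>" using \<rho> by (auto simp: max_def)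
  ultimately obtain \<beta> where \<beta>: "max (slope R M) (ereal (real (1 + i)) * Rate R) = ereal \<beta>"
    by (cases "max (slope R M) (ereal (real (1 + i)) * Rate R)") auto
  have s\<beta>: "slope R M \<le> ereal \<beta>" and "ereal (real (1 + i)) * Rate R \<le> ereal \<beta>"
    unfolding \<beta>[symmetric] by (rule max.cobounded1 max.cobounded2)+
  then have \<rho>\<beta>: "(1 + real i) * \<rho> \<le> \<beta>" using \<rho> by simp
  have main: "(t_inv R (Z i) a - t_inv R (Z i) 0) / ereal (real a) \<le> ereal \<beta>"
    if a: "0 < a" "t_inv R (Z i) a \<noteq> - \<infinity>" for a
  proof -
    obtain j where j: "\<not> vanishes G (Z i) a j" using a(2) t_inv_minf[OF gmod_Z] by blast
    then have "i \<le> D" using cycles_beyond_top by (meson not_le)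
    obtain t where t: "\<not> vanishes G M 0 t" "t_inv R M 0 = ereal (real_of_int t)"
      using M_zero_or_max cycles_vanish j by blast
    have "\<exists>k. \<not> vanishes G (Z i) 0 k"
      using cycles_generator_above[OF _ t(1), of i] top_cycles_bound[of a j] j \<open>i \<le> D\<close> by (cases "i = D") auto
    then obtain k0 where "\<not> vanishes G (Z i) 0 k0" by blast
    then have "t_inv R (Z i) 0 \<noteq> - \<infinity>" using Z_ge[of i 0 k0] by auto
    moreover have "t_inv R (Z i) 0 \<noteq> \<infinity>"
      using t_inv_cycles_le[OF sc, of i 0] \<rho> t by (auto simp: max_def zero_ereal_def[symmetric] split: if_splits)
    ultimately obtain z where z: "t_inv R (Z i) 0 = ereal z" by (cases "t_inv R (Z i) 0") auto
    have ai: "real (a + i) * \<rho> \<le> real a * \<beta>"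
    proof -
      have "real a + real i \<le> real a * (1 + real i)" 
        using a(1) mult_right_mono[of 1 "real a" "real i"] by (simp add: algebra_simps)
      then have "(real a + real i) * \<rho> \<le> real a * (1 + real i) * \<rho>" using \<rho>(2) by (intro mult_right_mono) auto
      also have "\<dots> \<le> real a * \<beta>" using \<rho>\<beta> mult_left_mono[OF \<rho>\<beta>, of "real a"] by (simp add: mult.assoc)
      finally show ?thesis by simp
    qed
    have as: "ereal (real a) * slope R M \<le> ereal (real a * \<beta>)"
      using ereal_mult_left_mono[OF s\<beta>, of "ereal (real a)"] by simp
    have "t_inv R (Z i) a \<le> ereal (z + real a * \<beta>)"
    proof (cases "t_inv R M 0 + ereal (real (i * c)) \<le> t_inv R (Z i) 0")
      case True
      have "max (ereal (real a) * slope R M) (ereal (real (a + i)) * Rate R) \<le> ereal (real a * \<beta>)"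
        using as ai by (simp add: \<rho>(1))
      then have "t_inv R M 0 + ereal (real (i * c)) + max (ereal (real a) * slope R M) (ereal (real (a + i)) * Rate R)
          \<le> t_inv R (Z i) 0 + ereal (real a * \<beta>)"
        by (intro add_mono True)
      then show ?thesis using t_inv_cycles_le[OF sc, of i a] z by simp
    next
      case False
      have "i = D"
      proof (rule ccontr)
        assume "i \<noteq> D"
        then obtain k where k: "k \<ge> t + int (i * c)" "\<not> vanishes G (Z i) 0 k"
          using cycles_generator_above[OF _ t(1), of i] \<open>i \<le> D\<close> by auto
        have "real_of_int (t + int (i * c)) \<le> real_of_int k"
          using k(1) by (simp only: of_int_le_iff)
        then have "t_inv R M 0 + ereal (real (i * c)) \<le> ereal (real_of_int k)"
          by (simp add: t(2))
        also have "\<dots> \<le> t_inv R (Z i) 0" by (rule Z_ge[OF k(2)])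
        finally show False using False by blast
      qed
      then have "ereal (real c) \<le> ereal \<beta>" using top False z unfolding \<beta> by auto
      then have c\<beta>: "real c \<le> \<beta>" by simp
      show ?thesis
      proof (rule t_inv_le[OF gmod_Z])
        fix j assume "\<not> vanishes G (Z i) a j"
        then obtain b k where b: "b \<in> basis G a" and k: "\<not> vanishes G (Z i) 0 k" "j < k + int c + deg G a b"
          using top_cycles_bound \<open>i = D\<close> by blast
        have kz: "real_of_int k \<le> z" using Z_ge[OF k(1)] z by simp
        obtain a' where a': "a = Suc a'" using a(1) gr0_implies_Suc by blast
        have "real_of_int (deg G a b) \<le> 1 + real a' * \<rho>"
          using deg_le_Rate[of b a'] b by (simp add: a' \<rho>(1) one_ereal_def)
        moreover have "real a' * \<rho> \<le> real a' * \<beta>"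
        proof (rule mult_left_mono)
          have "\<rho> \<le> (1 + real i) * \<rho>" using \<rho>(2) by (simp add: algebra_simps)
          then show "\<rho> \<le> \<beta>" using \<rho>\<beta> by simp
        qed simp
        moreover have "real_of_int j + 1 \<le> real_of_int k + real c + real_of_int (deg G a b)"
          using k(2) by linarith
        ultimately have "real_of_int j \<le> z + real a * \<beta>"
          using kz c\<beta> by (simp add: a' algebra_simps)
        then show "ereal (real_of_int j) \<le> ereal (z + real a * \<beta>)" by simp
      qed
    qed
    then have "t_inv R (Z i) a - ereal z \<le> ereal (real a * \<beta>)"
      by (cases "t_inv R (Z i) a") auto
    then show ?thesis using a(1) unfolding z by (simp add: ereal_divide_le_pos)
  qed
  show ?thesis unfolding slope_def[of R "Z i"] \<beta>
  proof (rule Sup_least)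
    fix x
    assume "x \<in> {(t_inv R (Z i) a - t_inv R (Z i) 0) / ereal (real a) | a. 0 < a \<and> t_inv R (Z i) a \<noteq> - \<infinity>}"
    then obtain a where "x = (t_inv R (Z i) a - t_inv R (Z i) 0) / ereal (real a)" "0 < a"
      "t_inv R (Z i) a \<noteq> - \<infinity>" by blast
    then show "x \<le> ereal \<beta>" using main by simp
  qed
qed

lemma t_inv_cycles_le_Koszul:
  assumes rate: "Rate R = 1"
  shows "t_inv R (Z i) a \<le> ereal (real a) + ereal (real (i * (c + 1))) + regularity R M"
proof -
  define \<phi> where "\<phi> a i = ereal (real a) + ereal (real (i * (c + 1))) + regularity R M" for a i
  have \<phi>M: "ereal (real_of_int (j + int (i * c))) \<le> \<phi> a i" if "\<not> vanishes G M a j" for a i j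
  proof -
    have "ereal (real_of_int j) - ereal (real a) \<le> t_inv R M a - ereal (real a)"
      using M_ge[OF that] by (rule ereal_minus_mono) simp
    also have "\<dots> \<le> regularity R M" unfolding regularity_def by (rule SUP_upper) simp
    finally show ?thesis by (cases "regularity R M") (simp_all add: \<phi>_def algebra_simps)
  qed
  have \<phi>Suc: "\<phi> (Suc a) i \<le> \<phi> a (Suc i)" for a i
    by (cases "regularity R M") (simp_all add: \<phi>_def algebra_simps)
  have \<phi>H: "\<phi> 0 i + ereal (real_of_int (int c - 1 + deg G (Suc (Suc a)) b)) \<le> \<phi> a (Suc i)"
    if b: "b \<in> basis G (Suc (Suc a))" for a i b
  proof -
    have "real_of_int (deg G (Suc (Suc a)) b) \<le> real a + 2"
      using deg_le_Rate[OF b] by (simp add: rate one_ereal_def)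
    then show ?thesis by (cases "regularity R M") (simp_all add: \<phi>_def algebra_simps)
  qed
  have "t_inv R (Z i) a \<le> \<phi> a i"
    by (rule t_inv_le[OF gmod_Z cycles_bound]) (use \<phi>M \<phi>Suc \<phi>H in auto)
  then show ?thesis by (simp only: \<phi>_def)
qed

lemma regularity_cycles_le:
  assumes rate: "Rate R = 1"
  shows "regularity R (Z i) \<le> ereal (real (i * (c + 1))) + regularity R M"
  unfolding regularity_def[of R "Z i"]
proof (rule SUP_least)
  fix a
  have "t_inv R (Z i) a \<le> ereal (real a) + ereal (real (i * (c + 1))) + regularity R M"
    by (rule t_inv_cycles_le_Koszul[OF rate])
  then show "t_inv R (Z i) a - ereal (real a) \<le> ereal (real (i * (c + 1))) + regularity R M"
    by (cases "regularity R M"; cases "t_inv R (Z i) a") auto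
qed

end

end

theorem proposition2p4:
  fixes R :: "('k::field, 'r::comm_ring_1) grad_alg"
    and M :: "('r, 'm::ab_group_add) grad_mod"
    and c D :: nat and u :: "nat \<Rightarrow> 'r"
  assumes "standard_graded R"
    and "graded_module R M" and "fin_gen M"
    and "c \<ge> 1"
    and "K_basis R c D u"
  shows
    "(slope R M \<le> ereal (real c) \<longrightarrow>
       (\<forall>a i. t_inv R (koszul_cycles M c D u i) a \<le>
                t_inv R M 0 + ereal (real (i * c)) +
                max (ereal (real a) * slope R M) (ereal (real (a + i)) * Rate R)) \<and>
       (\<forall>i. (i = D \<longrightarrow>
               t_inv R (koszul_cycles M c D u i) 0 = -\<infinity> \<or>
               t_inv R M 0 + ereal (real (i * c)) \<le> t_inv R (koszul_cycles M c D u i) 0 \<or>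
               ereal (real c) \<le> max (slope R M) (ereal (real (1 + i)) * Rate R)) \<longrightarrow>
            slope R (koszul_cycles M c D u i) \<le>
              max (slope R M) (ereal (real (1 + i)) * Rate R))) \<and>
     (Rate R = 1 \<longrightarrow>
       (\<forall>a i. t_inv R (koszul_cycles M c D u i) a \<le>
                ereal (real a) + ereal (real (i * (c + 1))) + regularity R M) \<and>
       (\<forall>i. regularity R (koszul_cycles M c D u i) \<le>
              ereal (real (i * (c + 1))) + regularity R M))"
proof -
  interpret std_graded R by unfold_locales (rule assms(1))
  obtain G where "residue_resolution R G" using ex_residue_resolution by blast
  then interpret residue_resolution R G .
  interpret koszul_setting R G M c D u
    by unfold_locales (rule graded_module_gmod[OF assms(2)], rule assms(5))
  obtain k l where kl: "\<And>j. j < k \<Longrightarrow> piece M j = {0}" "\<And>j. l < j \<Longrightarrow> piece M j \<subseteq> mpart M j"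
    "countably_spanned M"
    using fin_gen_bounds[OF assms(2,3)] by metis
  show ?thesis
    unfolding koszul_cycles_Z
  proof (intro conjI impI allI)
    fix a i assume "slope R M \<le> ereal (real c)"
    with kl show "t_inv R (Z i) a \<le> t_inv R M 0 + ereal (real (i * c)) +
        max (ereal (real a) * slope R M) (ereal (real (a + i)) * Rate R)"
      by (rule t_inv_cycles_le)
  next
    fix i assume sc: "slope R M \<le> ereal (real c)"
      and top: "i = D \<longrightarrow> t_inv R (Z i) 0 = - \<infinity> \<or>
        t_inv R M 0 + ereal (real (i * c)) \<le> t_inv R (Z i) 0 \<or>
        ereal (real c) \<le> max (slope R M) (ereal (real (1 + i)) * Rate R)"
    from kl sc top[THEN mp] show "slope R (Z i) \<le> max (slope R M) (ereal (real (1 + i)) * Rate R)"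
      by (rule slope_cycles_le)
  next
    fix a i assume "Rate R = 1"
    with kl show "t_inv R (Z i) a \<le> ereal (real a) + ereal (real (i * (c + 1))) + regularity R M"
      by (rule t_inv_cycles_le_Koszul)
  next
    fix i assume "Rate R = 1"
    with kl show "regularity R (Z i) \<le> ereal (real (i * (c + 1))) + regularity R M"
      by (rule regularity_cycles_le)
  qed
qed

end
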